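(* Let $v:\mathbb X\times\mathbb X\to[0,\infty]$ be a measurable symmetric pair potential (so $v\ge0$) and $z:\mathbb X\to[0,\infty)$ measurable with $\int_B z\,d\lambda<\infty$ for all $B\in\mathcal X_{\mathsf b}$. Suppose there exists a measurable $a:\mathbb X\to[0,\infty)$ such that for $\lambda$-almost all $x_0\in\mathbb X$, $$\sum_{k=1}^\infty\frac{1}{k!}\int_{\mathbb X^k}\prod_{j=1}^k|f(x_0,y_j)|\prod_{1\le i<j\le k}\bigl(1+f(y_i,y_j)\bigr)\prod_{j=1}^k z(y_j)e^{a(y_j)}\,d\lambda^k(\mathbf y)\le e^{a(x_0)}-1.$$ Then for $\lambda$-almost all $x_0\in\mathbb X$, $$\sum_{n=1}^\infty\frac1{n!}\int_{\mathbb X^n}|\varphi_{n+1}^{\mathsf T}(x_0,x_1,\dots,x_n)|\,d\lambda_z(x_1)\cdots d\lambda_z(x_n)\le e^{a(x_0)}-1.$$ Moreover, for every $\Lambda\in\mathcal X_{\mathsf b}$ with $\lambda_z(\Lambda)>0$ and every measurable $h:\Lambda\to[0,\infty]$ (or $h$ complex-valued with non-negative real part) with $\int_\Lambda|e^{-h}-1|e^a\,d\lambda_z<\infty$, $$\log\mathsf E_\Lambda\Bigl[e^{-\int_\Lambda h\,d\eta}\Bigr]=\sum_{n=1}^\infty\frac1{n!}\int_{\Lambda^n}\Bigl(e^{-\sum_{j=1}^nh(x_j)}-1\Bigr)\varphi_n^{\mathsf T}(x_1,\dots,x_n)\,d\lambda_z^n(\mathbf x).$$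
   Context: $(\mathbb X,\mathrm{dist})$ is a complete separable metric space with Borel $\sigma$-algebra $\mathcal X$, $\mathcal X_{\mathsf b}$ the bounded Borel sets, $\lambda$ a measure finite on bounded sets; $\lambda_z(dx)=z(x)\lambda(dx)$; $f(x,y)=e^{-v(x,y)}-1$ (with $e^{-\infty}=0$). The Ursell function is $\varphi_n^{\mathsf T}(x_1,\dots,x_n)=\sum_{G\in\mathcal C_n}\prod_{\{i,j\}\in E(G)}f(x_i,x_j)$, where $\mathcal C_n$ is the set of connected simple graphs on vertex set $\{1,\dots,n\}$. For bounded $\Lambda$ with $\lambda_z(\Lambda)>0$, the finite-volume Gibbs measure with empty boundary conditions $\mathsf P_\Lambda$ (expectation $\mathsf E_\Lambda$) is the probability measure on locally finite counting measures supported in $\Lambda$ given by $\mathsf E_\Lambda[F]=\Xi_\Lambda(z)^{-1}\bigl(F(0)+\sum_{n\ge1}\frac1{n!}\int_{\Lambda^n}F(\delta_{x_1}+\dots+\delta_{x_n})e^{-\sum_{1\le i<j\le n}v(x_i,x_j)}\,d\lambda_z^n(\mathbf x)\bigr)$, where $\Xi_\Lambda(z)=1+\sum_{n\ge1}\frac1{n!}\int_{\Lambda^n}e^{-\sum_{i<j}v(x_i,x_j)}\,d\lambda_z^n(\mathbf x)$; equivalently it is absolutely continuous w.r.t. the Poisson point process with intensity $\mathbf 1_\Lambda\lambda_z$ with density proportional to $e^{-\sum_{i<j}v(x_i,x_j)}$. *)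

theory Defs
  imports "HOL-Analysis.Analysis"
begin

text \<open>Mayer function f(x,y) = e^{-v(x,y)} - 1, with e^{-\<infinity>} = 0.\<close>
definition emexp :: "ennreal \<Rightarrow> real" where
  "emexp t = (if t = \<infinity> then 0 else exp (- enn2real t))"

definition mayer :: "('a \<Rightarrow> 'a \<Rightarrow> ennreal) \<Rightarrow> 'a \<Rightarrow> 'a \<Rightarrow> real" where
  "mayer v x y = emexp (v x y) - 1"

text \<open>Simple graphs on vertex set {0..<n}: sets of 2-element subsets.\<close>
definition graph_edges :: "nat \<Rightarrow> nat set set" where
  "graph_edges n = {e. e \<subseteq> {..<n} \<and> card e = 2}"

definition graph_connected :: "nat \<Rightarrow> nat set set \<Rightarrow> bool" where
  "graph_connected n E \<longleftrightarrow>
     (\<forall>i<n. \<forall>j<n. (i, j) \<in> {(a, b). {a, b} \<in> E}\<^sup>*)"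

definition connected_graphs :: "nat \<Rightarrow> nat set set set" where
  "connected_graphs n = {E. E \<subseteq> graph_edges n \<and> graph_connected n E}"

text \<open>Ursell function \<phi>_n^T(x_0,...,x_{n-1}) (vertices indexed 0..n-1).\<close>
definition ursell :: "('a \<Rightarrow> 'a \<Rightarrow> real) \<Rightarrow> nat \<Rightarrow> (nat \<Rightarrow> 'a) \<Rightarrow> real" where
  "ursell f n x = (\<Sum>G\<in>connected_graphs n. \<Prod>e\<in>G. f (x (Min e)) (x (Max e)))"

text \<open>Boltzmann factor e^{-\<Sum>_{i<j<n} v(x_i,x_j)}.\<close>
definition boltzmann :: "('a \<Rightarrow> 'a \<Rightarrow> ennreal) \<Rightarrow> nat \<Rightarrow> (nat \<Rightarrow> 'a) \<Rightarrow> real" where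
  "boltzmann v n x = (\<Prod>j<n. \<Prod>i<j. emexp (v (x i) (x j)))"

text \<open>\<lambda>_z\<close>
definition weighted :: "'a measure \<Rightarrow> ('a \<Rightarrow> real) \<Rightarrow> 'a measure" where
  "weighted lam z = density lam (\<lambda>x. ennreal (z x))"

text \<open>Grand partition function \<Xi>_\<Lambda>(z).\<close>
definition partition_fn :: "'a measure \<Rightarrow> ('a \<Rightarrow> real) \<Rightarrow> ('a \<Rightarrow> 'a \<Rightarrow> ennreal) \<Rightarrow> 'a set \<Rightarrow> real" where
  "partition_fn lam z v \<Lambda> = 1 + (\<Sum>n. (1 / fact (Suc n)) *
      (LINT x : (PiE {..<Suc n} (\<lambda>_. \<Lambda>)) | PiM {..<Suc n} (\<lambda>_. weighted lam z).
          boltzmann v (Suc n) x))"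

text \<open>Expectation under the finite-volume Gibbs measure P_\<Lambda> with empty boundary
  conditions of a functional F of the configuration; F n x is the value at
  \<delta>_{x_0} + ... + \<delta>_{x_{n-1}} (F 0 _ is the value at the empty configuration).\<close>
definition gibbs_expect ::
  "'a measure \<Rightarrow> ('a \<Rightarrow> real) \<Rightarrow> ('a \<Rightarrow> 'a \<Rightarrow> ennreal) \<Rightarrow> 'a set
     \<Rightarrow> (nat \<Rightarrow> (nat \<Rightarrow> 'a) \<Rightarrow> 'b::{banach, second_countable_topology}) \<Rightarrow> 'b" where
  "gibbs_expect lam z v \<Lambda> F = inverse (partition_fn lam z v \<Lambda>) *\<^sub>R
     (F 0 (\<lambda>_. undefined) + (\<Sum>n. (1 / fact (Suc n)) *\<^sub>R
      (LINT x : (PiE {..<Suc n} (\<lambda>_. \<Lambda>)) | PiM {..<Suc n} (\<lambda>_. weighted lam z).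
          boltzmann v (Suc n) x *\<^sub>R F (Suc n) x)))"

end

(* Let psi(A; V) be the sum, over the graphs on A + V in which every vertex of V is connected to A, of
   the products of Mayer weights; the Ursell function is the case of a single root. Removing a root
   y from A and summing over the set S of its neighbours in V gives the Kirkwood-Salsburg recursion
     psi(A; V) = prod_{s in A - y} (1 + f(y,s)) * sum_{S <= V} prod_{s in S} f(y,s) * psi(A - y + S; V - S).
   Since 0 <= 1 + f <= 1, induction on this recursion propagates the bound
     prod_{pairs in A} (1 + f) * prod_{i in A} exp(a(x_i))
   for the integrated |psi(A; .)|, and the hypothesis on a is exactly what the induction step needs.

   Splitting off the component of one vertex gives the recursion of the coefficients of the
   partition function in terms of those of the Ursell series, which is the power series identity
   Xi' = L' Xi, so Xi = exp(L) under absolute convergence. As exp(a) need not be integrable on the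
   volume, this is applied to {a <= m} and to the quotient of two partition functions, and m tends
   to infinity by dominated convergence. *)
theory Submission
  imports Defs
begin

subsection \<open>Rooted graph sums\<close>

text \<open>The recursion leaves the single-root case: neighbours of a removed root become roots
  themselves, which forces arbitrary finite root sets A. The factor prod (1 + f) over pairs of roots
  has to be carried in the bound: restricted to the new roots S it supplies the factor prod (1 +
  f(y_i,y_j)) of the hypothesis. Repulsion enters twice: 1 + f >= 0 lets absolute values pass the
  product over the old roots, and 1 + f <= 1 lets the interactions between old and new roots be
  dropped. The identity Xi = exp(L) is needed at the point 1, where the series of L is only known to
  converge absolutely, with no larger radius available. It is proved inside the unit disc, where
  differentiation is legitimate, and carried to the boundary by dominated convergence. Only |exp(-h)
  - 1| exp(a) is integrable. Telescoping a difference of two products of weights isolates one such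
  factor; its n + 1 possible positions turn 1/(n+1)! into 1/n!, the weight in the bound on the
  rooted integrals.\<close>

definition pair_edges :: "'i set \<Rightarrow> 'i set set" where
  "pair_edges U = {e. e \<subseteq> U \<and> card e = 2}"

definition edge_rel :: "'i set set \<Rightarrow> ('i \<times> 'i) set" where
  "edge_rel E = {(a, b). {a, b} \<in> E}"

text \<open>Edges between two roots are unconstrained, and roots need not be connected to each
  other. For nonempty A the condition says that the graph becomes connected once A is contracted to
  a point.\<close>

definition rooted_graphs :: "'i set \<Rightarrow> 'i set \<Rightarrow> 'i set set set" where
  "rooted_graphs A V = {E. E \<subseteq> pair_edges (A \<union> V) \<and> (\<forall>v\<in>V. \<exists>a\<in>A. (v, a) \<in> (edge_rel E)\<^sup>*)}"

definition rooted_sum :: "('i set \<Rightarrow> 'b::comm_semiring_1) \<Rightarrow> 'i set \<Rightarrow> 'i set \<Rightarrow> 'b" where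
  "rooted_sum w A V = (\<Sum>E\<in>rooted_graphs A V. \<Prod>e\<in>E. w e)"

text \<open>Expanded, this is the sum over all graphs on U without any connectivity condition; for
  Mayer weights it is the Boltzmann factor.\<close>

definition edge_weight_prod :: "('i set \<Rightarrow> 'b::comm_semiring_1) \<Rightarrow> 'i set \<Rightarrow> 'b" where
  "edge_weight_prod w U = (\<Prod>e\<in>pair_edges U. 1 + w e)"

section \<open>Pairs, stars at a vertex, and products over all pairs\<close>

lemma finite_pair_edges [simp]: "finite U \<Longrightarrow> finite (pair_edges U)"
  unfolding pair_edges_def by (rule finite_subset[of _ "Pow U"]) auto

lemma pair_edges_empty [simp]: "pair_edges {} = {}"
  by (auto simp: pair_edges_def)

lemma pair_edges_singleton [simp]: "pair_edges {a} = {}"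
  by (auto simp: pair_edges_def card_2_iff)

lemma pair_in_pair_edges [simp]: "{a, b} \<in> pair_edges U \<longleftrightarrow> a \<in> U \<and> b \<in> U \<and> a \<noteq> b"
  by (auto simp: pair_edges_def card_2_iff doubleton_eq_iff)

lemma singleton_notin_pair_edges [simp]: "{a} \<notin> pair_edges U"
  by (simp add: pair_edges_def)

lemma pair_edgesE:
  assumes "e \<in> pair_edges U" obtains a b where "e = {a, b}" "a \<noteq> b" "a \<in> U" "b \<in> U"
  using assms by (auto simp: pair_edges_def card_2_iff)

lemma pair_edgesE_at:
  assumes "e \<in> pair_edges U" "y \<in> e" obtains s where "e = {y, s}" "s \<noteq> y" "s \<in> U"
proof -
  obtain a b where ab: "e = {a, b}" "a \<noteq> b" "a \<in> U" "b \<in> U" using assms by (elim pair_edgesE)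
  with assms(2) have "y = a \<or> y = b" by auto
  then show thesis using ab that by (metis insert_commute)
qed

lemma finite_rooted_graphs: "finite (A \<union> V) \<Longrightarrow> finite (rooted_graphs A V)"
  unfolding rooted_graphs_def by (rule finite_subset[of _ "Pow (pair_edges (A \<union> V))"]) auto

lemma pair_edges_insert:
  assumes "y \<notin> U" shows "pair_edges (insert y U) = pair_edges U \<union> (\<lambda>s. {y, s}) ` U"
proof (intro equalityI subsetI)
  fix e assume e: "e \<in> pair_edges (insert y U)"
  show "e \<in> pair_edges U \<union> (\<lambda>s. {y, s}) ` U"
  proof (cases "y \<in> e")
    case True with e show ?thesis by (auto elim!: pair_edgesE_at)
  next
    case False with e show ?thesis by (auto simp: pair_edges_def)
  qed
next
  fix e assume "e \<in> pair_edges U \<union> (\<lambda>s. {y, s}) ` U"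
  then show "e \<in> pair_edges (insert y U)"
    using assms by (auto simp: pair_edges_def card_2_iff)
qed

lemma inj_on_star: "y \<notin> T \<Longrightarrow> inj_on (\<lambda>s. {y, s}) T"
  by (auto simp: inj_on_def doubleton_eq_iff)

lemma edge_weight_prod_empty [simp]: "edge_weight_prod w {} = 1"
  by (simp add: edge_weight_prod_def)

lemma edge_weight_prod_singleton [simp]: "edge_weight_prod w {a} = 1"
  by (simp add: edge_weight_prod_def)

lemma edge_weight_prod_insert:
  assumes "finite U" "y \<notin> U"
  shows "edge_weight_prod w (insert y U) = (\<Prod>s\<in>U. 1 + w {y, s}) * edge_weight_prod w U"
proof -
  have "pair_edges U \<inter> (\<lambda>s. {y, s}) ` U = {}" using assms(2) by (auto simp: pair_edges_def)
  then have "edge_weight_prod w (insert y U) = edge_weight_prod w U * (\<Prod>e\<in>(\<lambda>s. {y, s}) ` U. 1 + w e)"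
    unfolding edge_weight_prod_def pair_edges_insert[OF assms(2)]
    using assms by (subst prod.union_disjoint) auto
  also have "(\<Prod>e\<in>(\<lambda>s. {y, s}) ` U. 1 + w e) = (\<Prod>s\<in>U. 1 + w {y, s})"
    using inj_on_star[OF assms(2)] by (simp add: prod.reindex)
  finally show ?thesis by (simp add: mult.commute)
qed

lemma prod_one_plus:
  fixes g :: "'i \<Rightarrow> 'b::comm_semiring_1"
  assumes "finite A" shows "(\<Prod>x\<in>A. 1 + g x) = (\<Sum>X\<in>Pow A. \<Prod>x\<in>X. g x)"
  using prod_add[OF assms, of g "\<lambda>_. 1"] by (simp add: add.commute)

text \<open>A path from V to A is followed until it first meets y. The vertex before y is a
  neighbour of y, and making these neighbours roots keeps everything reachable; conversely a
  neighbour reaches A through y. Neighbours inside A are roots already, so only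
  \<open>N \<inter> V\<close> is added.\<close>

lemma rooted_graphs_remove_root:
  assumes "y \<in> A" "A \<inter> V = {}" "E \<subseteq> pair_edges (A \<union> V)"
  defines "N \<equiv> {s. {y, s} \<in> E}" and "E' \<equiv> {e\<in>E. y \<notin> e}"
  shows "E \<in> rooted_graphs A V \<longleftrightarrow> E' \<in> rooted_graphs (A - {y} \<union> (N \<inter> V)) (V - N)"
proof -
  have y: "y \<notin> V" using assms by auto
  have N: "N \<subseteq> A - {y} \<union> V" unfolding N_def using assms(3) by (auto dest!: subsetD)
  have E': "E' \<subseteq> pair_edges (A - {y} \<union> (N \<inter> V) \<union> (V - N))"
    using assms(3) y unfolding E'_def pair_edges_def by auto
  have sub: "edge_rel E' \<subseteq> edge_rel E" unfolding edge_rel_def E'_def by auto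
  have reach: "\<exists>b\<in>A - {y} \<union> (N \<inter> V). (u, b) \<in> (edge_rel E')\<^sup>*"
    if "(u, a) \<in> (edge_rel E)\<^sup>*" "a \<in> A" "u \<noteq> y" for u a
    using that(1,3)
  proof (induction rule: converse_rtrancl_induct)
    case base then show ?case using that by auto
  next
    case (step u u')
    have ed: "{u, u'} \<in> E" using step by (auto simp: edge_rel_def)
    then have uin: "u \<in> A \<union> V" using assms(3) by (auto dest!: subsetD)
    show ?case
    proof (cases "u' = y")
      case True
      then have "u \<in> N" using ed by (auto simp: N_def insert_commute)
      then show ?thesis using uin step.prems by auto
    next
      case False
      then have "(u, u') \<in> edge_rel E'" using ed step.prems by (auto simp: edge_rel_def E'_def)
      moreover obtain b where "b\<in>A - {y} \<union> (N \<inter> V)" "(u', b) \<in> (edge_rel E')\<^sup>*"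
        using step.IH False by auto
      ultimately show ?thesis by (meson converse_rtrancl_into_rtrancl)
    qed
  qed
  show ?thesis
  proof
    assume "E \<in> rooted_graphs A V"
    then have *: "\<And>v. v \<in> V \<Longrightarrow> \<exists>a\<in>A. (v, a) \<in> (edge_rel E)\<^sup>*" by (auto simp: rooted_graphs_def)
    show "E' \<in> rooted_graphs (A - {y} \<union> (N \<inter> V)) (V - N)"
      unfolding rooted_graphs_def using E'
    proof (intro CollectI conjI ballI)
      fix v assume "v \<in> V - N"
      then show "\<exists>a\<in>A - {y} \<union> N \<inter> V. (v, a) \<in> (edge_rel E')\<^sup>*"
        using * reach y by (metis DiffE)
    qed
  next
    assume "E' \<in> rooted_graphs (A - {y} \<union> (N \<inter> V)) (V - N)"
    then have *: "\<And>v. v \<in> V - N \<Longrightarrow> \<exists>a\<in>A - {y} \<union> (N \<inter> V). (v, a) \<in> (edge_rel E')\<^sup>*"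
      by (auto simp: rooted_graphs_def)
    have Ny: "(s, y) \<in> (edge_rel E)\<^sup>*" if "s \<in> N" for s
      using that by (auto simp: N_def edge_rel_def insert_commute)
    have "\<exists>a\<in>A. (v, a) \<in> (edge_rel E)\<^sup>*" if v: "v \<in> V" for v
    proof (cases "v \<in> N")
      case True then show ?thesis using Ny assms(1) by blast
    next
      case False
      then obtain a where a: "a\<in>A - {y} \<union> (N \<inter> V)" "(v, a) \<in> (edge_rel E')\<^sup>*" using * v by auto
      have va: "(v, a) \<in> (edge_rel E)\<^sup>*" using a(2) rtrancl_mono[OF sub] by auto
      show ?thesis
      proof (cases "a \<in> A")
        case True then show ?thesis using va by auto
      next
        case False
        then have "a \<in> N" using a by auto
        then show ?thesis using va Ny assms(1) by (meson rtrancl_trans)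
      qed
    qed
    then show "E \<in> rooted_graphs A V" using assms(3) by (auto simp: rooted_graphs_def)
  qed
qed

text \<open>A graph is encoded by the neighbourhood N of y together with what is left after deleting
  y; the bijection glues the star from y to N back on.\<close>

lemma rooted_sum_remove_root_all_neighbours:
  assumes fin: "finite A" "finite V" and y: "y \<in> A" and disj: "A \<inter> V = {}"
  shows "rooted_sum w A V = (\<Sum>N\<in>Pow (A - {y} \<union> V).
     (\<Prod>s\<in>N. w {y, s}) * rooted_sum w (A - {y} \<union> (N \<inter> V)) (V - N))"
proof -
  let ?st = "\<lambda>N. (\<lambda>s. {y, s}) ` N"
  let ?R = "\<lambda>N. rooted_graphs (A - {y} \<union> (N \<inter> V)) (V - N)"
  have yV: "y \<notin> V" using y disj by auto
  have U: "A - {y} \<union> (N \<inter> V) \<union> (V - N) = A - {y} \<union> V" for N by auto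
  have noty: "y \<notin> e" if "E' \<in> ?R N" "e \<in> E'" for E' N e
    using that yV unfolding rooted_graphs_def U by (auto simp: pair_edges_def)
  have finE: "finite E'" if "E' \<in> ?R N" for E' N
    using that fin unfolding rooted_graphs_def U by (auto elim: finite_subset)
  have "(\<Sum>N\<in>Pow (A - {y} \<union> V). (\<Prod>s\<in>N. w {y, s}) * rooted_sum w (A - {y} \<union> (N \<inter> V)) (V - N))
     = (\<Sum>N\<in>Pow (A - {y} \<union> V). \<Sum>E'\<in>?R N. (\<Prod>s\<in>N. w {y, s}) * (\<Prod>e\<in>E'. w e))"
    by (simp add: rooted_sum_def sum_distrib_left)
  also have "\<dots> = (\<Sum>(N, E')\<in>Sigma (Pow (A - {y} \<union> V)) ?R. (\<Prod>s\<in>N. w {y, s}) * (\<Prod>e\<in>E'. w e))"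
    using fin by (intro sum.Sigma) (auto intro!: finite_rooted_graphs)
  also have "\<dots> = (\<Sum>E\<in>rooted_graphs A V. \<Prod>e\<in>E. w e)"
  proof (rule sum.reindex_bij_witness[where i = "\<lambda>E. ({s. {y, s} \<in> E}, {e\<in>E. y \<notin> e})"
        and j = "\<lambda>(N, E'). ?st N \<union> E'"])
    fix q assume q: "q \<in> Sigma (Pow (A - {y} \<union> V)) ?R"
    obtain N E' where q': "q = (N, E')" by force
    have N: "N \<subseteq> A - {y} \<union> V" and E': "E' \<in> ?R N" using q q' by auto
    have yN: "y \<notin> N" using N yV by auto
    have *: "{s. {y, s} \<in> ?st N \<union> E'} = N"
      using noty[OF E'] by (auto simp: doubleton_eq_iff)
    have **: "{e \<in> ?st N \<union> E'. y \<notin> e} = E'" using noty[OF E'] by auto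
    show "({s. {y, s} \<in> (case q of (N, E') \<Rightarrow> ?st N \<union> E')}, {e \<in> case q of (N, E') \<Rightarrow> ?st N \<union> E'. y \<notin> e}) = q"
      using * ** q' by simp
    have sub: "?st N \<union> E' \<subseteq> pair_edges (A \<union> V)"
      using N y yN E' unfolding rooted_graphs_def U by (auto simp: pair_edges_def card_2_iff doubleton_eq_iff)
    show "(case q of (N, E') \<Rightarrow> ?st N \<union> E') \<in> rooted_graphs A V"
      using rooted_graphs_remove_root[OF y disj sub] E' q' by (simp only: * ** prod.case)
    have "finite N" using N fin by (auto elim: finite_subset)
    moreover have "?st N \<inter> E' = {}" using noty[OF E'] by auto
    ultimately have "(\<Prod>e\<in>?st N \<union> E'. w e) = (\<Prod>s\<in>N. w {y, s}) * (\<Prod>e\<in>E'. w e)"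
      using finE[OF E'] inj_on_star[OF yN] by (simp add: prod.union_disjoint prod.reindex)
    then show "prod w (case q of (N, E') \<Rightarrow> ?st N \<union> E') =
        (case q of (N, E') \<Rightarrow> (\<Prod>s\<in>N. w {y, s}) * prod w E')" using q' by simp
  next
    fix E assume E: "E \<in> rooted_graphs A V"
    then have sub: "E \<subseteq> pair_edges (A \<union> V)" by (auto simp: rooted_graphs_def)
    show "(case ({s. {y, s} \<in> E}, {e\<in>E. y \<notin> e}) of (N, E') \<Rightarrow> ?st N \<union> E') = E"
      using sub by (auto elim!: pair_edgesE_at[of _ "A \<union> V" y])
    have "{s. {y, s} \<in> E} \<subseteq> A - {y} \<union> V" using sub yV by (auto dest!: subsetD)
    then show "({s. {y, s} \<in> E}, {e\<in>E. y \<notin> e}) \<in> Sigma (Pow (A - {y} \<union> V)) ?R"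
      using rooted_graphs_remove_root[OF y disj sub] E by auto
  qed
  finally show ?thesis by (simp add: rooted_sum_def)
qed

lemma sum_Pow_Un_disjoint:
  fixes g :: "'i set \<Rightarrow> 'b::comm_monoid_add"
  assumes "finite A" "finite B" "A \<inter> B = {}"
  shows "(\<Sum>N\<in>Pow (A \<union> B). g N) = (\<Sum>S\<in>Pow B. \<Sum>T\<in>Pow A. g (T \<union> S))"
proof -
  have "(\<Sum>S\<in>Pow B. \<Sum>T\<in>Pow A. g (T \<union> S)) = (\<Sum>(S, T)\<in>Pow B \<times> Pow A. g (T \<union> S))"
    by (rule sum.cartesian_product)
  also have "\<dots> = (\<Sum>N\<in>Pow (A \<union> B). g N)"
    by (rule sum.reindex_bij_witness[where i = "\<lambda>N. (N \<inter> B, N \<inter> A)" and j = "\<lambda>(S, T). T \<union> S"])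
      (use assms in auto)
  finally show ?thesis ..
qed

text \<open>The Kirkwood--Salsburg recursion: condition on the set \<open>S\<close> of neighbours of the root \<open>y\<close>
  among the non-roots.\<close>
lemma rooted_sum_remove_root:
  assumes fin: "finite A" "finite V" and y: "y \<in> A" and disj: "A \<inter> V = {}"
  shows "rooted_sum w A V = (\<Prod>s\<in>A - {y}. 1 + w {y, s}) *
     (\<Sum>S\<in>Pow V. (\<Prod>s\<in>S. w {y, s}) * rooted_sum w (A - {y} \<union> S) (V - S))"
proof -
  have "rooted_sum w A V = (\<Sum>S\<in>Pow V. \<Sum>T\<in>Pow (A - {y}). (\<Prod>s\<in>T \<union> S. w {y, s}) *
      rooted_sum w (A - {y} \<union> ((T \<union> S) \<inter> V)) (V - (T \<union> S)))"
    unfolding rooted_sum_remove_root_all_neighbours[OF assms] by (rule sum_Pow_Un_disjoint) (use assms in auto)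
  \<comment> \<open>The neighbours T among the other roots leave the reduced problem unchanged, so
    their sum decouples and turns into the product of the factors 1 + w.\<close>
  also have "\<dots> = (\<Sum>S\<in>Pow V. \<Sum>T\<in>Pow (A - {y}). (\<Prod>s\<in>T. w {y, s}) *
      ((\<Prod>s\<in>S. w {y, s}) * rooted_sum w (A - {y} \<union> S) (V - S)))"
  proof (intro sum.cong refl)
    fix S T assume ST: "S \<in> Pow V" "T \<in> Pow (A - {y})"
    have "(\<Prod>s\<in>T \<union> S. w {y, s}) = (\<Prod>s\<in>T. w {y, s}) * (\<Prod>s\<in>S. w {y, s})"
      using ST fin disj by (intro prod.union_disjoint) (auto elim: finite_subset)
    moreover have "(T \<union> S) \<inter> V = S" "V - (T \<union> S) = V - S" using ST disj by auto
    ultimately show "(\<Prod>s\<in>T \<union> S. w {y, s}) * rooted_sum w (A - {y} \<union> ((T \<union> S) \<inter> V)) (V - (T \<union> S))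
      = (\<Prod>s\<in>T. w {y, s}) * ((\<Prod>s\<in>S. w {y, s}) * rooted_sum w (A - {y} \<union> S) (V - S))"
      by (simp add: mult.assoc)
  qed
  also have "\<dots> = (\<Prod>s\<in>A - {y}. 1 + w {y, s}) *
     (\<Sum>S\<in>Pow V. (\<Prod>s\<in>S. w {y, s}) * rooted_sum w (A - {y} \<union> S) (V - S))"
    using fin by (simp add: prod_one_plus sum_distrib_left sum_distrib_right)
  finally show ?thesis .
qed

text \<open>Without a root no vertex of V can be attached. This is the base case of every induction
  on the recursion.\<close>

lemma rooted_sum_no_roots: "rooted_sum w {} V = (if V = {} then 1 else 0)"
proof -
  have "rooted_graphs {} V = (if V = {} then {{}} else {})" by (auto simp: rooted_graphs_def)
  then show ?thesis by (simp add: rooted_sum_def)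
qed

lemma rooted_sum_singleton [simp]: "rooted_sum w {a} {} = 1"
proof -
  have "rooted_graphs {a} {} = {{}}" by (auto simp: rooted_graphs_def)
  then show ?thesis by (simp add: rooted_sum_def)
qed

text \<open>The pair (V, S) is replaced by (S, V - S), so that the newly exposed roots S can be
  chosen first and the remaining vertices afterwards.\<close>

lemma sum_Pow_Pow:
  fixes g :: "'i set \<Rightarrow> 'i set \<Rightarrow> 'b::comm_monoid_add"
  assumes "finite W"
  shows "(\<Sum>V\<in>Pow W. \<Sum>S\<in>Pow V. g S (V - S)) = (\<Sum>S\<in>Pow W. \<Sum>V\<in>Pow (W - S). g S V)"
proof -
  have "(\<Sum>V\<in>Pow W. \<Sum>S\<in>Pow V. g S (V - S)) = (\<Sum>(V, S)\<in>Sigma (Pow W) Pow. g S (V - S))"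
    using assms by (intro sum.Sigma) (auto intro: finite_subset)
  also have "\<dots> = (\<Sum>(S, V)\<in>Sigma (Pow W) (\<lambda>S. Pow (W - S)). g S V)"
    by (rule sum.reindex_bij_witness[where i = "\<lambda>(S, V). (S \<union> V, S)" and j = "\<lambda>(V, S). (S, V - S)"]) auto
  also have "\<dots> = (\<Sum>S\<in>Pow W. \<Sum>V\<in>Pow (W - S). g S V)"
    using assms by (intro sum.Sigma[symmetric]) (auto intro: finite_subset)
  finally show ?thesis .
qed

lemma Diff_Diff_left: "A - B - C = A - (B \<union> C)"
  by auto

text \<open>Combinatorially, V collects the vertices of X connected to A, and the rest of X carries
  an arbitrary graph with no edge to A or V. Instead of this bijection, the proof checks that both
  sides satisfy the same recursion when a root is removed.\<close>

lemma edge_weight_prod_Un: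
  assumes "finite A" "finite X" "A \<inter> X = {}"
  shows "edge_weight_prod w (A \<union> X) = (\<Sum>V\<in>Pow X. rooted_sum w A V * edge_weight_prod w (X - V))"
  using assms
proof (induction "card (A \<union> X)" arbitrary: A X rule: less_induct)
  case less
  show ?case
  proof (cases "A = {}")
    case True
    have "(\<Sum>V\<in>Pow X. rooted_sum w A V * edge_weight_prod w (X - V)) =
        (\<Sum>V\<in>Pow X. if V = {} then edge_weight_prod w X else 0)"
      using True by (intro sum.cong) (auto simp: rooted_sum_no_roots)
    also have "\<dots> = edge_weight_prod w X" using less.prems by (simp add: sum.delta)
    finally show ?thesis using True by simp
  next
    case False
    then obtain y where y: "y \<in> A" by auto
    let ?A = "A - {y}"
    let ?P = "\<Prod>s\<in>?A. 1 + w {y, s}"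
    let ?q = "\<lambda>S. \<Prod>s\<in>S. w {y, s}"
    have yX: "y \<notin> X" using y less.prems by auto
    \<comment> \<open>The left side does not depend on S: the same product is expanded with a
      different root set for each S, namely the one that the recursion for A produces.\<close>
    have IH: "edge_weight_prod w (?A \<union> X) =
       (\<Sum>V\<in>Pow (X - S). rooted_sum w (?A \<union> S) V * edge_weight_prod w ((X - S) - V))"
      if S: "S \<in> Pow X" for S
    proof -
      have eq: "(?A \<union> S) \<union> (X - S) = ?A \<union> X" using S by auto
      have "?A \<union> X \<subset> A \<union> X" using y yX by auto
      then have "card (?A \<union> X) < card (A \<union> X)" using less.prems by (intro psubset_card_mono) auto
      then have "edge_weight_prod w ((?A \<union> S) \<union> (X - S)) =
       (\<Sum>V\<in>Pow (X - S). rooted_sum w (?A \<union> S) V * edge_weight_prod w ((X - S) - V))"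
        using less.prems S by (intro less.hyps) (auto simp: eq intro: finite_subset)
      then show ?thesis by (simp only: eq)
    qed
    have "A \<union> X = insert y (?A \<union> X)" using y by auto
    then have "edge_weight_prod w (A \<union> X) = (\<Prod>s\<in>?A \<union> X. 1 + w {y, s}) * edge_weight_prod w (?A \<union> X)"
      using less.prems yX by (metis edge_weight_prod_insert DiffE UnE finite_Diff finite_UnI singletonI)
    also have "(\<Prod>s\<in>?A \<union> X. 1 + w {y, s}) = ?P * (\<Sum>S\<in>Pow X. ?q S)"
      using less.prems by (subst prod.union_disjoint) (auto simp: prod_one_plus)
    also have "?P * (\<Sum>S\<in>Pow X. ?q S) * edge_weight_prod w (?A \<union> X) =
       ?P * (\<Sum>S\<in>Pow X. ?q S * edge_weight_prod w (?A \<union> X))"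
      by (simp add: sum_distrib_right mult.assoc)
    also have "(\<Sum>S\<in>Pow X. ?q S * edge_weight_prod w (?A \<union> X)) =
       (\<Sum>S\<in>Pow X. \<Sum>V\<in>Pow (X - S). ?q S * (rooted_sum w (?A \<union> S) V * edge_weight_prod w (X - (S \<union> V))))"
    proof (intro sum.cong refl)
      fix S assume "S \<in> Pow X"
      from IH[OF this] show "?q S * edge_weight_prod w (?A \<union> X) =
        (\<Sum>V\<in>Pow (X - S). ?q S * (rooted_sum w (?A \<union> S) V * edge_weight_prod w (X - (S \<union> V))))"
        by (simp only: sum_distrib_left Diff_Diff_left)
    qed
    also have "\<dots> = (\<Sum>V\<in>Pow X. \<Sum>S\<in>Pow V. ?q S * (rooted_sum w (?A \<union> S) (V - S) * edge_weight_prod w (X - (S \<union> (V - S)))))"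
      using less.prems by (intro sum_Pow_Pow[symmetric]) auto
    also have "\<dots> = (\<Sum>V\<in>Pow X. (\<Sum>S\<in>Pow V. ?q S * rooted_sum w (?A \<union> S) (V - S)) * edge_weight_prod w (X - V))"
      unfolding sum_distrib_right
      by (intro sum.cong refl) (simp add: mult.assoc Un_absorb1)
    also have "?P * \<dots> = (\<Sum>V\<in>Pow X. rooted_sum w A V * edge_weight_prod w (X - V))"
      unfolding sum_distrib_left
    proof (intro sum.cong refl)
      fix V assume V: "V \<in> Pow X"
      then have "rooted_sum w A V = ?P * (\<Sum>S\<in>Pow V. ?q S * rooted_sum w (?A \<union> S) (V - S))"
        using less.prems y by (intro rooted_sum_remove_root) (auto intro: finite_subset)
      then show "?P * ((\<Sum>S\<in>Pow V. ?q S * rooted_sum w (?A \<union> S) (V - S)) * edge_weight_prod w (X - V)) =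
         rooted_sum w A V * edge_weight_prod w (X - V)" by (simp add: mult.assoc)
    qed
    finally show ?thesis .
  qed
qed

section \<open>Invariance under relabelling of the vertices\<close>

lemma edge_weight_prod_relabel:
  assumes "inj_on p U" shows "edge_weight_prod w (p ` U) = edge_weight_prod (\<lambda>e. w (p ` e)) U"
proof -
  have "pair_edges (p ` U) = (`) p ` pair_edges U"
  proof (intro equalityI subsetI)
    fix e assume "e \<in> pair_edges (p ` U)"
    then obtain a b where "e = {p a, p b}" "p a \<noteq> p b" "a \<in> U" "b \<in> U" by (auto elim!: pair_edgesE)
    then show "e \<in> (`) p ` pair_edges U" by (intro image_eqI[of _ _ "{a, b}"]) auto
  next
    fix e assume "e \<in> (`) p ` pair_edges U"
    then show "e \<in> pair_edges (p ` U)" using assms by (auto elim!: pair_edgesE simp: inj_on_eq_iff)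
  qed
  moreover have "inj_on ((`) p) (pair_edges U)"
    using inj_on_image_Pow[OF assms] by (rule inj_on_subset) (auto simp: pair_edges_def)
  ultimately show ?thesis by (simp add: edge_weight_prod_def prod.reindex)
qed

text \<open>The recursion reduces the claim to reindexing of sums and products, so no paths have to
  be transported along p.\<close>

lemma rooted_sum_relabel:
  assumes "finite A" "finite V" "A \<inter> V = {}" "inj_on p (A \<union> V)"
  shows "rooted_sum w (p ` A) (p ` V) = rooted_sum (\<lambda>e. w (p ` e)) A V"
  using assms
proof (induction "card (A \<union> V)" arbitrary: A V rule: less_induct)
  case less
  show ?case
  proof (cases "A = {}")
    case True then show ?thesis by (simp add: rooted_sum_no_roots)
  next
    case False
    then obtain y where y: "y \<in> A" by auto
    have inj: "inj_on p A" "inj_on p V" using less.prems by (auto intro: inj_on_subset)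
    have disj: "p ` A \<inter> p ` V = {}" using less.prems by (auto simp: inj_on_def)
    have im: "p ` A - {p y} = p ` (A - {y})" using inj y by (auto simp: inj_on_def)
    have "rooted_sum w (p ` A) (p ` V) = (\<Prod>s\<in>p ` (A - {y}). 1 + w {p y, s}) *
      (\<Sum>S\<in>Pow (p ` V). (\<Prod>s\<in>S. w {p y, s}) * rooted_sum w (p ` (A - {y}) \<union> S) (p ` V - S))"
      using rooted_sum_remove_root[OF _ _ _ disj, of "p y" w] less.prems y by (simp add: im)
    also have "(\<Prod>s\<in>p ` (A - {y}). 1 + w {p y, s}) = (\<Prod>s\<in>A - {y}. 1 + w (p ` {y, s}))"
      using inj by (subst prod.reindex) (auto intro: inj_on_subset)
    also have "(\<Sum>S\<in>Pow (p ` V). (\<Prod>s\<in>S. w {p y, s}) * rooted_sum w (p ` (A - {y}) \<union> S) (p ` V - S))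
       = (\<Sum>S\<in>Pow V. (\<Prod>s\<in>p ` S. w {p y, s}) * rooted_sum w (p ` (A - {y}) \<union> p ` S) (p ` V - p ` S))"
      using inj_on_image_Pow[OF inj(2)] by (subst image_Pow_surj[OF refl, symmetric]) (simp add: sum.reindex)
    also have "\<dots> = (\<Sum>S\<in>Pow V. (\<Prod>s\<in>S. w (p ` {y, s})) *
        rooted_sum (\<lambda>e. w (p ` e)) (A - {y} \<union> S) (V - S))"
    proof (intro sum.cong refl)
      fix S assume S: "S \<in> Pow V"
      have "(\<Prod>s\<in>p ` S. w {p y, s}) = (\<Prod>s\<in>S. w (p ` {y, s}))"
        using inj S by (subst prod.reindex) (auto intro: inj_on_subset)
      moreover have "rooted_sum w (p ` (A - {y} \<union> S)) (p ` (V - S)) =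
          rooted_sum (\<lambda>e. w (p ` e)) (A - {y} \<union> S) (V - S)"
      proof (rule less.hyps)
        have "A - {y} \<union> S \<union> (V - S) \<subset> A \<union> V" using S y less.prems by auto
        then show "card (A - {y} \<union> S \<union> (V - S)) < card (A \<union> V)"
          using less.prems by (intro psubset_card_mono) auto
        show "inj_on p (A - {y} \<union> S \<union> (V - S))"
          using less.prems(4) by (rule inj_on_subset) (use S in auto)
        show "finite (A - {y} \<union> S)" "finite (V - S)" "(A - {y} \<union> S) \<inter> (V - S) = {}"
          using less.prems(1,2,3) finite_subset[of S V] S by auto
      qed
      moreover have "p ` V - p ` S = p ` (V - S)" using S by (intro inj_on_image_set_diff[OF inj(2), symmetric]) auto
      ultimately show "(\<Prod>s\<in>p ` S. w {p y, s}) * rooted_sum w (p ` (A - {y}) \<union> p ` S) (p ` V - p ` S) =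
         (\<Prod>s\<in>S. w (p ` {y, s})) * rooted_sum (\<lambda>e. w (p ` e)) (A - {y} \<union> S) (V - S)"
        by (simp add: image_Un)
    qed
    also have "(\<Prod>s\<in>A - {y}. 1 + w (p ` {y, s})) * \<dots> = rooted_sum (\<lambda>e. w (p ` e)) A V"
      using less.prems y by (intro rooted_sum_remove_root[symmetric]) auto
    finally show ?thesis .
  qed
qed

lemma rooted_sum_cong:
  "(\<And>e. e \<in> pair_edges (A \<union> V) \<Longrightarrow> w e = w' e) \<Longrightarrow> rooted_sum w A V = rooted_sum w' A V"
  unfolding rooted_sum_def rooted_graphs_def by (intro sum.cong prod.cong) auto

lemma edge_weight_prod_cong:
  "(\<And>e. e \<in> pair_edges U \<Longrightarrow> w e = w' e) \<Longrightarrow> edge_weight_prod w U = edge_weight_prod w' U"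
  unfolding edge_weight_prod_def by (intro prod.cong) auto

text \<open>By symmetry of the edge relation, connectivity can be tested from any one vertex. The
  free choice of r is what yields the symmetry of the Ursell function in
  \<open>cluster_eq_ursell\<close>.\<close>

lemma connected_graphs_eq_rooted_graphs:
  assumes "r < n" shows "connected_graphs n = rooted_graphs {r} ({..<n} - {r})"
proof -
  have U: "{r} \<union> ({..<n} - {r}) = {..<n}" using assms by auto
  have "graph_connected n E \<longleftrightarrow> (\<forall>v\<in>{..<n} - {r}. (v, r) \<in> (edge_rel E)\<^sup>*)" for E
  proof
    assume "graph_connected n E"
    then show "\<forall>v\<in>{..<n} - {r}. (v, r) \<in> (edge_rel E)\<^sup>*"
      using assms by (auto simp: graph_connected_def edge_rel_def)
  next
    assume *: "\<forall>v\<in>{..<n} - {r}. (v, r) \<in> (edge_rel E)\<^sup>*"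
    have 0: "(v, r) \<in> (edge_rel E)\<^sup>*" if "v < n" for v
      using * that by (cases "v = r") auto
    have "sym (edge_rel E)" by (auto simp: sym_def edge_rel_def insert_commute)
    then have "sym ((edge_rel E)\<^sup>*)" by (rule sym_rtrancl)
    then have "(i, j) \<in> (edge_rel E)\<^sup>*" if "i < n" "j < n" for i j
      using 0[OF that(1)] 0[OF that(2)] by (meson rtrancl_trans symD)
    then show "graph_connected n E" by (simp add: graph_connected_def edge_rel_def)
  qed
  then show ?thesis
    unfolding connected_graphs_def rooted_graphs_def U by (simp add: pair_edges_def graph_edges_def)
qed

subsection \<open>Configurations and their measures\<close>

text \<open>The orientation by \<open>Min\<close> and \<open>Max\<close> is that of
  \<open>ursell\<close>, so the two agree by unfolding; for symmetric f it disappears in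
  \<open>edge_wt_pair\<close>.\<close>

definition edge_wt :: "('a \<Rightarrow> 'a \<Rightarrow> 'b) \<Rightarrow> (nat \<Rightarrow> 'a) \<Rightarrow> nat set \<Rightarrow> 'b" where
  "edge_wt f x e = f (x (Min e)) (x (Max e))"

abbreviation cluster :: "('a \<Rightarrow> 'a \<Rightarrow> 'b::comm_semiring_1) \<Rightarrow> nat set \<Rightarrow> nat set \<Rightarrow> (nat \<Rightarrow> 'a) \<Rightarrow> 'b" where
  "cluster f A V x \<equiv> rooted_sum (edge_wt f x) A V"

abbreviation pair_boltzmann :: "('a \<Rightarrow> 'a \<Rightarrow> 'b::comm_semiring_1) \<Rightarrow> nat set \<Rightarrow> (nat \<Rightarrow> 'a) \<Rightarrow> 'b" where
  "pair_boltzmann f U x \<equiv> edge_weight_prod (edge_wt f x) U"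

lemma ursell_eq_cluster_root: "r < n \<Longrightarrow> ursell f n x = cluster f {r} ({..<n} - {r}) x"
  by (simp add: ursell_def rooted_sum_def connected_graphs_eq_rooted_graphs edge_wt_def)

lemma ursell_eq_cluster: "0 < n \<Longrightarrow> ursell f n x = cluster f {0} {1..<n} x"
proof -
  have "{..<n} - {0} = {1..<n}" by auto
  then show "0 < n \<Longrightarrow> ?thesis" by (simp only: ursell_eq_cluster_root)
qed

lemma edge_wt_pair:
  assumes "\<And>u v. f u v = f v u" shows "edge_wt f x {i, j} = f (x i) (x j)"
  using assms by (auto simp: edge_wt_def min_def max_def)

lemma edge_wt_image:
  assumes "\<And>u v. f u v = f v u" "e \<in> pair_edges U" "\<And>i. i \<in> U \<Longrightarrow> X (p i) = x i"
  shows "edge_wt f X (p ` e) = edge_wt f x e"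
  using assms(2,3) by (elim pair_edgesE) (simp add: edge_wt_pair assms(1))

lemma cluster_relabel:
  assumes "\<And>u v. f u v = f v u" "finite A" "finite V" "A \<inter> V = {}" "inj_on p (A \<union> V)"
    "\<And>i. i \<in> A \<union> V \<Longrightarrow> X (p i) = x i"
  shows "cluster f (p ` A) (p ` V) X = cluster f A V x"
  unfolding rooted_sum_relabel[OF assms(2-5)]
  using assms(1,6) by (intro rooted_sum_cong edge_wt_image) auto

lemma pair_boltzmann_relabel:
  assumes "\<And>u v. f u v = f v u" "inj_on p U" "\<And>i. i \<in> U \<Longrightarrow> X (p i) = x i"
  shows "pair_boltzmann f (p ` U) X = pair_boltzmann f U x"
  unfolding edge_weight_prod_relabel[OF assms(2)]
  using assms(1,3) by (intro edge_weight_prod_cong edge_wt_image) auto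

lemma cluster_cong:
  assumes "\<And>u v. f u v = f v u" "\<And>i. i \<in> A \<union> V \<Longrightarrow> X i = x i"
  shows "cluster f A V X = cluster f A V x"
  using assms by (intro rooted_sum_cong) (auto elim!: pair_edgesE simp: edge_wt_pair)

lemma pair_boltzmann_cong:
  assumes "\<And>u v. f u v = f v u" "\<And>i. i \<in> U \<Longrightarrow> X i = x i"
  shows "pair_boltzmann f U X = pair_boltzmann f U x"
  using assms by (intro edge_weight_prod_cong) (auto elim!: pair_edgesE simp: edge_wt_pair)

text \<open>This contains the permutation symmetry of the Ursell function: the root pulls back along
  p to some vertex r, possibly different from 0, and any vertex may serve as root.\<close>

lemma cluster_eq_ursell:
  assumes "\<And>u v. f u v = f v u" "0 < n" "bij_betw p {..<n} (A \<union> V)" "card A = 1" "A \<inter> V = {}"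
    "\<And>i. i < n \<Longrightarrow> X (p i) = x i"
  shows "cluster f A V X = ursell f n x"
proof -
  obtain r' where A: "A = {r'}" using assms(4) by (auto simp: card_1_singleton_iff)
  then have "r' \<in> p ` {..<n}" using assms(3) by (simp add: bij_betw_def)
  then obtain r where r: "r < n" "p r = r'" by auto
  have inj: "inj_on p {..<n}" and im: "p ` {..<n} = A \<union> V" using assms(3) by (auto simp: bij_betw_def)
  have U: "{r} \<union> ({..<n} - {r}) = {..<n}" using r by auto
  have "p ` ({..<n} - {r}) = p ` {..<n} - {p r}"
    using inj r by (subst inj_on_image_set_diff[OF inj]) auto
  then have "p ` ({..<n} - {r}) = V" using im r A assms(5) by auto
  moreover have "cluster f (p ` {r}) (p ` ({..<n} - {r})) X = cluster f {r} ({..<n} - {r}) x"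
  proof (rule cluster_relabel[OF assms(1)])
    show "inj_on p ({r} \<union> ({..<n} - {r}))" unfolding U by (rule inj)
    show "X (p i) = x i" if "i \<in> {r} \<union> ({..<n} - {r})" for i
      using that assms(6) unfolding U by auto
  qed auto
  ultimately show ?thesis using r A by (simp add: ursell_eq_cluster_root)
qed

lemma ursell_cong:
  assumes "\<And>i. i < n \<Longrightarrow> X i = x i" shows "ursell f n X = ursell f n x"
proof -
  have "edge_wt f X e = edge_wt f x e" if "E \<in> connected_graphs n" "e \<in> E" for E e
  proof -
    have "e \<subseteq> {..<n}" "card e = 2" using that by (auto simp: connected_graphs_def graph_edges_def)
    then show ?thesis using assms by (auto simp: edge_wt_def card_2_iff min_def max_def)
  qed
  then show ?thesis by (simp add: ursell_def edge_wt_def cong: sum.cong prod.cong)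
qed

lemma pair_boltzmann_lessThan:
  assumes "\<And>u v. f u v = f v u"
  shows "pair_boltzmann f {..<n} x = (\<Prod>j<n. \<Prod>i<j. 1 + f (x i) (x j))"
proof (induction n)
  case (Suc n)
  have "pair_boltzmann f {..<Suc n} x = (\<Prod>s<n. 1 + f (x n) (x s)) * pair_boltzmann f {..<n} x"
    by (simp add: lessThan_Suc edge_weight_prod_insert edge_wt_pair assms)
  then show ?case by (simp add: Suc.IH mult.commute assms[of "x n"])
qed simp

section \<open>Binomial weights for sums over subsets\<close>

lemma sum_Pow_card:
  fixes g :: "nat \<Rightarrow> 'b::comm_semiring_1"
  assumes "finite W"
  shows "(\<Sum>S\<in>Pow W. g (card S)) = (\<Sum>k\<le>card W. of_nat (card W choose k) * g k)"
proof -
  have "(\<Sum>S\<in>Pow W. g (card S)) = (\<Sum>k\<le>card W. \<Sum>S\<in>{S \<in> Pow W. card S = k}. g (card S))"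
    using assms by (intro sum.group[symmetric]) (auto simp: card_mono)
  also have "\<dots> = (\<Sum>k\<le>card W. of_nat (card W choose k) * g k)"
    using assms by (intro sum.cong refl) (simp add: n_subsets)
  finally show ?thesis .
qed

text \<open>The source is binom(n,k) k! <= n^k. The condition is an inequality in c rather than c =
  1/n because the induction on rooted sums passes to smaller sets with c fixed.\<close>

lemma binomial_weight_le:
  assumes "0 \<le> c" "c * real n \<le> 1"
  shows "real (n choose k) * c ^ k \<le> 1 / fact k"
proof -
  have "real ((n choose k) * fact k) \<le> real (n ^ k)"
    using binomial_fact_pow[of n k] by (simp only: of_nat_le_iff)
  then have "real (n choose k) * fact k * c ^ k \<le> real n ^ k * c ^ k"
    using assms by (intro mult_right_mono) auto
  also have "\<dots> = (c * real n) ^ k" by (simp add: power_mult_distrib mult.commute)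
  also have "\<dots> \<le> 1" using assms by (intro power_le_one) auto
  finally show ?thesis by (simp add: field_simps)
qed

text \<open>For N > 0 the weight is 1/n! times the product of 1 - i/N over i < n, a fixed number of
  factors tending to 1.\<close>

lemma binomial_weight_tendsto: "(\<lambda>N. real (N choose n) * (1 / real N) ^ n) \<longlonglongrightarrow> 1 / fact n"
proof -
  have "(\<lambda>N. (\<Prod>i = 0..<n. 1 - real i / real N) / fact n) \<longlonglongrightarrow> (\<Prod>i = 0..<n. 1 - 0) / fact n"
    by (intro tendsto_intros lim_const_over_n)  simp
  moreover have "\<forall>\<^sub>F N in sequentially. (\<Prod>i = 0..<n. 1 - real i / real N) / fact n =
      real (N choose n) * (1 / real N) ^ n"
  proof (rule eventually_mono[OF eventually_gt_at_top[of 0]])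
    fix N :: nat assume N: "0 < N"
    have "(\<Prod>i = 0..<n. 1 - real i / real N) = (\<Prod>i = 0..<n. (real N - real i) * (1 / real N))"
      using N by (intro prod.cong) (auto simp: field_simps)
    also have "\<dots> = (\<Prod>i = 0..<n. real N - real i) * (1 / real N) ^ n"
      by (simp only: prod.distrib prod_constant card_atLeastLessThan diff_zero)
    finally show "(\<Prod>i = 0..<n. 1 - real i / real N) / fact n = real (N choose n) * (1 / real N) ^ n"
      by (simp add: binomial_gbinomial gbinomial_prod_rev)
  qed
  ultimately show ?thesis by (simp add: tendsto_cong)
qed

section \<open>Integration over finitely many coordinates of an infinite configuration\<close>

locale full_sigma_finite_measure = sigma_finite_measure M for M :: "'a measure" +
  assumes space_M: "space M = UNIV"
begin

sublocale product_sigma_finite "\<lambda>_::nat. M" ..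

text \<open>This serves only as a measurable space; integrals always run over finite index
  sets.\<close>

abbreviation "config \<equiv> PiM (UNIV::nat set) (\<lambda>_. M)"

lemma measurable_override_on [measurable]:
  "(\<lambda>(x, y). override_on x y V) \<in> config \<Otimes>\<^sub>M PiM V (\<lambda>_. M) \<rightarrow>\<^sub>M PiM UNIV (\<lambda>_. M)"
proof -
  have "(\<lambda>p i. (if i \<in> V then snd p i else fst p i))
     \<in> config \<Otimes>\<^sub>M PiM V (\<lambda>_. M) \<rightarrow>\<^sub>M config"
  proof (rule measurable_PiM_single')
    fix i :: nat
    show "(\<lambda>p. if i \<in> V then snd p i else fst p i) \<in> PiM UNIV (\<lambda>_. M) \<Otimes>\<^sub>M PiM V (\<lambda>_. M) \<rightarrow>\<^sub>M M"
      by (cases "i \<in> V") simp_all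
  qed (auto simp: space_M)
  then show ?thesis by (simp add: override_on_def case_prod_unfold)
qed

lemma measurable_override_on_snd:
  "(\<lambda>y. override_on x y V) \<in> PiM V (\<lambda>_. M) \<rightarrow>\<^sub>M config"
  using measurable_compose[OF measurable_Pair1' measurable_override_on, of x] by (simp add: space_M space_PiM)

text \<open>The coordinates in V are integrated out and the others stay at their values in x.
  Working with configurations indexed by all natural numbers keeps one type of integrand while the
  recursion moves vertices from the integrated ones to the fixed roots.\<close>

definition nn_integral_at :: "nat set \<Rightarrow> ((nat \<Rightarrow> 'a) \<Rightarrow> ennreal) \<Rightarrow> (nat \<Rightarrow> 'a) \<Rightarrow> ennreal" where
  "nn_integral_at V F x = (\<integral>\<^sup>+ y. F (override_on x y V) \<partial>PiM V (\<lambda>_. M))"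

lemma measurable_nn_integrand [measurable]:
  "F \<in> borel_measurable config \<Longrightarrow> (\<lambda>y. F (override_on x y V)) \<in> borel_measurable (PiM V (\<lambda>_. M))"
  by (rule measurable_compose[OF measurable_override_on_snd]) auto

lemma nn_integral_at_empty [simp]: "nn_integral_at {} F x = F x"
  unfolding nn_integral_at_def by (subst nn_integral_empty) auto

lemma nn_integral_at_insert:
  assumes "finite V" "i \<notin> V" "F \<in> borel_measurable config"
  shows "nn_integral_at (insert i V) F x = (\<integral>\<^sup>+ u. nn_integral_at V F (x(i := u)) \<partial>M)"
proof -
  have "override_on x (y(i := u)) (insert i V) = override_on (x(i := u)) y V" for y u
    using assms(2) by (auto simp: override_on_def)
  then show ?thesis
    unfolding nn_integral_at_def using assms by (subst product_nn_integral_insert_rev) auto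
qed

lemma borel_measurable_nn_integral_at [measurable]:
  assumes "finite V" "F \<in> borel_measurable config"
  shows "nn_integral_at V F \<in> borel_measurable config"
proof -
  interpret V: sigma_finite_measure "PiM V (\<lambda>_. M)" by (rule sigma_finite) fact
  have "(\<lambda>x. \<integral>\<^sup>+ y. F (override_on x y V) \<partial>PiM V (\<lambda>_. M)) \<in> borel_measurable config"
    using assms(2) measurable_compose[OF measurable_override_on assms(2)]
    by (intro V.borel_measurable_nn_integral) (simp add: case_prod_unfold)
  then show ?thesis by (simp add: nn_integral_at_def[abs_def])
qed

lemma nn_integral_at_Un:
  assumes "finite S" "finite T" "S \<inter> T = {}" and [measurable]: "F \<in> borel_measurable config"
  shows "nn_integral_at (S \<union> T) F x = nn_integral_at S (nn_integral_at T F) x"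
  using assms(1,3)
proof (induction S arbitrary: x)
  case (insert i S)
  then have "nn_integral_at (insert i S \<union> T) F x = (\<integral>\<^sup>+ u. nn_integral_at (S \<union> T) F (x(i := u)) \<partial>M)"
    using assms(2) by (simp add: nn_integral_at_insert)
  also have "\<dots> = (\<integral>\<^sup>+ u. nn_integral_at S (nn_integral_at T F) (x(i := u)) \<partial>M)"
    using insert by simp
  also have "\<dots> = nn_integral_at (insert i S) (nn_integral_at T F) x"
    using insert assms(2) by (simp add: nn_integral_at_insert)
  finally show ?case .
qed simp

lemma nn_integral_at_sum:
  "(\<And>k. k \<in> I \<Longrightarrow> F k \<in> borel_measurable config) \<Longrightarrow>
    nn_integral_at V (\<lambda>x. \<Sum>k\<in>I. F k x) x = (\<Sum>k\<in>I. nn_integral_at V (F k) x)"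
  unfolding nn_integral_at_def by (intro nn_integral_sum) auto

lemma nn_integral_at_cmult:
  assumes "F \<in> borel_measurable config" "\<And>y. g (override_on x y V) = g x"
  shows "nn_integral_at V (\<lambda>x. g x * F x) x = g x * nn_integral_at V F x"
  unfolding nn_integral_at_def using assms by (simp add: nn_integral_cmult)

text \<open>The coordinates are integrated one at a time, so the almost-everywhere condition is used
  only for M and never has to be lifted to a product measure.\<close>

lemma nn_integral_at_mono:
  assumes "finite V" and [measurable]: "F \<in> borel_measurable config" "F' \<in> borel_measurable config"
    and G: "AE u in M. u \<in> G"
    and le: "\<And>y. (\<And>i. i \<in> V \<Longrightarrow> y i \<in> G) \<Longrightarrow> (\<And>i. i \<notin> V \<Longrightarrow> y i = x i) \<Longrightarrow> F y \<le> F' y"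
  shows "nn_integral_at V F x \<le> nn_integral_at V F' x"
  using assms(1) le
proof (induction V arbitrary: x)
  case empty
  from empty(1)[of x] show ?case by simp
next
  case (insert i V)
  have "(\<integral>\<^sup>+ u. nn_integral_at V F (x(i := u)) \<partial>M) \<le> (\<integral>\<^sup>+ u. nn_integral_at V F' (x(i := u)) \<partial>M)"
  proof (rule nn_integral_mono_AE, rule AE_mp[OF G], rule AE_I2, rule impI)
    fix u assume u: "u \<in> G"
    show "nn_integral_at V F (x(i := u)) \<le> nn_integral_at V F' (x(i := u))"
    proof (rule insert.IH)
      fix y assume y: "\<And>j. j \<in> V \<Longrightarrow> y j \<in> G" "\<And>j. j \<notin> V \<Longrightarrow> y j = (x(i := u)) j"
      show "F y \<le> F' y"
      proof (rule insert.prems)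
        fix j assume "j \<in> insert i V" then show "y j \<in> G" using y[of j] u by (cases "j \<in> V") auto
      next
        fix j assume "j \<notin> insert i V" then show "y j = x j" using y(2)[of j] by auto
      qed
    qed
  qed
  then show ?case using insert by (simp add: nn_integral_at_insert)
qed

section \<open>Product measures under a bijection of the index sets\<close>

lemma distr_PiM_relabel:
  fixes p :: "nat \<Rightarrow> nat"
  assumes "finite I" "bij_betw p I K"
  shows "distr (PiM K (\<lambda>_. M)) (PiM I (\<lambda>_. M)) (\<lambda>x. \<lambda>i\<in>I. x (p i)) = PiM I (\<lambda>_. M)"
proof (rule PiM_eqI)
  have fK: "finite K" using assms bij_betw_finite by auto
  have m: "(\<lambda>x. \<lambda>i\<in>I. x (p i)) \<in> PiM K (\<lambda>_. M) \<rightarrow>\<^sub>M PiM I (\<lambda>_. M)"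
    using assms by (intro measurable_restrict measurable_component_singleton) (auto simp: bij_betw_def)
  fix A :: "nat \<Rightarrow> 'a set" assume A: "\<And>i. i \<in> I \<Longrightarrow> A i \<in> sets M"
  let ?q = "the_inv_into I p"
  have q: "?q (p i) = i" if "i \<in> I" for i
    using assms that by (auto simp: bij_betw_def the_inv_into_f_f)
  have K: "K = p ` I" using assms by (auto simp: bij_betw_def)
  have "(\<lambda>x. \<lambda>i\<in>I. x (p i)) -` PiE I A \<inter> space (PiM K (\<lambda>_. M)) = PiE K (\<lambda>k. A (?q k))"
    using q by (auto simp: space_PiM space_M K PiE_iff Pi_iff)
  then have "emeasure (distr (PiM K (\<lambda>_. M)) (PiM I (\<lambda>_. M)) (\<lambda>x. \<lambda>i\<in>I. x (p i))) (PiE I A)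
      = emeasure (PiM K (\<lambda>_. M)) (PiE K (\<lambda>k. A (?q k)))"
    using m A assms(1) by (subst emeasure_distr) (auto intro!: sets_PiM_I_finite)
  also have "\<dots> = (\<Prod>k\<in>K. emeasure M (A (?q k)))"
    using fK A q by (intro emeasure_PiM) (auto simp: K)
  also have "\<dots> = (\<Prod>i\<in>I. emeasure M (A i))"
    using assms q unfolding K by (subst prod.reindex) (auto simp: bij_betw_def)
  finally show "emeasure (distr (PiM K (\<lambda>_. M)) (PiM I (\<lambda>_. M)) (\<lambda>x. \<lambda>i\<in>I. x (p i))) (PiE I A) =
      (\<Prod>i\<in>I. emeasure M (A i))" .
qed (use assms in auto)

lemma measurable_relabel:
  fixes p :: "nat \<Rightarrow> nat"
  assumes "bij_betw p I K"
  shows "(\<lambda>x. \<lambda>i\<in>I. x (p i)) \<in> PiM K (\<lambda>_. M) \<rightarrow>\<^sub>M PiM I (\<lambda>_. M)"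
  using assms by (intro measurable_restrict measurable_component_singleton) (auto simp: bij_betw_def)

lemma nn_integral_PiM_relabel:
  fixes p :: "nat \<Rightarrow> nat"
  assumes "finite I" "bij_betw p I K" "H \<in> borel_measurable (PiM I (\<lambda>_. M))"
    and eq: "\<And>y. F y = H (\<lambda>i\<in>I. y (p i))"
  shows "(\<integral>\<^sup>+ y. F y \<partial>PiM K (\<lambda>_. M)) = (\<integral>\<^sup>+ y. H y \<partial>PiM I (\<lambda>_. M))"
  using nn_integral_distr[OF measurable_relabel[OF assms(2)], of H] assms(3)
  unfolding eq distr_PiM_relabel[OF assms(1,2)] by simp

lemma integral_PiM_relabel:
  fixes p :: "nat \<Rightarrow> nat" and H :: "(nat \<Rightarrow> 'a) \<Rightarrow> 'c::{banach, second_countable_topology}"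
  assumes "finite I" "bij_betw p I K" "H \<in> borel_measurable (PiM I (\<lambda>_. M))"
    and eq: "\<And>y. F y = H (\<lambda>i\<in>I. y (p i))"
  shows "(\<integral>y. F y \<partial>PiM K (\<lambda>_. M)) = (\<integral>y. H y \<partial>PiM I (\<lambda>_. M))"
  using integral_distr[OF measurable_relabel[OF assms(2)] assms(3)]
  unfolding eq distr_PiM_relabel[OF assms(1,2)] by simp

end

subsection \<open>The bound on rooted graph sums\<close>

text \<open>The bounds -1 <= f <= 0 express that the potential is non-negative. In the application M
  is the measure weighted by z, so the activity does not appear below.\<close>

locale mayer_space = full_sigma_finite_measure M for M :: "'a measure" +
  fixes f :: "'a \<Rightarrow> 'a \<Rightarrow> real"
  assumes measurable_f: "(\<lambda>(x, y). f x y) \<in> borel_measurable (M \<Otimes>\<^sub>M M)"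
    and f_sym: "f u v = f v u"
    and f_le_0: "f u v \<le> 0" and f_ge_minus_1: "- 1 \<le> f u v"
begin

lemma one_plus_f: "0 \<le> 1 + f u v" "1 + f u v \<le> 1"
  using f_le_0[of u v] f_ge_minus_1[of u v] by auto

lemma measurable_f_comp [measurable (raw)]:
  assumes "g \<in> N \<rightarrow>\<^sub>M M" "h \<in> N \<rightarrow>\<^sub>M M" shows "(\<lambda>x. f (g x) (h x)) \<in> borel_measurable N"
  using measurable_compose[OF measurable_Pair[OF assms] measurable_f] by simp

lemma measurable_edge_wt:
  assumes "e \<in> pair_edges I" shows "(\<lambda>x. edge_wt f x e) \<in> borel_measurable (PiM I (\<lambda>_. M))"
proof -
  obtain a b where e: "e = {a, b}" "a \<in> I" "b \<in> I" using assms by (elim pair_edgesE)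
  have "(\<lambda>x. f (x a) (x b)) \<in> borel_measurable (PiM I (\<lambda>_. M))"
    using e by (intro measurable_f_comp measurable_component_singleton)
  then show ?thesis by (simp add: e edge_wt_pair f_sym)
qed

lemma measurable_cluster:
  assumes "A \<union> V \<subseteq> I" shows "cluster f A V \<in> borel_measurable (PiM I (\<lambda>_. M))"
  unfolding rooted_sum_def
proof (intro borel_measurable_sum borel_measurable_prod measurable_edge_wt)
  fix E e assume "E \<in> rooted_graphs A V" "e \<in> E"
  then have "e \<in> pair_edges (A \<union> V)" by (auto simp: rooted_graphs_def)
  then show "e \<in> pair_edges I" using assms by (auto simp: pair_edges_def)
qed

lemma measurable_pair_boltzmann:
  assumes "U \<subseteq> I" shows "pair_boltzmann f U \<in> borel_measurable (PiM I (\<lambda>_. M))"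
  unfolding edge_weight_prod_def
proof (intro borel_measurable_prod borel_measurable_add borel_measurable_const measurable_edge_wt)
  fix e assume "e \<in> pair_edges U"
  then show "e \<in> pair_edges I" using assms by (auto simp: pair_edges_def)
qed

declare measurable_cluster[OF subset_UNIV, measurable] measurable_pair_boltzmann[OF subset_UNIV, measurable]

lemma one_plus_edge_wt: "0 \<le> 1 + edge_wt f x e" "1 + edge_wt f x e \<le> 1"
  using one_plus_f by (auto simp: edge_wt_def)

lemma pair_boltzmann_nonneg: "0 \<le> pair_boltzmann f U x"
  unfolding edge_weight_prod_def using one_plus_edge_wt by (intro prod_nonneg) auto

lemma pair_boltzmann_le_1: "pair_boltzmann f U x \<le> 1"
  unfolding edge_weight_prod_def using one_plus_edge_wt by (intro prod_le_1) auto

text \<open>The factors for edges between A and B lie in [0, 1] and are dropped. This is what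
  separates the new roots from the old ones in the induction.\<close>

lemma pair_boltzmann_Un_le:
  assumes "finite A" "finite B" "A \<inter> B = {}"
  shows "pair_boltzmann f (A \<union> B) x \<le> pair_boltzmann f A x * pair_boltzmann f B x"
proof -
  have "pair_edges A \<inter> pair_edges B = {}"
    using assms by (auto simp: pair_edges_def)
      (metis Int_subset_iff card.empty subset_empty zero_neq_numeral)
  then have "pair_boltzmann f A x * pair_boltzmann f B x = (\<Prod>e\<in>pair_edges A \<union> pair_edges B. 1 + edge_wt f x e)"
    using assms by (simp add: edge_weight_prod_def prod.union_disjoint)
  also have "\<dots> \<ge> (\<Prod>e\<in>pair_edges (A \<union> B). 1 + edge_wt f x e)"
  proof -
    have sub: "pair_edges A \<union> pair_edges B \<subseteq> pair_edges (A \<union> B)" by (auto simp: pair_edges_def)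
    have "(\<Prod>e\<in>pair_edges (A \<union> B). 1 + edge_wt f x e) =
       (\<Prod>e\<in>pair_edges (A \<union> B) - (pair_edges A \<union> pair_edges B). 1 + edge_wt f x e) *
       (\<Prod>e\<in>pair_edges A \<union> pair_edges B. 1 + edge_wt f x e)"
      using assms sub by (intro prod.subset_diff) auto
    also have "\<dots> \<le> 1 * (\<Prod>e\<in>pair_edges A \<union> pair_edges B. 1 + edge_wt f x e)"
      using one_plus_edge_wt by (intro mult_right_mono prod_le_1 prod_nonneg) auto
    finally show ?thesis by simp
  qed
  finally show ?thesis by (simp add: edge_weight_prod_def)
qed

text \<open>The k-th integral in the hypothesis on a, with the activity absorbed into M and without
  1/k!.\<close>

definition kernel :: "('a \<Rightarrow> real) \<Rightarrow> nat \<Rightarrow> 'a \<Rightarrow> ennreal" where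
  "kernel a k u = (\<integral>\<^sup>+ y. ennreal ((\<Prod>j<k. \<bar>f u (y j)\<bar>) * (\<Prod>j<k. \<Prod>i<j. 1 + f (y i) (y j)) *
      (\<Prod>j<k. exp (a (y j)))) \<partial>PiM {..<k} (\<lambda>_. M))"

lemma kernel_0 [simp]: "kernel a 0 u = 1"
  by (simp add: kernel_def space_PiM emeasure_PiM_empty)

lemma nn_integral_at_kernel:
  assumes [measurable]: "a \<in> borel_measurable M" and "finite S" "y \<notin> S"
  shows "nn_integral_at S (\<lambda>x. ennreal ((\<Prod>s\<in>S. \<bar>f (x y) (x s)\<bar>) * pair_boltzmann f S x * (\<Prod>s\<in>S. exp (a (x s))))) x
     = kernel a (card S) (x y)"
proof -
  obtain p where p: "bij_betw p {..<card S} S"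
    using assms(2) by (metis atLeast0LessThan ex_bij_betw_nat_finite)
  have S: "S = p ` {..<card S}" and inj: "inj_on p {..<card S}" using p by (auto simp: bij_betw_def)
  show ?thesis
    unfolding nn_integral_at_def kernel_def
  proof (rule nn_integral_PiM_relabel[OF _ p])
    fix v :: "nat \<Rightarrow> 'a"
    let ?z = "override_on x v S"
    have 1: "(\<Prod>s\<in>S. g (?z s)) = (\<Prod>j<card S. g (v (p j)))" for g :: "'a \<Rightarrow> real"
      by (subst (1) S, subst prod.reindex[OF inj]) (use S in \<open>auto simp: override_on_def intro!: prod.cong\<close>)
    have 2: "pair_boltzmann f S ?z = (\<Prod>j<card S. \<Prod>i<j. 1 + f (v (p i)) (v (p j)))"
    proof -
      have "pair_boltzmann f S ?z = pair_boltzmann f {..<card S} (v \<circ> p)"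
        by (subst (1) S, rule pair_boltzmann_relabel[OF f_sym inj]) (use S in \<open>auto simp: override_on_def\<close>)
      then show ?thesis by (simp add: pair_boltzmann_lessThan[OF f_sym])
    qed
    have 3: "?z y = x y" using assms(3) by (simp add: override_on_def)
    show "ennreal ((\<Prod>s\<in>S. \<bar>f (?z y) (?z s)\<bar>) * pair_boltzmann f S ?z * (\<Prod>s\<in>S. exp (a (?z s)))) =
      ennreal ((\<Prod>j<card S. \<bar>f (x y) ((\<lambda>i\<in>{..<card S}. v (p i)) j)\<bar>) *
        (\<Prod>j<card S. \<Prod>i<j. 1 + f ((\<lambda>i\<in>{..<card S}. v (p i)) i) ((\<lambda>i\<in>{..<card S}. v (p i)) j)) *
        (\<Prod>j<card S. exp (a ((\<lambda>i\<in>{..<card S}. v (p i)) j))))"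
      unfolding 3 1[of "\<lambda>w. \<bar>f (x y) w\<bar>"] 1[of "\<lambda>w. exp (a w)"] 2
      by (intro arg_cong[where f = ennreal] arg_cong2[where f = "(*)"] prod.cong refl) auto
  qed (auto intro!: measurable_compose[OF _ measurable_ennreal] borel_measurable_times borel_measurable_prod
      borel_measurable_abs measurable_f_comp borel_measurable_add measurable_component_singleton
      measurable_compose[OF measurable_component_singleton] simp: space_M)
qed

lemma cluster_remove_root:
  assumes "finite A" "finite V" "y \<in> A" "A \<inter> V = {}"
  shows "cluster f A V x = (\<Prod>s\<in>A - {y}. 1 + f (x y) (x s)) *
     (\<Sum>S\<in>Pow V. (\<Prod>s\<in>S. f (x y) (x s)) * cluster f (A - {y} \<union> S) (V - S) x)"
  using rooted_sum_remove_root[OF assms, of "edge_wt f x"] by (simp add: edge_wt_pair f_sym)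

text \<open>Summing over subsets of a finite \<open>W\<close> with weights \<open>c ^ card V\<close> instead of over sizes with weights
  \<open>1 / fact n\<close> lets the induction use the recursion directly; the sizes are recovered for
  \<open>c = 1 / N\<close>, \<open>W = {1..N}\<close>, as \<open>N\<close> tends to infinity.\<close>
lemma weighted_sum_cluster_le:
  fixes a :: "'a \<Rightarrow> real" and c :: real
  assumes a [measurable]: "a \<in> borel_measurable M"
    and G: "AE u in M. u \<in> G"
    and KP: "\<And>u n. u \<in> G \<Longrightarrow> (\<Sum>k\<le>n. ennreal (1 / fact k) * kernel a k u) \<le> ennreal (exp (a u))"
    and c: "0 \<le> c"
  shows "finite A \<Longrightarrow> finite W \<Longrightarrow> A \<inter> W = {} \<Longrightarrow> c * card W \<le> 1 \<Longrightarrow> (\<And>i. i \<in> A \<Longrightarrow> x i \<in> G) \<Longrightarrow>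
    (\<Sum>V\<in>Pow W. ennreal (c ^ card V) * nn_integral_at V (\<lambda>x. ennreal \<bar>cluster f A V x\<bar>) x)
      \<le> ennreal (pair_boltzmann f A x * (\<Prod>i\<in>A. exp (a (x i))))"
proof (induction "card (A \<union> W)" arbitrary: A W x rule: less_induct)
  case less
  note finA = less.prems(1) and finW = less.prems(2) and disj = less.prems(3) and cW = less.prems(4)
    and xG = less.prems(5)
  show ?case
  proof (cases "A = {}")
    case True
    have "(\<Sum>V\<in>Pow W. ennreal (c ^ card V) * nn_integral_at V (\<lambda>x. ennreal \<bar>cluster f A V x\<bar>) x) =
        (\<Sum>V\<in>Pow W. if V = {} then 1 else 0)"
    proof (intro sum.cong refl)
      fix V
      show "ennreal (c ^ card V) * nn_integral_at V (\<lambda>x. ennreal \<bar>cluster f A V x\<bar>) x = (if V = {} then 1 else 0)"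
        using True by (cases "V = {}") (simp add: rooted_sum_no_roots, simp add: rooted_sum_no_roots nn_integral_at_def)
    qed
    also have "\<dots> = 1" using finW by (simp add: sum.delta)
    finally show ?thesis using True by simp
  next
    case False
    then obtain y where y: "y \<in> A" by auto
    define A' where "A' = A - {y}"
    have finA': "finite A'" and A': "A' \<subseteq> A" "y \<notin> A'" and yW: "y \<notin> W" and A'W: "A' \<inter> W = {}"
      using finA y disj by (auto simp: A'_def)
    \<comment> \<open>Removing y leaves the interaction P of y with the other roots, its edges q to
      the new roots S, and the bound B already available for the other roots. K is the integrand of
      \<open>kernel\<close>.\<close>
    define P where "P x = ennreal (\<Prod>s\<in>A'. 1 + f (x y) (x s))" for x
    define q where "q S x = ennreal (\<Prod>s\<in>S. \<bar>f (x y) (x s)\<bar>)" for S x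
    define B where "B x = ennreal (pair_boltzmann f A' x * (\<Prod>i\<in>A'. exp (a (x i))))" for x
    define K where "K S x = ennreal ((\<Prod>s\<in>S. \<bar>f (x y) (x s)\<bar>) * pair_boltzmann f S x * (\<Prod>s\<in>S. exp (a (x s))))" for S x
    define C where "C A V x = ennreal \<bar>cluster f A V x\<bar>" for A V x
    have meas [measurable]: "q S \<in> borel_measurable config" "B \<in> borel_measurable config"
      "K S \<in> borel_measurable config" "C A V \<in> borel_measurable config" for S A V
      unfolding q_def[abs_def] B_def[abs_def] K_def[abs_def] C_def[abs_def] by measurable
    have step: "C A V x \<le> P x * (\<Sum>S\<in>Pow V. q S x * C (A' \<union> S) (V - S) x)" if V: "V \<subseteq> W" for V x
    proof -
      have finV: "finite V" using V finW finite_subset by auto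
      have "\<bar>cluster f A V x\<bar> = (\<Prod>s\<in>A'. 1 + f (x y) (x s)) *
          \<bar>\<Sum>S\<in>Pow V. (\<Prod>s\<in>S. f (x y) (x s)) * cluster f (A' \<union> S) (V - S) x\<bar>"
      proof -
        have "A \<inter> V = {}" using V disj by auto
        from cluster_remove_root[OF finA finV y this, of x]
        show ?thesis unfolding A'_def[symmetric] by (simp add: abs_mult abs_prod one_plus_f)
      qed
      also have "\<dots> \<le> (\<Prod>s\<in>A'. 1 + f (x y) (x s)) *
          (\<Sum>S\<in>Pow V. (\<Prod>s\<in>S. \<bar>f (x y) (x s)\<bar>) * \<bar>cluster f (A' \<union> S) (V - S) x\<bar>)"
        using one_plus_f
        by (intro mult_left_mono prod_nonneg order_trans[OF sum_abs]) (auto simp: abs_mult abs_prod)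
      finally have "C A V x \<le> ennreal (\<dots>)" unfolding C_def by (rule ennreal_leI)
      also have "\<dots> = P x * (\<Sum>S\<in>Pow V. q S x * C (A' \<union> S) (V - S) x)"
        using one_plus_f unfolding P_def q_def C_def
        by (simp add: ennreal_mult prod_nonneg sum_nonneg flip: sum_ennreal)
      finally show ?thesis .
    qed
    let ?I = nn_integral_at
    have IH: "(\<Sum>V\<in>Pow (W - S). ennreal (c ^ card V) * ?I V (C (A' \<union> S) V) z)
        \<le> ennreal (pair_boltzmann f (A' \<union> S) z * (\<Prod>i\<in>A' \<union> S. exp (a (z i))))"
      if S: "S \<subseteq> W" and z: "\<And>i. i \<in> A' \<union> S \<Longrightarrow> z i \<in> G" for S z
      unfolding C_def
    proof (rule less.hyps)
      have "A' \<union> S \<union> (W - S) \<subset> A \<union> W" using S y yW A' by auto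
      then show "card (A' \<union> S \<union> (W - S)) < card (A \<union> W)"
        using finA finW by (intro psubset_card_mono) auto
      show "finite (A' \<union> S)" "finite (W - S)" using finA' finW finite_subset[OF S] by auto
      show "(A' \<union> S) \<inter> (W - S) = {}" using A'W by auto
      have "c * real (card (W - S)) \<le> c * real (card W)"
        using c finW by (intro mult_left_mono) (auto intro: card_mono)
      then show "c * real (card (W - S)) \<le> 1" using cW by linarith
    qed (use z in auto)
    \<comment> \<open>Splitting the bound for the roots \<open>A' \<union> S\<close> leaves B, which
      does not see S, times a factor which together with q is exactly the integrand of
      \<open>kernel\<close> at the removed root.\<close>
    have inner: "q S z * (\<Sum>V\<in>Pow (W - S). ennreal (c ^ card V) * ?I V (C (A' \<union> S) V) z) \<le> B z * K S z"
      if S: "S \<subseteq> W" and z: "\<And>i. i \<in> A' \<union> S \<Longrightarrow> z i \<in> G" for S z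
    proof -
      have finS: "finite S" using S finW finite_subset by auto
      have dS: "A' \<inter> S = {}" using A'W S by auto
      have "q S z * (\<Sum>V\<in>Pow (W - S). ennreal (c ^ card V) * ?I V (C (A' \<union> S) V) z)
         \<le> q S z * ennreal (pair_boltzmann f (A' \<union> S) z * (\<Prod>i\<in>A' \<union> S. exp (a (z i))))"
        using IH[OF S z] by (intro mult_left_mono) auto
      also have "\<dots> \<le> q S z * ennreal ((pair_boltzmann f A' z * pair_boltzmann f S z) * ((\<Prod>i\<in>A'. exp (a (z i))) * (\<Prod>i\<in>S. exp (a (z i)))))"
        using pair_boltzmann_Un_le[OF finA' finS dS, of z] finA' finS dS
        by (intro mult_left_mono ennreal_leI) (auto simp: prod.union_disjoint intro!: mult_right_mono mult_nonneg_nonneg prod_nonneg)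
      also have "\<dots> = B z * K S z"
        unfolding q_def B_def K_def
        by (simp add: pair_boltzmann_nonneg prod_nonneg mult.assoc mult.left_commute flip: ennreal_mult)
      finally show ?thesis .
    qed
    have "(\<Sum>V\<in>Pow W. ennreal (c ^ card V) * ?I V (C A V) x)
        \<le> (\<Sum>V\<in>Pow W. ennreal (c ^ card V) * (P x * (\<Sum>S\<in>Pow V. ?I S (\<lambda>x. q S x * ?I (V - S) (C (A' \<union> S) (V - S)) x) x)))"
    proof (intro sum_mono mult_left_mono)
      fix V assume "V \<in> Pow W"
      then have V: "V \<subseteq> W" and finV: "finite V" using finW finite_subset by auto
      have inv: "P (override_on x v V) = P x" for v
        using y V disj A' A'W unfolding P_def by (intro arg_cong[where f = ennreal] prod.cong) (auto simp: override_on_def)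
      have "?I V (C A V) x \<le> ?I V (\<lambda>x. P x * (\<Sum>S\<in>Pow V. q S x * C (A' \<union> S) (V - S) x)) x"
        unfolding nn_integral_at_def using step[OF V] by (intro nn_integral_mono) auto
      also have "\<dots> = P x * ?I V (\<lambda>x. \<Sum>S\<in>Pow V. q S x * C (A' \<union> S) (V - S) x) x"
        using inv by (intro nn_integral_at_cmult) auto
      also have "?I V (\<lambda>x. \<Sum>S\<in>Pow V. q S x * C (A' \<union> S) (V - S) x) x =
         (\<Sum>S\<in>Pow V. ?I V (\<lambda>x. q S x * C (A' \<union> S) (V - S) x) x)"
        by (intro nn_integral_at_sum) auto
      also have "\<dots> = (\<Sum>S\<in>Pow V. ?I S (\<lambda>x. q S x * ?I (V - S) (C (A' \<union> S) (V - S)) x) x)"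
      proof (intro sum.cong refl)
        fix S assume "S \<in> Pow V"
        then have S: "S \<subseteq> V" and finS: "finite S" using finV finite_subset by auto
        have "?I V (\<lambda>x. q S x * C (A' \<union> S) (V - S) x) x =
           ?I (S \<union> (V - S)) (\<lambda>x. q S x * C (A' \<union> S) (V - S) x) x" using S by (simp add: Un_absorb1)
        also have "\<dots> = ?I S (?I (V - S) (\<lambda>x. q S x * C (A' \<union> S) (V - S) x)) x"
          using finS finV by (intro nn_integral_at_Un) auto
        also have "?I (V - S) (\<lambda>x. q S x * C (A' \<union> S) (V - S) x) = (\<lambda>x. q S x * ?I (V - S) (C (A' \<union> S) (V - S)) x)"
        proof
          fix z
          have "q S (override_on z v (V - S)) = q S z" for v
            using yW V unfolding q_def
            by (intro arg_cong[where f = ennreal] prod.cong) (auto simp: override_on_def)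
          then show "?I (V - S) (\<lambda>x. q S x * C (A' \<union> S) (V - S) x) z = q S z * ?I (V - S) (C (A' \<union> S) (V - S)) z"
            by (intro nn_integral_at_cmult) auto
        qed
        finally show "?I V (\<lambda>x. q S x * C (A' \<union> S) (V - S) x) x =
          ?I S (\<lambda>x. q S x * ?I (V - S) (C (A' \<union> S) (V - S)) x) x" .
      qed
      finally show "?I V (C A V) x \<le> P x * (\<Sum>S\<in>Pow V. ?I S (\<lambda>x. q S x * ?I (V - S) (C (A' \<union> S) (V - S)) x) x)" .
    qed simp
    also have "\<dots> = P x * (\<Sum>V\<in>Pow W. \<Sum>S\<in>Pow V. ennreal (c ^ card S) *
         (ennreal (c ^ card (V - S)) * ?I S (\<lambda>x. q S x * ?I (V - S) (C (A' \<union> S) (V - S)) x) x))"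
      unfolding sum_distrib_left
    proof (intro sum.cong refl)
      fix V S assume "V \<in> Pow W" and S: "S \<in> Pow V"
      then have "finite V" using finW finite_subset by auto
      then have "card V = card S + card (V - S)"
        using S by (metis PowD card_Diff_subset card_mono finite_subset le_add_diff_inverse)
      then have "ennreal (c ^ card V) = ennreal (c ^ card S) * ennreal (c ^ card (V - S))"
        using c by (simp add: power_add ennreal_mult)
      then show "ennreal (c ^ card V) * (P x * ?I S (\<lambda>x. q S x * ?I (V - S) (C (A' \<union> S) (V - S)) x) x) =
         P x * (ennreal (c ^ card S) * (ennreal (c ^ card (V - S)) * ?I S (\<lambda>x. q S x * ?I (V - S) (C (A' \<union> S) (V - S)) x) x))"
        by (simp add: ac_simps)
    qed
    \<comment> \<open>With S chosen first, the inner sum over V is the left side of the induction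
      hypothesis for the roots \<open>A' \<union> S\<close>.\<close>
    also have "\<dots> = P x * (\<Sum>S\<in>Pow W. \<Sum>V\<in>Pow (W - S). ennreal (c ^ card S) *
         (ennreal (c ^ card V) * ?I S (\<lambda>x. q S x * ?I V (C (A' \<union> S) V) x) x))"
      by (subst sum_Pow_Pow[OF finW, of "\<lambda>S V. ennreal (c ^ card S) *
         (ennreal (c ^ card V) * ?I S (\<lambda>x. q S x * ?I V (C (A' \<union> S) V) x) x)"]) simp
    also have "\<dots> \<le> P x * (\<Sum>S\<in>Pow W. ennreal (c ^ card S) * (B x * kernel a (card S) (x y)))"
    proof (intro mult_left_mono sum_mono)
      fix S assume "S \<in> Pow W"
      then have S: "S \<subseteq> W" and finS: "finite S" using finW finite_subset by auto
      have fin: "finite V" if "V \<in> Pow (W - S)" for V using that finW finite_subset by auto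
      have "(\<Sum>V\<in>Pow (W - S). ennreal (c ^ card S) * (ennreal (c ^ card V) * ?I S (\<lambda>x. q S x * ?I V (C (A' \<union> S) V) x) x))
         = ennreal (c ^ card S) * (\<Sum>V\<in>Pow (W - S). ?I S (\<lambda>x. ennreal (c ^ card V) * (q S x * ?I V (C (A' \<union> S) V) x)) x)"
        using fin unfolding sum_distrib_left
        by (intro sum.cong refl arg_cong2[where f = "(*)"] nn_integral_at_cmult[symmetric]) auto
      also have "(\<Sum>V\<in>Pow (W - S). ?I S (\<lambda>x. ennreal (c ^ card V) * (q S x * ?I V (C (A' \<union> S) V) x)) x)
         = ?I S (\<lambda>x. \<Sum>V\<in>Pow (W - S). ennreal (c ^ card V) * (q S x * ?I V (C (A' \<union> S) V) x)) x"
        using fin by (intro nn_integral_at_sum[symmetric]) auto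
      also have "\<dots> = ?I S (\<lambda>x. q S x * (\<Sum>V\<in>Pow (W - S). ennreal (c ^ card V) * ?I V (C (A' \<union> S) V) x)) x"
        by (simp add: sum_distrib_left mult.left_commute)
      also have "\<dots> \<le> ?I S (\<lambda>x. B x * K S x) x"
      \<comment> \<open>The induction hypothesis requires the new roots to lie in G, which holds for
        almost every value of each coordinate in S.\<close>
      proof (rule nn_integral_at_mono[OF finS _ _ G])
        show "(\<lambda>x. q S x * (\<Sum>V\<in>Pow (W - S). ennreal (c ^ card V) * ?I V (C (A' \<union> S) V) x)) \<in> borel_measurable config"
          using fin by (intro borel_measurable_times_ennreal borel_measurable_sum) auto
        fix z assume z: "\<And>i. i \<in> S \<Longrightarrow> z i \<in> G" "\<And>i. i \<notin> S \<Longrightarrow> z i = x i"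
        show "q S z * (\<Sum>V\<in>Pow (W - S). ennreal (c ^ card V) * ?I V (C (A' \<union> S) V) z) \<le> B z * K S z"
        proof (rule inner[OF S])
          fix i assume "i \<in> A' \<union> S" then show "z i \<in> G"
            using z[of i] xG[of i] A' by (cases "i \<in> S") auto
        qed
      qed auto
      also have "\<dots> = B x * ?I S (K S) x"
      proof (rule nn_integral_at_cmult)
        fix v
        have *: "override_on x v S i = x i" if "i \<in> A'" for i
          using that S A'W by (auto simp: override_on_def)
        then have "pair_boltzmann f A' (override_on x v S) = pair_boltzmann f A' x"
          by (intro pair_boltzmann_cong f_sym) auto
        then show "B (override_on x v S) = B x" using * unfolding B_def by simp
      qed auto
      also have "?I S (K S) x = kernel a (card S) (x y)"
        unfolding K_def using finS S yW by (intro nn_integral_at_kernel) auto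
      finally show "(\<Sum>V\<in>Pow (W - S). ennreal (c ^ card S) * (ennreal (c ^ card V) * ?I S (\<lambda>x. q S x * ?I V (C (A' \<union> S) V) x) x))
        \<le> ennreal (c ^ card S) * (B x * kernel a (card S) (x y))"
        by (simp add: mult_left_mono)
    qed simp
    also have "\<dots> = P x * B x * (\<Sum>S\<in>Pow W. ennreal (c ^ card S) * kernel a (card S) (x y))"
      by (simp add: sum_distrib_left ac_simps)
    also have "(\<Sum>S\<in>Pow W. ennreal (c ^ card S) * kernel a (card S) (x y)) =
       (\<Sum>k\<le>card W. of_nat (card W choose k) * (ennreal (c ^ k) * kernel a k (x y)))"
      by (rule sum_Pow_card[OF finW])
    \<comment> \<open>Here \<open>c * card W\<close> being at most 1 brings the weights down to
      1/k!, after which the hypothesis on a at the removed root supplies its factor exp(a).\<close>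
    also have "\<dots> \<le> (\<Sum>k\<le>card W. ennreal (1 / fact k) * kernel a k (x y))"
    proof (rule sum_mono)
      fix k
      have "of_nat (card W choose k) * (ennreal (c ^ k) * kernel a k (x y)) =
         ennreal (real (card W choose k) * c ^ k) * kernel a k (x y)"
        using c by (simp add: ennreal_mult ennreal_of_nat_eq_real_of_nat mult.assoc)
      also have "\<dots> \<le> ennreal (1 / fact k) * kernel a k (x y)"
        using binomial_weight_le[OF c cW] by (intro mult_right_mono ennreal_leI) auto
      finally show "of_nat (card W choose k) * (ennreal (c ^ k) * kernel a k (x y)) \<le> ennreal (1 / fact k) * kernel a k (x y)" .
    qed
    also have "\<dots> \<le> ennreal (exp (a (x y)))" using KP xG y by auto
    \<comment> \<open>The factors 1 + f between y and the other roots restore the full pair factor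
      of A, closing the induction with no loss.\<close>
    also have "P x * B x * ennreal (exp (a (x y))) = ennreal (pair_boltzmann f A x * (\<Prod>i\<in>A. exp (a (x i))))"
    proof -
      have A: "A = insert y A'" using y by (auto simp: A'_def)
      have "pair_boltzmann f A x = (\<Prod>s\<in>A'. 1 + f (x y) (x s)) * pair_boltzmann f A' x"
        unfolding A using finA' A' by (subst edge_weight_prod_insert) (auto simp: edge_wt_pair f_sym)
      moreover have "(\<Prod>i\<in>A. exp (a (x i))) = exp (a (x y)) * (\<Prod>i\<in>A'. exp (a (x i)))"
        unfolding A using finA' A' by simp
      ultimately show ?thesis unfolding P_def B_def
        using one_plus_f by (simp add: pair_boltzmann_nonneg prod_nonneg flip: ennreal_mult)
    qed
    finally show ?thesis by (simp add: C_def mult_left_mono)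
  qed
qed

end

subsection \<open>The bound on the Ursell functions\<close>

context mayer_space begin

definition ursell_integral :: "nat \<Rightarrow> 'a \<Rightarrow> ennreal" where
  "ursell_integral n u =
    (\<integral>\<^sup>+ y. ennreal \<bar>ursell f (Suc n) (\<lambda>i. if i = 0 then u else y (i - 1))\<bar> \<partial>PiM {..<n} (\<lambda>_. M))"

lemma ursell_integral_0 [simp]: "ursell_integral 0 u = 1"
  by (simp add: ursell_integral_def ursell_eq_cluster nn_integral_empty del: nn_integral_const)

lemma measurable_ursell_comp:
  assumes "\<And>i. i < n \<Longrightarrow> (\<lambda>y. g y i) \<in> N \<rightarrow>\<^sub>M M"
  shows "(\<lambda>y. ursell f n (g y)) \<in> borel_measurable N"
  unfolding ursell_def
proof (intro borel_measurable_sum borel_measurable_prod measurable_f_comp assms)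
  fix E e assume "E \<in> connected_graphs n" "e \<in> E"
  then have "e \<subseteq> {..<n}" "card e = 2" by (auto simp: connected_graphs_def graph_edges_def)
  then have "Min e \<in> {..<n}" "Max e \<in> {..<n}" by (auto simp: card_2_iff min_def max_def)
  then show "Min e < n" "Max e < n" by auto
qed

lemma nn_integral_at_cluster:
  assumes "finite V" "0 \<notin> V"
  shows "nn_integral_at V (\<lambda>x. ennreal \<bar>cluster f {0} V x\<bar>) x = ursell_integral (card V) (x 0)"
proof -
  obtain p where p: "bij_betw p {..<card V} V"
    using assms(1) by (metis atLeast0LessThan ex_bij_betw_nat_finite)
  have V: "V = p ` {..<card V}" and inj: "inj_on p {..<card V}" using p by (auto simp: bij_betw_def)
  have pV: "p i \<in> V" if "i < card V" for i using p that by (auto simp: bij_betw_def)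
  \<comment> \<open>P extends p by the root 0; the shift by one matches the Ursell function, where
    vertex i > 0 sits at coordinate i - 1.\<close>
  define P where "P i = (if i = 0 then 0 else p (i - 1))" for i
  have PV: "P ` {1..<Suc (card V)} = V"
  proof -
    have "P ` {1..<Suc (card V)} = P ` Suc ` {..<card V}"
      by (simp add: lessThan_atLeast0 image_Suc_atLeastLessThan)
    also have "\<dots> = p ` {..<card V}" unfolding image_image by (simp add: P_def)
    finally show ?thesis by (simp only: V[symmetric])
  qed
  have injP: "inj_on P ({0} \<union> {1..<Suc (card V)})"
  proof (rule inj_onI)
    fix i j assume ij: "i \<in> {0} \<union> {1..<Suc (card V)}" "j \<in> {0} \<union> {1..<Suc (card V)}" "P i = P j"
    have PV': "P k \<noteq> 0" if "k \<in> {0} \<union> {1..<Suc (card V)}" "k \<noteq> 0" for k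
    proof -
      have "P k \<in> P ` {1..<Suc (card V)}" using that by (intro imageI) auto
      then have "P k \<in> V" by (simp only: PV)
      then show ?thesis using assms(2) by metis
    qed
    have P0: "P 0 = 0" by (simp add: P_def)
    show "i = j"
    proof (cases "i = 0 \<or> j = 0")
      case True
      with PV'[OF ij(1)] PV'[OF ij(2)] ij(3) P0 show ?thesis by metis
    next
      case False
      then have "p (i - 1) = p (j - 1)" using ij(3) by (simp add: P_def)
      then have "i - 1 = j - 1" by (rule inj_onD[OF inj]) (use ij False in auto)
      with False show ?thesis by linarith
    qed
  qed
  show ?thesis
    unfolding nn_integral_at_def ursell_integral_def
  proof (rule nn_integral_PiM_relabel[OF _ p])
    fix v :: "nat \<Rightarrow> 'a"
    have "cluster f (P ` {0}) (P ` {1..<Suc (card V)}) (override_on x v V) =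
      cluster f {0} {1..<Suc (card V)} (\<lambda>i. if i = 0 then x 0 else (\<lambda>i\<in>{..<card V}. v (p i)) (i - 1))"
      using assms(2) pV by (intro cluster_relabel f_sym injP) (auto simp: P_def override_on_def)
    then show "ennreal \<bar>cluster f {0} V (override_on x v V)\<bar> =
      ennreal \<bar>ursell f (Suc (card V)) (\<lambda>i. if i = 0 then x 0 else (\<lambda>i\<in>{..<card V}. v (p i)) (i - 1))\<bar>"
      unfolding PV by (simp add: ursell_eq_cluster P_def)
  next
    show "(\<lambda>y. ennreal \<bar>ursell f (Suc (card V)) (\<lambda>i. if i = 0 then x 0 else y (i - 1))\<bar>)
      \<in> borel_measurable (PiM {..<card V} (\<lambda>_. M))"
    proof (intro measurable_compose[OF _ measurable_ennreal] borel_measurable_abs measurable_ursell_comp)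
      fix i assume "i < Suc (card V)"
      then show "(\<lambda>y. if i = 0 then x 0 else y (i - 1)) \<in> PiM {..<card V} (\<lambda>_. M) \<rightarrow>\<^sub>M M"
        by (cases "i = 0") (auto simp: space_M)
    qed
  qed simp
qed

text \<open>Subsets of {1..N} of equal size give equal integrals, so the weighted sum for c = 1/N
  has the weights binom(N,n)/N^n. Only the first m + 1 terms are kept when N tends to infinity,
  which makes the limit one of a finite sum.\<close>

lemma sum_ursell_integral_le:
  fixes a :: "'a \<Rightarrow> real"
  assumes a: "a \<in> borel_measurable M"
    and G: "AE u in M. u \<in> G"
    and KP: "\<And>u n. u \<in> G \<Longrightarrow> (\<Sum>k\<le>n. ennreal (1 / fact k) * kernel a k u) \<le> ennreal (exp (a u))"
    and u: "u \<in> G"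
  shows "(\<Sum>n\<le>m. ennreal (1 / fact n) * ursell_integral n u) \<le> ennreal (exp (a u))"
proof -
  let ?w = "\<lambda>N n. ennreal (real (N choose n) * (1 / real N) ^ n)"
  have *: "(\<Sum>n\<le>N. ?w N n * ursell_integral n u) \<le> ennreal (exp (a u))" if N: "0 < N" for N
  proof -
    have "(\<Sum>n\<le>N. ?w N n * ursell_integral n u)
      = (\<Sum>n\<le>card {1..N}. of_nat (card {1..N} choose n) * (ennreal ((1 / real N) ^ n) * ursell_integral n u))"
      by (simp add: ennreal_mult ennreal_of_nat_eq_real_of_nat mult.assoc)
    also have "\<dots> = (\<Sum>V\<in>Pow {1..N}. ennreal ((1 / real N) ^ card V) * ursell_integral (card V) u)"
      by (rule sum_Pow_card[symmetric]) simp
    also have "\<dots> = (\<Sum>V\<in>Pow {1..N}. ennreal ((1 / real N) ^ card V) *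
         nn_integral_at V (\<lambda>x. ennreal \<bar>cluster f {0} V x\<bar>) (\<lambda>_. u))"
    proof (intro sum.cong refl arg_cong2[where f = "(*)"])
      fix V assume V: "V \<in> Pow {1..N}"
      then have "finite V" by (meson PowD finite_atLeastAtMost finite_subset)
      moreover have "0 \<notin> V" using V by auto
      ultimately show "ursell_integral (card V) u = nn_integral_at V (\<lambda>x. ennreal \<bar>cluster f {0} V x\<bar>) (\<lambda>_. u)"
        by (simp add: nn_integral_at_cluster)
    qed
    also have "\<dots> \<le> ennreal (pair_boltzmann f {0} (\<lambda>_. u) * (\<Prod>i\<in>{0::nat}. exp (a u)))"
      using u N by (intro weighted_sum_cluster_le[OF a G KP]) auto
    also have "\<dots> = ennreal (exp (a u))"
      by simp
    finally show ?thesis .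
  qed
  have le: "?w N n * ursell_integral n u \<le> ennreal (exp (a u))" if "n \<le> N" "0 < N" for n N
    using that by (intro order_trans[OF member_le_sum *[OF that(2)]]) auto
  \<comment> \<open>The limit below uses \<open>ennreal_tendsto_cmult\<close>, which asks for a
    finite constant. An infinite integral would violate the bound through the single term with N = n
    + 1, a choice that keeps N positive for n = 0.\<close>
  have fin: "ursell_integral n u < top" for n
  proof (rule ccontr)
    assume "\<not> ursell_integral n u < top"
    then have "ursell_integral n u = top" by (simp add: less_top[symmetric])
    moreover have "0 < real (Suc n choose n) * (1 / real (Suc n)) ^ n"
      by (intro mult_pos_pos zero_less_power) auto
    ultimately have "?w (Suc n) n * ursell_integral n u = top"
      by (simp only: ennreal_mult_top ennreal_eq_0_iff not_le[symmetric] if_False not_False_eq_True split: if_split)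
    with le[of n "Suc n"] have "top \<le> ennreal (exp (a u))" by simp
    then show False by (simp add: top_unique)
  qed
  have "(\<lambda>N. \<Sum>n\<le>m. ursell_integral n u * ?w N n) \<longlonglongrightarrow> (\<Sum>n\<le>m. ursell_integral n u * ennreal (1 / fact n))"
    by (intro tendsto_sum ennreal_tendsto_cmult tendsto_ennrealI binomial_weight_tendsto fin)
  moreover have "(\<Sum>n\<le>m. ursell_integral n u * ?w N n) \<le> ennreal (exp (a u))" if N: "Suc m \<le> N" for N
  proof -
    have "(\<Sum>n\<le>m. ursell_integral n u * ?w N n) \<le> (\<Sum>n\<le>N. ursell_integral n u * ?w N n)"
      using N by (intro sum_mono2) auto
    also have "\<dots> \<le> ennreal (exp (a u))" using *[of N] N by (simp add: mult.commute)
    finally show ?thesis .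
  qed
  ultimately have "(\<Sum>n\<le>m. ursell_integral n u * ennreal (1 / fact n)) \<le> ennreal (exp (a u))"
    by (intro LIMSEQ_le_const2) auto
  then show ?thesis by (simp add: mult.commute)
qed

text \<open>The terms of order 0, equal to 1 on both sides, account for the passage between exp(a) -
  1 and exp(a).\<close>

lemma suminf_ursell_integral_le:
  fixes a :: "'a \<Rightarrow> real"
  assumes a: "a \<in> borel_measurable M" and a0: "\<And>u. 0 \<le> a u"
    and G: "AE u in M. u \<in> G"
    and KP: "\<And>u. u \<in> G \<Longrightarrow>
      (\<Sum>k. ennreal (1 / fact (Suc k)) * kernel a (Suc k) u) \<le> ennreal (exp (a u) - 1)"
    and u: "u \<in> G"
  shows "(\<Sum>n. ennreal (1 / fact (Suc n)) * ursell_integral (Suc n) u) \<le> ennreal (exp (a u) - 1)"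
proof (rule suminf_le_const)
  have KP': "(\<Sum>k\<le>n. ennreal (1 / fact k) * kernel a k u) \<le> ennreal (exp (a u))" if u: "u \<in> G" for u n
  proof -
    have "(\<Sum>k\<le>n. ennreal (1 / fact k) * kernel a k u) \<le> (\<Sum>k\<le>Suc n. ennreal (1 / fact k) * kernel a k u)"
      by simp
    also have "\<dots> = 1 + (\<Sum>k\<le>n. ennreal (1 / fact (Suc k)) * kernel a (Suc k) u)"
      by (subst sum.atMost_Suc_shift) simp
    also have "\<dots> \<le> 1 + (\<Sum>k. ennreal (1 / fact (Suc k)) * kernel a (Suc k) u)"
      by (intro add_left_mono sum_le_suminf) auto
    also have "\<dots> \<le> 1 + ennreal (exp (a u) - 1)" using KP[OF u] by (intro add_left_mono)
    also have "\<dots> = ennreal (exp (a u))" using a0[of u] by (simp flip: ennreal_1 ennreal_plus)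
    finally show ?thesis .
  qed
  fix n
  let ?X = "\<Sum>k<n. ennreal (1 / fact (Suc k)) * ursell_integral (Suc k) u"

  have "?X + 1 = (\<Sum>k\<le>n. ennreal (1 / fact k) * ursell_integral k u)"
    using sum.lessThan_Suc_shift[of "\<lambda>k. ennreal (1 / fact k) * ursell_integral k u" n]
    by (simp add: lessThan_Suc_atMost add.commute)
  also have "\<dots> \<le> ennreal (exp (a u))"
    by (rule sum_ursell_integral_le[OF a G KP' u])
  finally have le: "?X + 1 \<le> ennreal (exp (a u))" .
  show "?X \<le> ennreal (exp (a u) - 1)"
  \<comment> \<open>Subtracting 1 from both sides is valid in \<open>ennreal\<close> only after the
    infinite case has been excluded.\<close>
  proof (cases ?X)
    case (real r)
    with le have "ennreal (r + 1) \<le> ennreal (exp (a u))" by (simp add: ennreal_plus)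
    then have "r \<le> exp (a u) - 1" by simp
    with real show ?thesis by (simp add: ennreal_leI)
  next
    case top
    have "top + 1 \<le> ennreal (exp (a u))" using le unfolding top .
    then show ?thesis by (simp add: top_unique)
  qed
qed simp

end

subsection \<open>Power series and weighted integrals\<close>

text \<open>The recursion is B' = L' B in coefficients, so B exp(-L) has zero derivative on the open
  unit disc and equals its value 1 at the origin. The sums themselves are values at the boundary
  point 1 and are reached as limits from inside.\<close>

lemma suminf_eq_exp_suminf:
  fixes b g :: "nat \<Rightarrow> complex"
  assumes b0: "b 0 = 1" and g0: "g 0 = 0"
    and rec: "\<And>n. of_nat (Suc n) * b (Suc n) = (\<Sum>k\<le>n. of_nat (Suc k) * g (Suc k) * b (n - k))"
    and sb: "summable (\<lambda>n. norm (b n))" and sg: "summable (\<lambda>n. norm (g n))"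
  shows "(\<Sum>n. b n) = exp (\<Sum>n. g n)"
proof -
  define B L where "B w = (\<Sum>n. b n * w ^ n)" and "L w = (\<Sum>n. g n * w ^ n)" for w :: complex
  have abs: "summable (\<lambda>n. norm (c n * w ^ n))" if "summable (\<lambda>n. norm (c n))" "norm w < 1"
    for c :: "nat \<Rightarrow> complex" and w
    using that by (intro summable_comparison_test'[OF that(1), of 0])
      (auto simp: norm_mult norm_power intro!: mult_left_le power_le_one)
  have deriv: "((\<lambda>w. \<Sum>n. c n * w ^ n) has_field_derivative (\<Sum>n. diffs c n * w ^ n)) (at w)"
    if "summable (\<lambda>n. norm (c n))" "norm w < 1" for c :: "nat \<Rightarrow> complex" and w
    using that summable_norm_cancel[OF that(1)] by (intro termdiffs_strong[of _ 1]) auto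
  \<comment> \<open>The Cauchy product needs the derivative series to converge absolutely, which
    follows by comparison at a radius strictly between |w| and 1.\<close>
  have dabs: "summable (\<lambda>n. norm (diffs g n * w ^ n))" if w: "norm w < 1" for w
  proof -
    define r :: complex where "r = of_real ((norm w + 1) / 2)"
    have r: "norm r < 1" "norm w < norm r" using w unfolding r_def by (simp_all only: norm_of_real) auto
    have "summable (\<lambda>n. diffs g n * r ^ n)"
      using r(1) abs[OF sg] by (intro termdiff_converges[of r 1]) (auto intro: summable_norm_cancel)
    then show ?thesis using r(2) by (rule powser_insidea)
  qed
  have "((\<lambda>w. B w * exp (- L w)) has_field_derivative 0) (at w)" if w: "norm w < 1" for w
  proof -
    have "(\<Sum>n. diffs b n * w ^ n) = (\<Sum>n. \<Sum>k\<le>n. (diffs g k * w ^ k) * (b (n - k) * w ^ (n - k)))"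
    proof (rule arg_cong[where f = suminf], rule ext)
      fix n
      have "(\<Sum>k\<le>n. (diffs g k * w ^ k) * (b (n - k) * w ^ (n - k))) =
          (\<Sum>k\<le>n. of_nat (Suc k) * g (Suc k) * b (n - k) * w ^ n)"
        by (intro sum.cong refl) (auto simp: diffs_def simp flip: power_add)
      then show "diffs b n * w ^ n = (\<Sum>k\<le>n. (diffs g k * w ^ k) * (b (n - k) * w ^ (n - k)))"
        by (simp only: sum_distrib_right[symmetric] rec[symmetric] diffs_def)
    qed
    also have "\<dots> = (\<Sum>n. diffs g n * w ^ n) * B w"
      unfolding B_def using abs[OF sb w] dabs[OF w] by (intro Cauchy_product[symmetric])
    finally have "(B has_field_derivative (\<Sum>n. diffs g n * w ^ n) * B w) (at w)"
      using deriv[OF sb w] by (simp add: B_def[abs_def])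
    moreover have "(L has_field_derivative (\<Sum>n. diffs g n * w ^ n)) (at w)"
      using deriv[OF sg w] by (simp add: L_def[abs_def])
    ultimately show ?thesis by (auto intro!: derivative_eq_intros)
  qed
  then have "\<exists>c. \<forall>w\<in>ball 0 1. B w * exp (- L w) = c"
    by (intro has_field_derivative_zero_constant) (auto intro: has_field_derivative_at_within)
  then obtain c where c: "\<And>w. norm w < 1 \<Longrightarrow> B w * exp (- L w) = c" by (auto simp: dist_norm)
  have "B 0 = 1" "L 0 = 0" using b0 g0 by (simp_all add: B_def L_def powser_zero)
  with c[of 0] have "c = 1" by simp
  with c have eq: "B w = exp (L w)" if "norm w < 1" for w
    using that by (simp add: exp_minus field_simps)
  \<comment> \<open>Points inside the disc tending to 1. There the n-th term is bounded by the norm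
    of the n-th coefficient, so both series converge to their values at 1.\<close>
  define w :: "nat \<Rightarrow> complex" where "w m = of_real (1 - 1 / real (Suc m))" for m
  have wr: "(\<lambda>m. 1 - 1 / real (Suc m)) \<longlonglongrightarrow> 1"
    using tendsto_diff[OF tendsto_const LIMSEQ_inverse_real_of_nat, of "1::real"] by (simp add: inverse_eq_divide)
  have w1: "norm (w m) < 1" for m
    unfolding w_def norm_of_real by (simp add: abs_if field_simps)
  have wlim: "w \<longlonglongrightarrow> 1" using tendsto_of_real[OF wr, where 'a = complex] by (simp add: w_def[abs_def])
  have lim: "(\<lambda>m. \<Sum>n. c n * w m ^ n) \<longlonglongrightarrow> (\<Sum>n. c n)" if "summable (\<lambda>n. norm (c n))" for c :: "nat \<Rightarrow> complex"
  proof -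
    have "(\<lambda>m. c n * w m ^ n) \<longlonglongrightarrow> c n" for n
      using wlim by (auto intro!: tendsto_eq_intros)
    moreover have "norm (c n * w m ^ n) \<le> norm (c n)" for n m
      using w1[of m] by (auto simp: norm_mult norm_power intro!: mult_left_le power_le_one)
    ultimately show ?thesis
      using that by (intro tannerys_theorem[THEN conjunct2, THEN conjunct2]) (auto simp: case_prod_unfold)
  qed
  have "(\<lambda>m. B (w m)) \<longlonglongrightarrow> (\<Sum>n. b n)" unfolding B_def by (rule lim[OF sb])
  moreover have "(\<lambda>m. exp (L (w m))) \<longlonglongrightarrow> exp (\<Sum>n. g n)"
    unfolding L_def by (intro tendsto_exp lim[OF sg])
  ultimately show ?thesis using eq[OF w1] LIMSEQ_unique by auto
qed

section \<open>Complex integrals of products of one-point weights against a bounded kernel\<close>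

context full_sigma_finite_measure begin

lemma integral_PiM_mult:
  fixes g h :: "(nat \<Rightarrow> 'a) \<Rightarrow> complex"
  assumes "finite S" "finite T" "S \<inter> T = {}"
    and int: "integrable (PiM (S \<union> T) (\<lambda>_. M)) (\<lambda>x. g x * h x)"
    and g: "\<And>x y. (\<And>i. i \<in> S \<Longrightarrow> x i = y i) \<Longrightarrow> g x = g y"
    and h: "\<And>x y. (\<And>i. i \<in> T \<Longrightarrow> x i = y i) \<Longrightarrow> h x = h y"
  shows "(\<integral>x. g x * h x \<partial>PiM (S \<union> T) (\<lambda>_. M)) =
    (\<integral>x. g x \<partial>PiM S (\<lambda>_. M)) * (\<integral>x. h x \<partial>PiM T (\<lambda>_. M))"
proof -
  have "g (merge S T (x, y)) = g x" for x y by (rule g) (simp add: merge_def)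
  moreover have "h (merge S T (x, y)) = h y" for x y
    by (rule h) (use assms(3) in \<open>auto simp: merge_def\<close>)
  ultimately show ?thesis
    by (subst product_integral_fold[OF assms(3,1,2) int]) simp
qed

text \<open>One notion serves both series: k is an Ursell function or a Boltzmann factor, while t is
  exp(-h) or 1, set to 0 outside the volume.\<close>

definition weighted_integral :: "((nat \<Rightarrow> 'a) \<Rightarrow> real) \<Rightarrow> ('a \<Rightarrow> complex) \<Rightarrow> nat set \<Rightarrow> complex" where
  "weighted_integral k t S = (\<integral>y. (\<Prod>j\<in>S. t (y j)) * complex_of_real (k y) \<partial>PiM S (\<lambda>_. M))"

lemma integrable_prod_weight:
  fixes t :: "'a \<Rightarrow> complex" and S :: "nat set"
  assumes "finite S" "integrable M t" "k \<in> borel_measurable (PiM S (\<lambda>_. M))" "\<And>y. \<bar>k y\<bar> \<le> C"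
  shows "integrable (PiM S (\<lambda>_. M)) (\<lambda>y. (\<Prod>j\<in>S. t (y j)) * complex_of_real (k y))"
proof (rule Bochner_Integration.integrable_bound)
  have "integrable (PiM S (\<lambda>_. M)) (\<lambda>y. (\<Prod>j\<in>S. t (y j)))"
    by (rule product_integrable_prod[where f = "\<lambda>_. t"]) (use assms in auto)
  then show "integrable (PiM S (\<lambda>_. M)) (\<lambda>y. (\<Prod>j\<in>S. t (y j)) * complex_of_real C)"
    by (intro integrable_mult_left) auto
  have "t \<in> borel_measurable M" using assms(2) by auto
  then show "(\<lambda>y. (\<Prod>j\<in>S. t (y j)) * complex_of_real (k y)) \<in> borel_measurable (PiM S (\<lambda>_. M))"
    using assms(3) by measurable
  show "AE y in PiM S (\<lambda>_. M). norm ((\<Prod>j\<in>S. t (y j)) * complex_of_real (k y)) \<le> norm ((\<Prod>j\<in>S. t (y j)) * complex_of_real C)"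
    using assms(4) by (intro AE_I2) (auto simp: norm_mult intro!: mult_left_mono order_trans[OF assms(4) abs_ge_self])
qed

lemma norm_weighted_integral_le:
  fixes t :: "'a \<Rightarrow> complex"
  assumes "finite S" "integrable M t" "k \<in> borel_measurable (PiM S (\<lambda>_. M))" "\<And>y. \<bar>k y\<bar> \<le> C"
  shows "norm (weighted_integral k t S) \<le> C * (\<integral>u. norm (t u) \<partial>M) ^ card S"
proof -
  have int: "integrable (PiM S (\<lambda>_. M)) (\<lambda>y. C * (\<Prod>j\<in>S. norm (t (y j))))"
    using assms by (intro integrable_mult_right product_integrable_prod[where f = "\<lambda>_ u. norm (t u)"]) auto
  have "norm (weighted_integral k t S) \<le> (\<integral>y. C * (\<Prod>j\<in>S. norm (t (y j))) \<partial>PiM S (\<lambda>_. M))"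
    unfolding weighted_integral_def
  proof (rule order_trans[OF integral_norm_bound integral_mono[OF integrable_norm[OF integrable_prod_weight[OF assms]] int]])
    fix y
    show "norm ((\<Prod>j\<in>S. t (y j)) * complex_of_real (k y)) \<le> C * (\<Prod>j\<in>S. norm (t (y j)))"
      using mult_right_mono[OF assms(4), of "\<Prod>j\<in>S. norm (t (y j))" y]
      by (simp add: norm_mult prod_norm[symmetric] mult.commute prod_nonneg)
  qed
  also have "\<dots> = C * (\<integral>u. norm (t u) \<partial>M) ^ card S"
    using assms by (simp add: product_integral_prod[where f = "\<lambda>_ u. norm (t u)"])
  finally show ?thesis .
qed

lemma weighted_integral_tendsto:
  fixes t :: "'a \<Rightarrow> complex" and s :: "nat \<Rightarrow> 'a \<Rightarrow> complex"
  assumes "finite S" "integrable M t" "k \<in> borel_measurable (PiM S (\<lambda>_. M))" "\<And>y. \<bar>k y\<bar> \<le> C"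
    and s: "\<And>m. s m \<in> borel_measurable M" "\<And>m u. norm (s m u) \<le> norm (t u)" "\<And>u. (\<lambda>m. s m u) \<longlonglongrightarrow> t u"
  shows "(\<lambda>m. weighted_integral k (s m) S) \<longlonglongrightarrow> weighted_integral k t S"
  unfolding weighted_integral_def
proof (rule integral_dominated_convergence)
  show "integrable (PiM S (\<lambda>_. M)) (\<lambda>y. C * (\<Prod>j\<in>S. norm (t (y j))))"
    using assms by (intro integrable_mult_right product_integrable_prod[where f = "\<lambda>_ u. norm (t u)"]) auto
  show "(\<lambda>y. (\<Prod>j\<in>S. t (y j)) * complex_of_real (k y)) \<in> borel_measurable (PiM S (\<lambda>_. M))"
    using integrable_prod_weight[OF assms(1-4)] by auto
  show "(\<lambda>y. (\<Prod>j\<in>S. s m (y j)) * complex_of_real (k y)) \<in> borel_measurable (PiM S (\<lambda>_. M))" for m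
    using assms(3) s(1)[of m] by measurable
  show "AE y in PiM S (\<lambda>_. M). (\<lambda>m. (\<Prod>j\<in>S. s m (y j)) * complex_of_real (k y)) \<longlonglongrightarrow>
      (\<Prod>j\<in>S. t (y j)) * complex_of_real (k y)"
    using s(3) by (intro AE_I2 tendsto_intros)
  show "AE y in PiM S (\<lambda>_. M). norm ((\<Prod>j\<in>S. s m (y j)) * complex_of_real (k y)) \<le> C * (\<Prod>j\<in>S. norm (t (y j)))" for m
  proof (rule AE_I2)
    fix y
    have "norm ((\<Prod>j\<in>S. s m (y j)) * complex_of_real (k y)) = \<bar>k y\<bar> * (\<Prod>j\<in>S. norm (s m (y j)))"
      by (simp add: norm_mult prod_norm)
    also have "\<dots> \<le> C * (\<Prod>j\<in>S. norm (t (y j)))"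
      using s(2) assms(4) order_trans[OF abs_ge_zero assms(4)]
      by (intro mult_mono prod_mono prod_nonneg) auto
    finally show "norm ((\<Prod>j\<in>S. s m (y j)) * complex_of_real (k y)) \<le> C * (\<Prod>j\<in>S. norm (t (y j)))" .
  qed
qed

lemma weighted_integral_relabel:
  fixes p :: "nat \<Rightarrow> nat"
  assumes "finite I" "bij_betw p I K" "t \<in> borel_measurable M" "k \<in> borel_measurable (PiM I (\<lambda>_. M))"
    and eq: "\<And>y. k' y = k (\<lambda>i\<in>I. y (p i))"
  shows "weighted_integral k' t K = weighted_integral k t I"
  unfolding weighted_integral_def
proof (rule integral_PiM_relabel[OF assms(1,2)])
  show "(\<lambda>y. (\<Prod>j\<in>I. t (y j)) * complex_of_real (k y)) \<in> borel_measurable (PiM I (\<lambda>_. M))"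
    using assms(3,4) by measurable
  fix y :: "nat \<Rightarrow> 'a"
  have "(\<Prod>j\<in>K. t (y j)) = (\<Prod>j\<in>I. t (y (p j)))"
    using assms(2) by (auto simp: bij_betw_def prod.reindex)
  also have "\<dots> = (\<Prod>j\<in>I. t ((\<lambda>i\<in>I. y (p i)) j))" by (rule prod.cong) auto
  finally show "(\<Prod>j\<in>K. t (y j)) * complex_of_real (k' y) =
      (\<Prod>j\<in>I. t ((\<lambda>i\<in>I. y (p i)) j)) * complex_of_real (k (\<lambda>i\<in>I. y (p i)))"
    by (simp add: eq)
qed

end

subsection \<open>Partition functions as exponentials\<close>

context mayer_space begin

lemma abs_edge_wt_le_1: "\<bar>edge_wt f x e\<bar> \<le> 1"
  using f_le_0 f_ge_minus_1 order_trans[OF f_le_0, of 1] by (simp add: edge_wt_def abs_le_iff minus_le_iff)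

text \<open>Counting graphs suffices for integrability and for limits at a fixed order. Summability
  over the order comes from the Kirkwood-Salsburg bound instead.\<close>

lemma abs_cluster_le: "\<bar>cluster f A V x\<bar> \<le> card (rooted_graphs A V)"
proof -
  have "\<bar>cluster f A V x\<bar> \<le> (\<Sum>E\<in>rooted_graphs A V. 1)"
    unfolding rooted_sum_def
    by (intro order_trans[OF sum_abs] sum_mono) (auto simp: abs_prod abs_edge_wt_le_1 intro!: prod_le_1)
  then show ?thesis by simp
qed

lemma abs_pair_boltzmann_le_1: "\<bar>pair_boltzmann f U x\<bar> \<le> 1"
  using pair_boltzmann_nonneg pair_boltzmann_le_1 by simp

lemma abs_ursell_le: "0 < n \<Longrightarrow> \<bar>ursell f n x\<bar> \<le> card (rooted_graphs {0} {1..<n})"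
  using abs_cluster_le by (simp add: ursell_eq_cluster)

lemma measurable_ursell: "ursell f n \<in> borel_measurable (PiM {..<n} (\<lambda>_. M))"
  by (rule measurable_ursell_comp) auto

definition ursell_coeff :: "('a \<Rightarrow> complex) \<Rightarrow> nat \<Rightarrow> complex" where
  "ursell_coeff t n = weighted_integral (ursell f n) t {..<n}"

definition partition_coeff :: "('a \<Rightarrow> complex) \<Rightarrow> nat \<Rightarrow> complex" where
  "partition_coeff t n = weighted_integral (pair_boltzmann f {..<n}) t {..<n}"

lemma weighted_integral_pair_boltzmann:
  assumes "finite T" "t \<in> borel_measurable M"
  shows "weighted_integral (pair_boltzmann f T) t T = partition_coeff t (card T)"
proof -
  obtain p where p: "bij_betw p {..<card T} T"
    using assms(1) by (metis atLeast0LessThan ex_bij_betw_nat_finite)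
  show ?thesis
    unfolding partition_coeff_def
  proof (rule weighted_integral_relabel[OF _ p assms(2) measurable_pair_boltzmann])
    fix y :: "nat \<Rightarrow> 'a"
    have "pair_boltzmann f (p ` {..<card T}) y = pair_boltzmann f {..<card T} (\<lambda>i\<in>{..<card T}. y (p i))"
      using p by (intro pair_boltzmann_relabel f_sym) (auto simp: bij_betw_def)
    then show "pair_boltzmann f T y = pair_boltzmann f {..<card T} (\<lambda>i\<in>{..<card T}. y (p i))"
      using p by (simp add: bij_betw_def)
  qed auto
qed

lemma weighted_integral_cluster:
  assumes "finite V" "0 \<notin> V" "t \<in> borel_measurable M"
  shows "weighted_integral (cluster f {0} V) t (insert 0 V) = ursell_coeff t (Suc (card V))"
proof -
  have "card (insert 0 V) = Suc (card V)" using assms by simp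
  then obtain p where p: "bij_betw p {..<Suc (card V)} ({0} \<union> V)"
    using assms(1) by (metis atLeast0LessThan ex_bij_betw_nat_finite finite.insertI insert_is_Un)
  show ?thesis
    unfolding ursell_coeff_def
  proof (rule weighted_integral_relabel[OF _ _ assms(3) measurable_ursell])
    show "bij_betw p {..<Suc (card V)} (insert 0 V)" using p by simp
    fix y :: "nat \<Rightarrow> 'a"
    show "cluster f {0} V y = ursell f (Suc (card V)) (\<lambda>i\<in>{..<Suc (card V)}. y (p i))"
      by (rule cluster_eq_ursell[OF f_sym _ p]) (use assms in auto)
  qed auto
qed

text \<open>With root set {0}, \<open>edge_weight_prod_Un\<close> splits off the component of vertex
  0. The cluster and the rest involve disjoint coordinates, so the integral factors, and the
  binomial coefficient counts the clusters with k further vertices.\<close>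

lemma partition_coeff_Suc:
  assumes t: "integrable M t"
  shows "partition_coeff t (Suc n) =
    (\<Sum>k\<le>n. of_nat (n choose k) * (ursell_coeff t (Suc k) * partition_coeff t (n - k)))"
proof -
  have tm: "t \<in> borel_measurable M" using t by auto
  let ?D = "{1..n}"
  let ?g = "\<lambda>V y. (\<Prod>j\<in>insert 0 V. t (y j)) * complex_of_real (cluster f {0} V y)"
  let ?h = "\<lambda>T y. (\<Prod>j\<in>T. t (y j)) * complex_of_real (pair_boltzmann f T y)"
  have S: "{..<Suc n} = {0} \<union> ?D" by auto
  have fin: "finite V" "0 \<notin> V" "insert 0 V \<inter> (?D - V) = {}" "insert 0 V \<union> (?D - V) = {..<Suc n}"
    if "V \<in> Pow ?D" for V using that finite_subset[of V ?D] by auto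
  have split: "?g V y * ?h (?D - V) y = (\<Prod>j\<in>{..<Suc n}. t (y j)) *
      complex_of_real (cluster f {0} V y * pair_boltzmann f (?D - V) y)" if V: "V \<in> Pow ?D" for V y
  proof -
    have "(\<Prod>j\<in>{..<Suc n}. t (y j)) = (\<Prod>j\<in>insert 0 V. t (y j)) * (\<Prod>j\<in>?D - V. t (y j))"
      using fin[OF V] by (subst fin(4)[OF V, symmetric], subst prod.union_disjoint) auto
    then show ?thesis by simp
  qed
  have int: "integrable (PiM {..<Suc n} (\<lambda>_. M)) (\<lambda>y. ?g V y * ?h (?D - V) y)" if V: "V \<in> Pow ?D" for V
    unfolding split[OF V]
  proof (rule integrable_prod_weight[OF _ t])
    show "(\<lambda>y. cluster f {0} V y * pair_boltzmann f (?D - V) y) \<in> borel_measurable (PiM {..<Suc n} (\<lambda>_. M))"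
      using V by (intro borel_measurable_times measurable_cluster measurable_pair_boltzmann) auto
    show "\<bar>cluster f {0} V y * pair_boltzmann f (?D - V) y\<bar> \<le> real (card (rooted_graphs {0} V)) * 1" for y
      unfolding abs_mult by (intro mult_mono abs_cluster_le abs_pair_boltzmann_le_1) auto
  qed simp
  have "pair_boltzmann f {..<Suc n} y = (\<Sum>V\<in>Pow ?D. cluster f {0} V y * pair_boltzmann f (?D - V) y)" for y
    unfolding S by (rule edge_weight_prod_Un) auto
  then have "partition_coeff t (Suc n) =
      (\<integral>y. (\<Sum>V\<in>Pow ?D. ?g V y * ?h (?D - V) y) \<partial>PiM {..<Suc n} (\<lambda>_. M))"
    unfolding partition_coeff_def weighted_integral_def
    by (simp only: of_real_sum sum_distrib_left split cong: sum.cong)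
  also have "\<dots> = (\<Sum>V\<in>Pow ?D. \<integral>y. ?g V y * ?h (?D - V) y \<partial>PiM {..<Suc n} (\<lambda>_. M))"
    using int by (intro Bochner_Integration.integral_sum)
  also have "\<dots> = (\<Sum>V\<in>Pow ?D. ursell_coeff t (Suc (card V)) * partition_coeff t (n - card V))"
  proof (intro sum.cong refl)
    fix V assume V: "V \<in> Pow ?D"
    have "(\<integral>y. ?g V y * ?h (?D - V) y \<partial>PiM {..<Suc n} (\<lambda>_. M)) =
       (\<integral>y. ?g V y \<partial>PiM (insert 0 V) (\<lambda>_. M)) * (\<integral>y. ?h (?D - V) y \<partial>PiM (?D - V) (\<lambda>_. M))"
      unfolding fin(4)[OF V, symmetric]
    proof (rule integral_PiM_mult)
      show "integrable (PiM (insert 0 V \<union> (?D - V)) (\<lambda>_. M)) (\<lambda>y. ?g V y * ?h (?D - V) y)"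
        using int[OF V] by (simp only: fin(4)[OF V])
    next
      fix x y :: "nat \<Rightarrow> 'a" assume eq: "\<And>i. i \<in> insert 0 V \<Longrightarrow> x i = y i"
      then have "cluster f {0} V x = cluster f {0} V y" by (intro cluster_cong f_sym) auto
      moreover have "(\<Prod>j\<in>insert 0 V. t (x j)) = (\<Prod>j\<in>insert 0 V. t (y j))"
        using eq by (intro prod.cong) auto
      ultimately show "?g V x = ?g V y" by simp
    next
      fix x y :: "nat \<Rightarrow> 'a" assume eq: "\<And>i. i \<in> ?D - V \<Longrightarrow> x i = y i"
      then have "pair_boltzmann f (?D - V) x = pair_boltzmann f (?D - V) y" by (intro pair_boltzmann_cong f_sym) auto
      moreover have "(\<Prod>j\<in>?D - V. t (x j)) = (\<Prod>j\<in>?D - V. t (y j))"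
        using eq by (intro prod.cong) auto
      ultimately show "?h (?D - V) x = ?h (?D - V) y" by simp
    qed (use fin[OF V] in auto)
    also have "(\<integral>y. ?g V y \<partial>PiM (insert 0 V) (\<lambda>_. M)) = ursell_coeff t (Suc (card V))"
      using weighted_integral_cluster[OF fin(1,2)[OF V] tm] by (simp only: weighted_integral_def)
    also have "(\<integral>y. ?h (?D - V) y \<partial>PiM (?D - V) (\<lambda>_. M)) = partition_coeff t (card (?D - V))"
      using weighted_integral_pair_boltzmann[OF _ tm, of "?D - V"] by (simp only: weighted_integral_def finite_Diff finite_atLeastAtMost)
    also have "card (?D - V) = n - card V" using V fin(1)[OF V] by (subst card_Diff_subset) auto
    finally show "(\<integral>y. ?g V y * ?h (?D - V) y \<partial>PiM {..<Suc n} (\<lambda>_. M)) =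
      ursell_coeff t (Suc (card V)) * partition_coeff t (n - card V)" .
  qed
  also have "\<dots> = (\<Sum>k\<le>n. of_nat (n choose k) * (ursell_coeff t (Suc k) * partition_coeff t (n - k)))"
    using sum_Pow_card[of ?D "\<lambda>k. ursell_coeff t (Suc k) * partition_coeff t (n - k)"] by simp
  finally show ?thesis .
qed

lemma partition_coeff_0 [simp]: "partition_coeff t 0 = 1"
  by (simp add: partition_coeff_def weighted_integral_def measure_def space_PiM)

lemma norm_partition_coeff_le: "integrable M t \<Longrightarrow> norm (partition_coeff t n) \<le> (\<integral>u. norm (t u) \<partial>M) ^ n"
  using norm_weighted_integral_le[of "{..<n}" t "pair_boltzmann f {..<n}" 1]
  by (simp add: partition_coeff_def measurable_pair_boltzmann abs_pair_boltzmann_le_1)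

definition partition_sum :: "('a \<Rightarrow> complex) \<Rightarrow> complex" where
  "partition_sum t = (\<Sum>n. partition_coeff t n / fact n)"

lemma partition_sum_eq_exp:
  assumes t: "integrable M t" and sg: "summable (\<lambda>n. norm (ursell_coeff t (Suc n) / fact (Suc n)))"
  shows "partition_sum t = exp (\<Sum>n. ursell_coeff t (Suc n) / fact (Suc n))"
proof -
  \<comment> \<open>The value at 0 is forced to vanish: \<open>ursell_coeff t 0\<close> is 1, since
    the empty graph on no vertices counts as connected, but the logarithm has no constant
    term.\<close>
  define g where "g n = (if n = 0 then 0 else ursell_coeff t n / fact n)" for n
  have gS: "g (Suc n) = ursell_coeff t (Suc n) / fact (Suc n)" for n by (simp add: g_def)
  have sg': "summable (\<lambda>n. norm (g n))"
    using sg unfolding gS[symmetric] by (rule summable_Suc_iff[of "\<lambda>n. norm (g n)", THEN iffD1])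
  have "partition_sum t = exp (\<Sum>n. g n)"
    unfolding partition_sum_def
  proof (rule suminf_eq_exp_suminf[OF _ _ _ _ sg'])
    show "summable (\<lambda>n. norm (partition_coeff t n / fact n))"
    proof (rule summable_comparison_test'[where N = 0])
      show "summable (\<lambda>n. inverse (fact n) * (\<integral>u. norm (t u) \<partial>M) ^ n)" by (rule summable_exp)
      show "norm (norm (partition_coeff t n / fact n)) \<le> inverse (fact n) * (\<integral>u. norm (t u) \<partial>M) ^ n" for n
        using norm_partition_coeff_le[OF t] by (simp add: norm_divide field_simps)
    qed
    fix n
    have "of_nat (Suc n) * (partition_coeff t (Suc n) / fact (Suc n)) = partition_coeff t (Suc n) / fact n"
      by (simp add: field_simps del: of_nat_Suc)
    also have "\<dots> = (\<Sum>k\<le>n. of_nat (n choose k) * (ursell_coeff t (Suc k) * partition_coeff t (n - k)) / fact n)"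
      by (simp add: partition_coeff_Suc[OF t] sum_divide_distrib)
    also have "\<dots> = (\<Sum>k\<le>n. of_nat (Suc k) * g (Suc k) * (partition_coeff t (n - k) / fact (n - k)))"
    proof (intro sum.cong refl)
      fix k assume "k \<in> {..n}"
      then have *: "of_nat (n choose k) = (fact n / (fact k * fact (n - k)) :: complex)"
        by (intro binomial_fact) simp
      have **: "of_nat (Suc k) * g (Suc k) = ursell_coeff t (Suc k) / fact k"
        by (simp add: g_def field_simps del: of_nat_Suc)
      show "of_nat (n choose k) * (ursell_coeff t (Suc k) * partition_coeff t (n - k)) / fact n =
          of_nat (Suc k) * g (Suc k) * (partition_coeff t (n - k) / fact (n - k))"
        unfolding * ** by (simp add: field_simps)
    qed
    finally show "of_nat (Suc n) * (partition_coeff t (Suc n) / fact (Suc n)) =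
      (\<Sum>k\<le>n. of_nat (Suc k) * g (Suc k) * (partition_coeff t (n - k) / fact (n - k)))" .
  qed (simp_all add: g_def)
  also have "(\<Sum>n. g n) = (\<Sum>n. g (Suc n))"
    using suminf_split_head[OF summable_norm_cancel[OF sg']] by (simp add: g_def)
  finally show ?thesis by (simp only: gS)
qed

section \<open>Ursell integrals with one marked vertex\<close>

lemma measurable_ursell_integral [measurable]: "ursell_integral n \<in> borel_measurable M"
proof -
  interpret P: sigma_finite_measure "PiM {..<n} (\<lambda>_. M)" by (rule sigma_finite) simp
  have "(\<lambda>q. ennreal \<bar>ursell f (Suc n) (\<lambda>i. if i = 0 then fst q else snd q (i - 1))\<bar>)
      \<in> borel_measurable (M \<Otimes>\<^sub>M PiM {..<n} (\<lambda>_. M))"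
  proof (intro measurable_compose[OF _ measurable_ennreal] borel_measurable_abs measurable_ursell_comp)
    fix i assume "i < Suc n"
    then show "(\<lambda>q. if i = 0 then fst q else snd q (i - 1)) \<in> M \<Otimes>\<^sub>M PiM {..<n} (\<lambda>_. M) \<rightarrow>\<^sub>M M"
      by (cases "i = 0") auto
  qed
  then show ?thesis
    unfolding ursell_integral_def[abs_def] by (intro P.borel_measurable_nn_integral) (simp add: case_prod_unfold)
qed

lemma nn_integral_ursell_root:
  assumes [measurable]: "g \<in> borel_measurable M"
  shows "(\<integral>\<^sup>+ y. g (y 0) * ennreal \<bar>ursell f (Suc n) y\<bar> \<partial>PiM {..<Suc n} (\<lambda>_. M)) =
    (\<integral>\<^sup>+ u. g u * ursell_integral n u \<partial>M)"
proof -
  have S: "{..<Suc n} = insert 0 {1..<Suc n}" by auto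
  have "(\<lambda>y. g (y 0) * ennreal \<bar>ursell f (Suc n) y\<bar>) \<in> borel_measurable (PiM {..<Suc n} (\<lambda>_. M))"
    using measurable_ursell[of "Suc n"] by measurable
  then have m: "(\<lambda>y. g (y 0) * ennreal \<bar>ursell f (Suc n) y\<bar>) \<in> borel_measurable (PiM (insert 0 {1..<Suc n}) (\<lambda>_. M))"
    by (simp only: S)
  have p: "bij_betw Suc {..<n} {1..<Suc n}"
    by (simp add: bij_betw_def lessThan_atLeast0 image_Suc_atLeastLessThan)
  have "(\<integral>\<^sup>+ y. g (y 0) * ennreal \<bar>ursell f (Suc n) y\<bar> \<partial>PiM {..<Suc n} (\<lambda>_. M)) =
     (\<integral>\<^sup>+ u. (\<integral>\<^sup>+ y. g u * ennreal \<bar>ursell f (Suc n) (y(0 := u))\<bar> \<partial>PiM {1..<Suc n} (\<lambda>_. M)) \<partial>M)"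
    unfolding S by (subst product_nn_integral_insert_rev[OF _ _ m]) auto
  also have "\<dots> = (\<integral>\<^sup>+ u. g u * ursell_integral n u \<partial>M)"
  proof (rule nn_integral_cong)
    fix u
    have m: "(\<lambda>y. ennreal \<bar>ursell f (Suc n) (\<lambda>i. if i = 0 then u else y (i - 1))\<bar>) \<in> borel_measurable (PiM {..<n} (\<lambda>_. M))"
    proof (intro measurable_compose[OF _ measurable_ennreal] borel_measurable_abs measurable_ursell_comp)
      fix i assume "i < Suc n"
      then show "(\<lambda>y. if i = 0 then u else y (i - 1)) \<in> PiM {..<n} (\<lambda>_. M) \<rightarrow>\<^sub>M M"
        by (cases "i = 0") (auto simp: space_M)
    qed
    have "(\<integral>\<^sup>+ y. g u * ennreal \<bar>ursell f (Suc n) (y(0 := u))\<bar> \<partial>PiM {1..<Suc n} (\<lambda>_. M)) =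
      (\<integral>\<^sup>+ y. g u * ennreal \<bar>ursell f (Suc n) (\<lambda>i. if i = 0 then u else y (i - 1))\<bar> \<partial>PiM {..<n} (\<lambda>_. M))"
    proof (rule nn_integral_PiM_relabel[OF _ p])
      fix y :: "nat \<Rightarrow> 'a"
      have "ursell f (Suc n) (y(0 := u)) = ursell f (Suc n) (\<lambda>i. if i = 0 then u else (\<lambda>i\<in>{..<n}. y (Suc i)) (i - 1))"
        by (rule ursell_cong) auto
      then show "g u * ennreal \<bar>ursell f (Suc n) (y(0 := u))\<bar> =
        g u * ennreal \<bar>ursell f (Suc n) (\<lambda>i. if i = 0 then u else (\<lambda>i\<in>{..<n}. y (Suc i)) (i - 1))\<bar>" by simp
    qed (use m in \<open>auto intro: borel_measurable_times_ennreal\<close>)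
    also have "\<dots> = g u * ursell_integral n u"
      unfolding ursell_integral_def using m by (rule nn_integral_cmult)
    finally show "(\<integral>\<^sup>+ y. g u * ennreal \<bar>ursell f (Suc n) (y(0 := u))\<bar> \<partial>PiM {1..<Suc n} (\<lambda>_. M)) = g u * ursell_integral n u" .
  qed
  finally show ?thesis .
qed

text \<open>By symmetry of the Ursell function, the transposition of 0 and j moves the marked point
  to the root.\<close>

lemma nn_integral_ursell_vertex:
  assumes [measurable]: "g \<in> borel_measurable M" and j: "j < Suc n"
  shows "(\<integral>\<^sup>+ y. g (y j) * ennreal \<bar>ursell f (Suc n) y\<bar> \<partial>PiM {..<Suc n} (\<lambda>_. M)) =
    (\<integral>\<^sup>+ u. g u * ursell_integral n u \<partial>M)"
proof -
  define p where "p i = (if i = 0 then j else if i = j then 0 else i)" for i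
  have p: "bij_betw p {..<Suc n} {..<Suc n}"
    using j by (intro bij_betwI[of p _ _ p]) (auto simp: p_def)
  have "(\<integral>\<^sup>+ y. g (y j) * ennreal \<bar>ursell f (Suc n) y\<bar> \<partial>PiM {..<Suc n} (\<lambda>_. M)) =
    (\<integral>\<^sup>+ y. g (y 0) * ennreal \<bar>ursell f (Suc n) y\<bar> \<partial>PiM {..<Suc n} (\<lambda>_. M))"
  proof (rule nn_integral_PiM_relabel[OF _ p])
    show "(\<lambda>y. g (y 0) * ennreal \<bar>ursell f (Suc n) y\<bar>) \<in> borel_measurable (PiM {..<Suc n} (\<lambda>_. M))"
      using measurable_ursell[of "Suc n"] by measurable
    fix y :: "nat \<Rightarrow> 'a"
    have U: "{0} \<union> ({..<Suc n} - {0}) = {..<Suc n}" by auto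
    have "cluster f {0} ({..<Suc n} - {0}) y = ursell f (Suc n) (\<lambda>i\<in>{..<Suc n}. y (p i))"
      by (rule cluster_eq_ursell[where p = p, OF f_sym]) (use p in \<open>auto simp only: U, auto\<close>)
    then show "g (y j) * ennreal \<bar>ursell f (Suc n) y\<bar> =
      g ((\<lambda>i\<in>{..<Suc n}. y (p i)) 0) * ennreal \<bar>ursell f (Suc n) (\<lambda>i\<in>{..<Suc n}. y (p i))\<bar>"
      by (simp add: ursell_eq_cluster_root[of 0] p_def)
  qed simp
  then show ?thesis by (simp add: nn_integral_ursell_root)
qed

text \<open>The weight is 1/n! although n + 1 vertices are present: the factor n + 1 counts the
  positions of the marked vertex carrying g.\<close>

definition ursell_bound :: "('a \<Rightarrow> real) \<Rightarrow> nat \<Rightarrow> ennreal" where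
  "ursell_bound g n = ennreal (1 / fact n) * (\<integral>\<^sup>+ u. ennreal (g u) * ursell_integral n u \<partial>M)"

text \<open>The majorant g is kept separate from |t - s| so that one bound can serve all truncations
  of t and s at once.\<close>

lemma norm_ursell_coeff_diff_le:
  assumes t: "integrable M t" "\<And>u. norm (t u) \<le> 1" and s: "integrable M s" "\<And>u. norm (s u) \<le> 1"
    and g: "g \<in> borel_measurable M" "\<And>u. norm (t u - s u) \<le> g u"
  shows "ennreal (norm ((ursell_coeff t (Suc n) - ursell_coeff s (Suc n)) / fact (Suc n))) \<le> ursell_bound g n"
proof -
  let ?P = "PiM {..<Suc n} (\<lambda>_. M)"
  have [measurable]: "t \<in> borel_measurable M" "s \<in> borel_measurable M" "g \<in> borel_measurable M"
    using t s g by auto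
  have int: "integrable ?P (\<lambda>y. (\<Prod>j<Suc n. t (y j)) * complex_of_real (ursell f (Suc n) y))"
    if "integrable M t" for t :: "'a \<Rightarrow> complex"
    by (rule integrable_prod_weight[OF _ that measurable_ursell abs_ursell_le]) auto
  have "ursell_coeff t (Suc n) - ursell_coeff s (Suc n) =
    (\<integral>y. (\<Prod>j<Suc n. t (y j)) * complex_of_real (ursell f (Suc n) y) - (\<Prod>j<Suc n. s (y j)) * complex_of_real (ursell f (Suc n) y) \<partial>?P)"
    unfolding ursell_coeff_def weighted_integral_def
    by (rule Bochner_Integration.integral_diff[symmetric]) (intro int t s)+
  then have "ennreal (norm (ursell_coeff t (Suc n) - ursell_coeff s (Suc n))) \<le>
    (\<integral>\<^sup>+ y. ennreal (norm ((\<Prod>j<Suc n. t (y j)) * complex_of_real (ursell f (Suc n) y) - (\<Prod>j<Suc n. s (y j)) * complex_of_real (ursell f (Suc n) y))) \<partial>?P)"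
    using integral_norm_bound_ennreal[OF Bochner_Integration.integrable_diff[OF int[OF t(1)] int[OF s(1)]]] by simp
  also have "\<dots> \<le> (\<integral>\<^sup>+ y. (\<Sum>j<Suc n. ennreal (g (y j)) * ennreal \<bar>ursell f (Suc n) y\<bar>) \<partial>?P)"
  proof (rule nn_integral_mono)
    fix y
    have g0: "0 \<le> g u" for u using g(2)[of u] norm_ge_zero order_trans by blast
    have "norm ((\<Prod>j<Suc n. t (y j)) * complex_of_real (ursell f (Suc n) y) - (\<Prod>j<Suc n. s (y j)) * complex_of_real (ursell f (Suc n) y))
      = norm ((\<Prod>j<Suc n. t (y j)) - (\<Prod>j<Suc n. s (y j))) * \<bar>ursell f (Suc n) y\<bar>"
      unfolding left_diff_distrib[symmetric] by (simp only: norm_mult norm_of_real)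
    \<comment> \<open>Telescoping: exchanging the factor at position j costs |t - s| there, as the
      other factors have norm at most 1.\<close>
    also have "\<dots> \<le> (\<Sum>j<Suc n. norm (t (y j) - s (y j))) * \<bar>ursell f (Suc n) y\<bar>"
      using t s by (intro mult_right_mono norm_prod_diff) auto
    also have "\<dots> \<le> (\<Sum>j<Suc n. g (y j)) * \<bar>ursell f (Suc n) y\<bar>"
      using g by (intro mult_right_mono sum_mono) auto
    finally have "ennreal (norm ((\<Prod>j<Suc n. t (y j)) * complex_of_real (ursell f (Suc n) y) - (\<Prod>j<Suc n. s (y j)) * complex_of_real (ursell f (Suc n) y)))
      \<le> ennreal (\<dots>)" by (rule ennreal_leI)
    also have "\<dots> = (\<Sum>j<Suc n. ennreal (g (y j)) * ennreal \<bar>ursell f (Suc n) y\<bar>)"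
      using g0 by (simp only: sum_distrib_right[symmetric] sum_ennreal ennreal_mult[OF sum_nonneg abs_ge_zero])
    finally show "ennreal (norm ((\<Prod>j<Suc n. t (y j)) * complex_of_real (ursell f (Suc n) y) - (\<Prod>j<Suc n. s (y j)) * complex_of_real (ursell f (Suc n) y)))
      \<le> (\<Sum>j<Suc n. ennreal (g (y j)) * ennreal \<bar>ursell f (Suc n) y\<bar>)" .
  qed
  also have "\<dots> = (\<Sum>j<Suc n. \<integral>\<^sup>+ y. ennreal (g (y j)) * ennreal \<bar>ursell f (Suc n) y\<bar> \<partial>?P)"
  proof (rule nn_integral_sum)
    fix j assume [measurable (raw)]: "j \<in> {..<Suc n}"
    show "(\<lambda>y. ennreal (g (y j)) * ennreal \<bar>ursell f (Suc n) y\<bar>) \<in> borel_measurable ?P"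
      using measurable_ursell[of "Suc n"] by measurable
  qed
  also have "\<dots> = (\<Sum>j<Suc n. \<integral>\<^sup>+ u. ennreal (g u) * ursell_integral n u \<partial>M)"
    using nn_integral_ursell_vertex[of "\<lambda>u. ennreal (g u)"] by (intro sum.cong) auto
  also have "\<dots> = of_nat (Suc n) * (\<integral>\<^sup>+ u. ennreal (g u) * ursell_integral n u \<partial>M)" by simp
  finally have le: "ennreal (norm (ursell_coeff t (Suc n) - ursell_coeff s (Suc n))) \<le>
     of_nat (Suc n) * (\<integral>\<^sup>+ u. ennreal (g u) * ursell_integral n u \<partial>M)" .
  have "ennreal (norm ((ursell_coeff t (Suc n) - ursell_coeff s (Suc n)) / fact (Suc n))) =
    ennreal (1 / fact (Suc n)) * ennreal (norm (ursell_coeff t (Suc n) - ursell_coeff s (Suc n)))"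
    by (simp add: norm_divide norm_fact del: fact_Suc flip: ennreal_mult)
  also have "\<dots> \<le> ennreal (1 / fact (Suc n)) * (of_nat (Suc n) * (\<integral>\<^sup>+ u. ennreal (g u) * ursell_integral n u \<partial>M))"
    using le by (rule mult_left_mono) simp
  also have "\<dots> = ursell_bound g n"
  proof -
    have "1 / fact (Suc n) * real (Suc n) = 1 / fact n" by (simp del: of_nat_Suc)
    then have "ennreal (1 / fact (Suc n)) * of_nat (Suc n) = ennreal (1 / fact n)"
      unfolding ennreal_of_nat_eq_real_of_nat by (subst ennreal_mult[symmetric]) auto
    then show ?thesis unfolding ursell_bound_def mult.assoc[symmetric] by simp
  qed
  finally show ?thesis .
qed

end

subsection \<open>Quotients of partition functions\<close>

context mayer_space begin

lemma suminf_ursell_bound_le: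
  assumes [measurable]: "g \<in> borel_measurable M"
    and ub: "AE u in M. (\<Sum>n. ennreal (1 / fact n) * ursell_integral n u) \<le> ennreal (exp (a u))"
  shows "(\<Sum>n. ursell_bound g n) \<le> (\<integral>\<^sup>+ u. ennreal (g u) * ennreal (exp (a u)) \<partial>M)"
proof -
  have "(\<Sum>n. ursell_bound g n) =
      (\<Sum>n. \<integral>\<^sup>+ u. ennreal (g u) * (ennreal (1 / fact n) * ursell_integral n u) \<partial>M)"
  proof (rule arg_cong[where f = suminf], rule ext)
    fix n
    have "(\<integral>\<^sup>+ u. ennreal (g u) * (ennreal (1 / fact n) * ursell_integral n u) \<partial>M) =
        (\<integral>\<^sup>+ u. ennreal (1 / fact n) * (ennreal (g u) * ursell_integral n u) \<partial>M)"
      by (intro nn_integral_cong) (rule mult.left_commute)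
    also have "\<dots> = ursell_bound g n"
      unfolding ursell_bound_def by (rule nn_integral_cmult) measurable
    finally show "ursell_bound g n = (\<integral>\<^sup>+ u. ennreal (g u) * (ennreal (1 / fact n) * ursell_integral n u) \<partial>M)" ..
  qed
  also have "\<dots> = (\<integral>\<^sup>+ u. (\<Sum>n. ennreal (g u) * (ennreal (1 / fact n) * ursell_integral n u)) \<partial>M)"
    by (rule nn_integral_suminf[symmetric]) measurable
  also have "\<dots> = (\<integral>\<^sup>+ u. ennreal (g u) * (\<Sum>n. ennreal (1 / fact n) * ursell_integral n u) \<partial>M)"
    by simp
  also have "\<dots> \<le> (\<integral>\<^sup>+ u. ennreal (g u) * ennreal (exp (a u)) \<partial>M)"
    using ub by (intro nn_integral_mono_AE) (auto elim!: eventually_mono intro: mult_left_mono)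
  finally show ?thesis .
qed

lemma ursell_bound_summable:
  assumes g: "g \<in> borel_measurable M"
    and ub: "AE u in M. (\<Sum>n. ennreal (1 / fact n) * ursell_integral n u) \<le> ennreal (exp (a u))"
    and fin: "(\<integral>\<^sup>+ u. ennreal (g u) * ennreal (exp (a u)) \<partial>M) < \<infinity>"
  obtains D where "summable D" "\<And>n. 0 \<le> D n" "\<And>n. ursell_bound g n = ennreal (D n)"
proof
  define D where "D n = enn2real (ursell_bound g n)" for n
  have lt: "(\<Sum>n. ursell_bound g n) < top"
    using le_less_trans[OF suminf_ursell_bound_le[OF g ub]] fin by simp
  have "ursell_bound g n \<le> (\<Sum>n. ursell_bound g n)" for n
    using sum_le_suminf[of "ursell_bound g" "{n}"] by simp
  then have "ursell_bound g n < top" for n using lt by (rule le_less_trans)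
  then show D: "ursell_bound g n = ennreal (D n)" for n by (simp add: D_def)
  show "summable D"
  proof (rule summable_suminf_not_top)
    show "(\<Sum>n. ennreal (D n)) \<noteq> top" using lt D by simp
  qed (simp add: D_def)
  show "0 \<le> D n" for n by (simp add: D_def)
qed

lemma ursell_coeff_zero: "ursell_coeff (\<lambda>_. 0) (Suc n) = 0"
  by (simp add: ursell_coeff_def weighted_integral_def)

text \<open>The case s = 0 gives absolute convergence of a single Ursell series when |t| exp(a) is
  integrable; truncated weights are treated this way.\<close>

lemma summable_norm_ursell_coeff_diff:
  assumes t: "integrable M t" "\<And>u. norm (t u) \<le> 1" and s: "integrable M s" "\<And>u. norm (s u) \<le> 1"
    and ub: "AE u in M. (\<Sum>n. ennreal (1 / fact n) * ursell_integral n u) \<le> ennreal (exp (a u))"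
    and fin: "(\<integral>\<^sup>+ u. ennreal (norm (t u - s u)) * ennreal (exp (a u)) \<partial>M) < \<infinity>"
  shows "summable (\<lambda>n. norm ((ursell_coeff t (Suc n) - ursell_coeff s (Suc n)) / fact (Suc n)))"
proof -
  have "(\<lambda>u. norm (t u - s u)) \<in> borel_measurable M" using t s by auto
  then obtain D where D: "summable D" "\<And>n. 0 \<le> D n" "\<And>n. ursell_bound (\<lambda>u. norm (t u - s u)) n = ennreal (D n)"
    using ursell_bound_summable[OF _ ub fin] by metis
  have "norm ((ursell_coeff t (Suc n) - ursell_coeff s (Suc n)) / fact (Suc n)) \<le> D n" for n
  proof -
    have "ennreal (norm ((ursell_coeff t (Suc n) - ursell_coeff s (Suc n)) / fact (Suc n))) \<le> ennreal (D n)"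
      unfolding D(3)[symmetric] by (rule norm_ursell_coeff_diff_le[OF t s]) (use t s in auto)
    then show ?thesis using D(2)[of n] by (simp del: fact_Suc)
  qed
  then show ?thesis
    by (intro summable_comparison_test'[OF D(1), of 0]) (simp del: fact_Suc)
qed

text \<open>The series of \<open>ursell_coeff t\<close> alone may diverge when \<open>exp a\<close> is not integrable. Truncating the
  weights to \<open>a \<le> m\<close> makes both series absolutely convergent; only their difference has a limit.\<close>
lemma partition_sum_ratio:
  fixes t s :: "'a \<Rightarrow> complex"
  assumes t: "integrable M t" "\<And>u. norm (t u) \<le> 1" and s: "integrable M s" "\<And>u. norm (s u) \<le> 1"
    and a: "a \<in> borel_measurable M"
    and ub: "AE u in M. (\<Sum>n. ennreal (1 / fact n) * ursell_integral n u) \<le> ennreal (exp (a u))"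
    and fin: "(\<integral>\<^sup>+ u. ennreal (norm (t u - s u)) * ennreal (exp (a u)) \<partial>M) < \<infinity>"
  shows "exp (\<Sum>n. (ursell_coeff t (Suc n) - ursell_coeff s (Suc n)) / fact (Suc n)) * partition_sum s =
    partition_sum t"
proof -
  define cut :: "nat \<Rightarrow> ('a \<Rightarrow> complex) \<Rightarrow> 'a \<Rightarrow> complex" where
    "cut m r u = (if a u \<le> real m then r u else 0)" for m r u
  have cut_meas: "cut m r \<in> borel_measurable M" if "integrable M r" for m r
  proof -
    have [measurable]: "r \<in> borel_measurable M" "a \<in> borel_measurable M" using that a by auto
    show ?thesis unfolding cut_def[abs_def] by measurable
  qed
  have cut_norm: "norm (cut m r u) \<le> norm (r u)" for m r u by (simp add: cut_def)
  have cut_int: "integrable M (cut m r)" if "integrable M r" for m r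
    by (rule Bochner_Integration.integrable_bound[OF that cut_meas[OF that]]) (simp add: cut_norm)
  have cut_lim: "(\<lambda>m. cut m r u) \<longlonglongrightarrow> r u" for r u
  proof (rule tendsto_eventually)
    obtain N where "a u \<le> real N" using real_arch_simple by blast
    then show "\<forall>\<^sub>F m in sequentially. cut m r u = r u"
      by (intro eventually_sequentiallyI[of N]) (auto simp: cut_def)
  qed
  \<comment> \<open>On the support of the truncated weight exp(a) is at most exp(m), so
    integrability of r is enough.\<close>
  have sum_cut: "summable (\<lambda>n. norm (ursell_coeff (cut m r) (Suc n) / fact (Suc n)))"
    if r: "integrable M r" "\<And>u. norm (r u) \<le> 1" for m r
  proof -
    have [measurable]: "r \<in> borel_measurable M" using r by auto
    have "(\<integral>\<^sup>+ u. ennreal (norm (cut m r u - 0)) * ennreal (exp (a u)) \<partial>M) \<le>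
        (\<integral>\<^sup>+ u. ennreal (exp (real m)) * ennreal (norm (r u)) \<partial>M)"
    proof (rule nn_integral_mono)
      fix u
      show "ennreal (norm (cut m r u - 0)) * ennreal (exp (a u)) \<le> ennreal (exp (real m)) * ennreal (norm (r u))"
      proof (cases "a u \<le> real m")
        case True
        then have "ennreal (exp (a u)) * ennreal (norm (r u)) \<le> ennreal (exp (real m)) * ennreal (norm (r u))"
          by (intro mult_right_mono ennreal_leI) auto
        then show ?thesis using True by (simp add: cut_def mult.commute)
      qed (simp add: cut_def)
    qed
    also have "\<dots> = ennreal (exp (real m)) * (\<integral>\<^sup>+ u. ennreal (norm (r u)) \<partial>M)"
      by (rule nn_integral_cmult) measurable
    also have "\<dots> < \<infinity>"
      using r(1) by (simp add: integrable_iff_bounded ennreal_mult_less_top)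
    finally have "(\<integral>\<^sup>+ u. ennreal (norm (cut m r u - 0)) * ennreal (exp (a u)) \<partial>M) < \<infinity>" .
    from summable_norm_ursell_coeff_diff[OF cut_int[OF r(1)] order_trans[OF cut_norm r(2)] _ _ ub this]
    show ?thesis by (simp add: ursell_coeff_zero)
  qed
  let ?d = "\<lambda>m n. (ursell_coeff (cut m t) (Suc n) - ursell_coeff (cut m s) (Suc n)) / fact (Suc n)"
  have ratio: "exp (\<Sum>n. ?d m n) * partition_sum (cut m s) = partition_sum (cut m t)" for m
  proof -
    have "(\<Sum>n. ?d m n) = (\<Sum>n. ursell_coeff (cut m t) (Suc n) / fact (Suc n)) - (\<Sum>n. ursell_coeff (cut m s) (Suc n) / fact (Suc n))"
      unfolding diff_divide_distrib
      by (rule suminf_diff[OF summable_norm_cancel[OF sum_cut[OF t]] summable_norm_cancel[OF sum_cut[OF s]], symmetric])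
    then show ?thesis
      using partition_sum_eq_exp[OF cut_int[OF t(1)] sum_cut[OF t]] partition_sum_eq_exp[OF cut_int[OF s(1)] sum_cut[OF s]]
      by (simp add: exp_diff)
  qed
  \<comment> \<open>The partition function converges for every integrable weight, with the
    exponential series of the norm of r dominating all truncations.\<close>
  have plim: "(\<lambda>m. partition_sum (cut m r)) \<longlonglongrightarrow> partition_sum r" if r: "integrable M r" for r
    unfolding partition_sum_def
  proof (rule tannerys_theorem[THEN conjunct2, THEN conjunct2])
    show "summable (\<lambda>n. inverse (fact n) * (\<integral>u. norm (r u) \<partial>M) ^ n)" by (rule summable_exp)
    have "(\<lambda>m. partition_coeff (cut m r) n) \<longlonglongrightarrow> partition_coeff r n" for n
      unfolding partition_coeff_def
      by (rule weighted_integral_tendsto[OF _ r measurable_pair_boltzmann abs_pair_boltzmann_le_1 cut_meas[OF r] cut_norm cut_lim]) auto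
    then show "(\<lambda>m. partition_coeff (cut m r) n / fact n) \<longlonglongrightarrow> partition_coeff r n / fact n" for n
      by (intro tendsto_divide tendsto_const) auto
    have "norm (partition_coeff (cut m r) n / fact n) \<le> inverse (fact n) * (\<integral>u. norm (r u) \<partial>M) ^ n" for m n
    proof -
      have "norm (partition_coeff (cut m r) n) \<le> (\<integral>u. norm (cut m r u) \<partial>M) ^ n"
        by (rule norm_partition_coeff_le[OF cut_int[OF r]])
      also have "\<dots> \<le> (\<integral>u. norm (r u) \<partial>M) ^ n"
        using cut_int[OF r] r cut_norm by (intro power_mono integral_mono integrable_norm) auto
      finally show ?thesis by (simp add: norm_divide field_simps)
    qed
    then show "\<forall>\<^sub>F (n, m) in sequentially \<times>\<^sub>F sequentially.
        norm (partition_coeff (cut m r) n / fact n) \<le> inverse (fact n) * (\<integral>u. norm (r u) \<partial>M) ^ n"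
      by (simp add: case_prod_unfold)
  qed simp
  have ulim: "(\<lambda>m. ursell_coeff (cut m r) (Suc n)) \<longlonglongrightarrow> ursell_coeff r (Suc n)" if r: "integrable M r" for r n
    unfolding ursell_coeff_def
    by (rule weighted_integral_tendsto[OF _ r measurable_ursell abs_ursell_le cut_meas[OF r] cut_norm cut_lim]) auto
  have "(\<lambda>u. norm (t u - s u)) \<in> borel_measurable M" using t s by auto
  then obtain D where D: "summable D" "\<And>n. 0 \<le> D n" "\<And>n. ursell_bound (\<lambda>u. norm (t u - s u)) n = ennreal (D n)"
    using ursell_bound_summable[OF _ ub fin] by metis
  \<comment> \<open>Truncating both weights at the same level never increases their distance, so D
    dominates the differences uniformly in m.\<close>
  have dD: "norm (?d m n) \<le> D n" for m n
  proof -
    have "ennreal (norm (?d m n)) \<le> ennreal (D n)"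
      unfolding D(3)[symmetric]
    proof (rule norm_ursell_coeff_diff_le[OF cut_int[OF t(1)] _ cut_int[OF s(1)]])
      show "norm (cut m t u) \<le> 1" "norm (cut m s u) \<le> 1" "norm (cut m t u - cut m s u) \<le> norm (t u - s u)" for u
        using t s by (auto simp: cut_def)
    qed (use t s in auto)
    then show ?thesis using D(2)[of n] by (simp del: fact_Suc)
  qed
  have "(\<lambda>m. \<Sum>n. ?d m n) \<longlonglongrightarrow> (\<Sum>n. (ursell_coeff t (Suc n) - ursell_coeff s (Suc n)) / fact (Suc n))"
    using dD by (intro tannerys_theorem[OF _ _ D(1), THEN conjunct2, THEN conjunct2]
        tendsto_divide tendsto_diff tendsto_const ulim t s) (auto simp: case_prod_unfold simp del: fact_Suc)
  then have "(\<lambda>m. exp (\<Sum>n. ?d m n) * partition_sum (cut m s)) \<longlonglongrightarrow>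
      exp (\<Sum>n. (ursell_coeff t (Suc n) - ursell_coeff s (Suc n)) / fact (Suc n)) * partition_sum s"
    by (intro tendsto_mult tendsto_exp plim s)
  then show ?thesis unfolding ratio using plim[OF t(1)] LIMSEQ_unique by blast
qed

end

subsection \<open>Finite-volume Gibbs measures\<close>

lemma measurable_emexp [measurable]: "emexp \<in> borel_measurable borel"
  unfolding emexp_def[abs_def] by measurable

lemma emexp_bounds: "0 \<le> emexp x" "emexp x \<le> 1"
  by (auto simp: emexp_def)

text \<open>Balls of integer radius about one point exhaust the space; \<open>undefined\<close> is
  just an arbitrary centre.\<close>

lemma borel_sigma_finite_if_locally_finite:
  fixes M :: "'a::metric_space measure"
  assumes "sets M = sets borel" "\<And>B. B \<in> sets borel \<Longrightarrow> bounded B \<Longrightarrow> emeasure M B < \<infinity>"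
  shows "full_sigma_finite_measure M"
proof
  let ?A = "range (\<lambda>n::nat. ball (undefined::'a) (real n))"
  have sp: "space M = UNIV" using sets_eq_imp_space_eq[OF assms(1)] by simp
  then show "space M = UNIV" .
  have "\<exists>n. x \<in> ball undefined (real n)" for x :: 'a
    using reals_Archimedean2[of "dist undefined x"] by auto
  then have "x \<in> \<Union>?A" for x by blast
  then have "\<Union>?A = space M" unfolding sp by (intro equalityI subsetI UNIV_I)
  moreover have "?A \<subseteq> sets M" unfolding assms(1) by (intro image_subsetI borel_open open_ball)
  moreover have "\<forall>B\<in>?A. emeasure M B \<noteq> \<infinity>"
  proof
    fix B assume "B \<in> ?A"
    then have "emeasure M B < \<infinity>" by (intro assms(2)) auto
    then show "emeasure M B \<noteq> \<infinity>" by simp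
  qed
  ultimately show "\<exists>A. countable A \<and> A \<subseteq> sets M \<and> \<Union>A = space M \<and> (\<forall>a\<in>A. emeasure M a \<noteq> \<infinity>)"
    by (intro exI[of _ ?A]) auto
qed

text \<open>Both measures agree on rectangles, where the integral factors. This translates the
  hypothesis, with z in the integrand, into integrals over the weighted measure.\<close>

lemma PiM_density:
  fixes z :: "'a \<Rightarrow> ennreal" and I :: "'i set"
  assumes "sigma_finite_measure M" "sigma_finite_measure (density M z)" "finite I"
    and [measurable]: "z \<in> borel_measurable M"
  shows "PiM I (\<lambda>_. density M z) = density (PiM I (\<lambda>_. M)) (\<lambda>y. \<Prod>i\<in>I. z (y i))"
proof -
  interpret M: product_sigma_finite "\<lambda>_::'i. M" using assms by (simp add: product_sigma_finite_def)
  interpret D: product_sigma_finite "\<lambda>_::'i. density M z" using assms by (simp add: product_sigma_finite_def)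
  show ?thesis
  proof (rule D.PiM_eqI[OF assms(3), symmetric])
    show "sets (density (PiM I (\<lambda>_. M)) (\<lambda>y. \<Prod>i\<in>I. z (y i))) = sets (PiM I (\<lambda>_. density M z))"
      by (simp cong: sets_PiM_cong)
    fix A :: "'i \<Rightarrow> 'a set" assume "\<And>i. i \<in> I \<Longrightarrow> A i \<in> sets (density M z)"
    then have A: "\<And>i. i \<in> I \<Longrightarrow> A i \<in> sets M" by simp
    then have PiE: "PiE I A \<in> sets (PiM I (\<lambda>_. M))" using assms(3) by (intro sets_PiM_I_finite)
    have "emeasure (density (PiM I (\<lambda>_. M)) (\<lambda>y. \<Prod>i\<in>I. z (y i))) (PiE I A) =
        (\<integral>\<^sup>+ y. (\<Prod>i\<in>I. z (y i)) * indicator (PiE I A) y \<partial>PiM I (\<lambda>_. M))"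
      by (rule emeasure_density[OF _ PiE]) measurable
    also have "\<dots> = (\<integral>\<^sup>+ y. (\<Prod>i\<in>I. z (y i) * indicator (A i) (y i)) \<partial>PiM I (\<lambda>_. M))"
    proof (rule nn_integral_cong)
      fix y assume y: "y \<in> space (PiM I (\<lambda>_. M))"
      have "indicator (PiE I A) y = (\<Prod>i\<in>I. indicator (A i) (y i) :: ennreal)"
      proof (cases "y \<in> PiE I A")
        case True then show ?thesis by (auto simp: PiE_iff intro!: prod.neutral[symmetric])
      next
        case False
        then have "\<exists>i\<in>I. y i \<notin> A i" using y by (auto simp: space_PiM PiE_iff)
        then show ?thesis using False assms(3) by (auto simp: prod_zero_iff indicator_def)
      qed
      then show "(\<Prod>i\<in>I. z (y i)) * indicator (PiE I A) y = (\<Prod>i\<in>I. z (y i) * indicator (A i) (y i))"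
        by (simp add: prod.distrib)
    qed
    also have "\<dots> = (\<Prod>i\<in>I. \<integral>\<^sup>+ u. z u * indicator (A i) u \<partial>M)"
    proof (rule M.product_nn_integral_prod[OF assms(3)])
      fix i assume "i \<in> I"
      then have [measurable]: "A i \<in> sets M" by (rule A)
      show "(\<lambda>u. z u * indicator (A i) u) \<in> borel_measurable M" by measurable
    qed
    also have "\<dots> = (\<Prod>i\<in>I. emeasure (density M z) (A i))"
      using A by (intro prod.cong) (auto simp: emeasure_density)
    finally show "emeasure (density (PiM I (\<lambda>_. M)) (\<lambda>y. \<Prod>i\<in>I. z (y i))) (PiE I A) =
      (\<Prod>i\<in>I. emeasure (density M z) (A i))" .
  qed
qed

section \<open>Restriction to a volume\<close>

context full_sigma_finite_measure begin

text \<open>The indicator of a box factors over the coordinates, so the restriction to a volume can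
  be absorbed into the one-point weight.\<close>

lemma restricted_prod:
  fixes t :: "'a \<Rightarrow> complex" and S :: "nat set"
  assumes "y \<in> space (PiM S (\<lambda>_. M))" "finite S"
  shows "indicat_real (PiE S (\<lambda>_. L)) y *\<^sub>R ((\<Prod>j\<in>S. t (y j)) * c) =
    (\<Prod>j\<in>S. if y j \<in> L then t (y j) else 0) * c"
proof (cases "y \<in> PiE S (\<lambda>_. L)")
  case True
  then have "(\<Prod>j\<in>S. if y j \<in> L then t (y j) else 0) = (\<Prod>j\<in>S. t (y j))"
    by (intro prod.cong) (auto simp: PiE_iff)
  with True show ?thesis by simp
next
  case False
  then obtain i where i: "i \<in> S" "y i \<notin> L" using assms(1) by (auto simp: space_PiM PiE_iff)
  then have "(\<Prod>j\<in>S. if y j \<in> L then t (y j) else 0) = 0"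
    using assms(2) by (intro prod_zero) auto
  then show ?thesis using False by simp
qed

lemma set_integral_PiE_eq_weighted_integral:
  fixes t :: "'a \<Rightarrow> complex" and S :: "nat set"
  assumes "finite S"
  shows "(LINT y : PiE S (\<lambda>_. L) | PiM S (\<lambda>_. M). (\<Prod>j\<in>S. t (y j)) * complex_of_real (k y)) =
    weighted_integral k (\<lambda>u. if u \<in> L then t u else 0) S"
  unfolding weighted_integral_def set_lebesgue_integral_def
  using restricted_prod[OF _ assms] by (rule Bochner_Integration.integral_cong[OF refl])

end

lemma boltzmann_eq_pair_boltzmann:
  assumes "\<And>x y. v x y = v y x" shows "boltzmann v n x = pair_boltzmann (mayer v) {..<n} x"
  using pair_boltzmann_lessThan[where f = "mayer v" and n = n and x = x] assms by (simp add: boltzmann_def mayer_def)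

context mayer_space begin

lemma partition_sum_eq_one_plus:
  assumes t: "integrable M t"
  shows "summable (\<lambda>n. partition_coeff t (Suc n) / fact (Suc n))"
    "partition_sum t = 1 + (\<Sum>n. partition_coeff t (Suc n) / fact (Suc n))"
proof -
  have s: "summable (\<lambda>n. partition_coeff t n / fact n)"
    using norm_partition_coeff_le[OF t]
    by (intro summable_comparison_test'[OF summable_exp, where N = 0]) (simp add: norm_divide field_simps)
  then show "summable (\<lambda>n. partition_coeff t (Suc n) / fact (Suc n))"
    using summable_Suc_iff[of "\<lambda>n. partition_coeff t n / fact n"] by blast
  show "partition_sum t = 1 + (\<Sum>n. partition_coeff t (Suc n) / fact (Suc n))"
    using suminf_split_head[OF s] by (simp add: partition_sum_def)
qed

end

section \<open>The Laplace functional as a quotient of partition functions\<close>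

locale mayer_gas =
  fixes lam :: "'a measure" and z :: "'a \<Rightarrow> real" and v :: "'a \<Rightarrow> 'a \<Rightarrow> ennreal"
  assumes mayer_space: "mayer_space (weighted lam z) (mayer v)" and v_sym: "v x y = v y x"

sublocale mayer_gas \<subseteq> mayer_space "weighted lam z" "mayer v" by (rule mayer_space)

context mayer_gas begin

abbreviation restricted :: "'a set \<Rightarrow> ('a \<Rightarrow> complex) \<Rightarrow> 'a \<Rightarrow> complex" where
  "restricted L t \<equiv> \<lambda>u. if u \<in> L then t u else 0"

lemma set_integral_boltzmann:
  "(LINT x : (PiE {..<n} (\<lambda>_. L)) | PiM {..<n} (\<lambda>_. weighted lam z).
      boltzmann v n x *\<^sub>R (\<Prod>j<n. t (x j))) = partition_coeff (restricted L t) n"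
  unfolding partition_coeff_def set_integral_PiE_eq_weighted_integral[OF finite_lessThan, symmetric]
  by (simp add: boltzmann_eq_pair_boltzmann[OF v_sym] scaleR_conv_of_real mult.commute)

text \<open>This links the real definition to the complex series. The Boltzmann factors are
  non-negative, so the partition function is at least 1 and may be divided by.\<close>

lemma of_real_partition_fn:
  assumes "integrable (weighted lam z) (restricted L (\<lambda>_. 1))"
  shows "complex_of_real (partition_fn lam z v L) = partition_sum (restricted L (\<lambda>_. 1))"
    and "partition_fn lam z v L \<noteq> 0"
proof -
  let ?r = "\<lambda>n. 1 / fact (Suc n) * (LINT x : (PiE {..<Suc n} (\<lambda>_. L)) | PiM {..<Suc n} (\<lambda>_. weighted lam z).
          boltzmann v (Suc n) x)"
  have r: "complex_of_real (?r n) = partition_coeff (restricted L (\<lambda>_. 1)) (Suc n) / fact (Suc n)" for n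
    unfolding set_integral_boltzmann[symmetric]
    by (simp add: scaleR_conv_of_real set_integral_complex_of_real del: fact_Suc)
  have sc: "summable (\<lambda>n. complex_of_real (?r n))"
    unfolding r by (rule partition_sum_eq_one_plus(1)[OF assms])
  then have s: "summable ?r" by (simp only: summable_complex_of_real)
  have "complex_of_real (\<Sum>n. ?r n) = (\<Sum>n. complex_of_real (?r n))"
    by (rule bounded_linear.suminf[OF bounded_linear_of_real s])
  then show "complex_of_real (partition_fn lam z v L) = partition_sum (restricted L (\<lambda>_. 1))"
    unfolding partition_fn_def r partition_sum_eq_one_plus(2)[OF assms] by (simp only: of_real_add of_real_1)
  have "0 \<le> (LINT x : (PiE {..<Suc n} (\<lambda>_. L)) | PiM {..<Suc n} (\<lambda>_. weighted lam z). boltzmann v (Suc n) x)" for n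
    unfolding set_lebesgue_integral_def
    by (intro Bochner_Integration.integral_nonneg) (simp add: boltzmann_eq_pair_boltzmann[OF v_sym] pair_boltzmann_nonneg)
  then have "0 \<le> (\<Sum>n. ?r n)" by (intro suminf_nonneg[OF s] mult_nonneg_nonneg) auto
  then show "partition_fn lam z v L \<noteq> 0" unfolding partition_fn_def by linarith
qed

text \<open>A product functional only changes the activity from z to z t, so its expectation
  compares two partition functions.\<close>

lemma gibbs_expect_eq_ratio:
  assumes "integrable (weighted lam z) (restricted L (\<lambda>_. 1))" "integrable (weighted lam z) (restricted L t)"
  shows "gibbs_expect lam z v L (\<lambda>n x. \<Prod>j<n. t (x j)) =
    partition_sum (restricted L t) / partition_sum (restricted L (\<lambda>_. 1))"
  unfolding gibbs_expect_def set_integral_boltzmann partition_sum_eq_one_plus(2)[OF assms(2)]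
  by (simp add: scaleR_conv_of_real of_real_partition_fn[OF assms(1)] divide_inverse mult.commute del: fact_Suc)

text \<open>This reduces real weights, in particular those from a potential h with values in
  [0, infinity], to the complex case.\<close>

lemma of_real_gibbs_expect:
  fixes t :: "'a \<Rightarrow> real"
  assumes "integrable (weighted lam z) (restricted L (\<lambda>u. complex_of_real (t u)))"
  shows "complex_of_real (gibbs_expect lam z v L (\<lambda>n x. \<Prod>j<n. t (x j))) =
    gibbs_expect lam z v L (\<lambda>n x. \<Prod>j<n. complex_of_real (t (x j)))"
proof -
  let ?r = "\<lambda>n. (1 / fact (Suc n)) *\<^sub>R (LINT x : (PiE {..<Suc n} (\<lambda>_. L)) | PiM {..<Suc n} (\<lambda>_. weighted lam z).
          boltzmann v (Suc n) x *\<^sub>R (\<Prod>j<Suc n. t (x j)))"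
  let ?c = "\<lambda>n. (1 / fact (Suc n)) *\<^sub>R (LINT x : (PiE {..<Suc n} (\<lambda>_. L)) | PiM {..<Suc n} (\<lambda>_. weighted lam z).
          boltzmann v (Suc n) x *\<^sub>R (\<Prod>j<Suc n. complex_of_real (t (x j))))"
  have r: "complex_of_real (?r n) = ?c n" for n
  proof -
    have "(LINT x : (PiE {..<Suc n} (\<lambda>_. L)) | PiM {..<Suc n} (\<lambda>_. weighted lam z).
          boltzmann v (Suc n) x *\<^sub>R (\<Prod>j<Suc n. complex_of_real (t (x j)))) =
        (LINT x : (PiE {..<Suc n} (\<lambda>_. L)) | PiM {..<Suc n} (\<lambda>_. weighted lam z).
          complex_of_real (boltzmann v (Suc n) x *\<^sub>R (\<Prod>j<Suc n. t (x j))))"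
      by (simp add: scaleR_conv_of_real del: prod.lessThan_Suc)
    also have "\<dots> = complex_of_real (LINT x : (PiE {..<Suc n} (\<lambda>_. L)) | PiM {..<Suc n} (\<lambda>_. weighted lam z).
          boltzmann v (Suc n) x *\<^sub>R (\<Prod>j<Suc n. t (x j)))"
      by (rule set_integral_complex_of_real)
    finally show ?thesis by (simp add: scaleR_conv_of_real del: fact_Suc)
  qed
  have "summable ?c"
    unfolding set_integral_boltzmann[where t = "\<lambda>u. complex_of_real (t u)"]
    using partition_sum_eq_one_plus(1)[OF assms]
    by (simp add: scaleR_conv_of_real del: fact_Suc)
  then have s: "summable ?r" unfolding r[symmetric] by (simp only: summable_complex_of_real)
  have "complex_of_real (\<Sum>n. ?r n) = (\<Sum>n. ?c n)"
    unfolding r[symmetric] by (rule bounded_linear.suminf[OF bounded_linear_of_real s])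
  then show ?thesis
    unfolding gibbs_expect_def by (simp add: scaleR_conv_of_real del: fact_Suc)
qed

text \<open>Stating the expansion for t = exp(-h) covers both versions of h: complex values with
  non-negative real part, and the value infinity, which is simply t = 0.\<close>

lemma cluster_expansion:
  fixes t :: "'a \<Rightarrow> complex"
  assumes L: "L \<in> sets (weighted lam z)" "emeasure (weighted lam z) L < \<infinity>"
    and a: "a \<in> borel_measurable (weighted lam z)"
    and ub: "AE u in weighted lam z. (\<Sum>n. ennreal (1 / fact n) * ursell_integral n u) \<le> ennreal (exp (a u))"
    and t: "t \<in> borel_measurable (weighted lam z)" "\<And>u. u \<in> L \<Longrightarrow> norm (t u) \<le> 1"
    and fin: "(\<integral>\<^sup>+ u \<in> L. ennreal (norm (t u - 1) * exp (a u)) \<partial>weighted lam z) < \<infinity>"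
  defines "s \<equiv> \<lambda>n. complex_of_real (1 / fact (Suc n)) *
      (LINT x : (PiE {..<Suc n} (\<lambda>_. L)) | PiM {..<Suc n} (\<lambda>_. weighted lam z).
         ((\<Prod>j<Suc n. t (x j)) - 1) * complex_of_real (ursell (mayer v) (Suc n) x))"
  shows "summable s" "exp (suminf s) = gibbs_expect lam z v L (\<lambda>n x. \<Prod>j<n. t (x j))"
    "integrable (weighted lam z) (restricted L t)"
proof -
  let ?t = "restricted L t" and ?c = "restricted L (\<lambda>_. 1)"
  have [measurable]: "L \<in> sets (weighted lam z)" "t \<in> borel_measurable (weighted lam z)" using L t by auto
  have ic: "integrable (weighted lam z) (\<lambda>u. indicat_real L u)"
    using L by (intro integrable_real_indicator) auto
  have it: "integrable (weighted lam z) ?t"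
    by (rule Bochner_Integration.integrable_bound[OF ic]) (use t in auto)
  have i1: "integrable (weighted lam z) ?c"
    by (rule Bochner_Integration.integrable_bound[OF ic]) auto
  have t1: "norm (?t u) \<le> 1" "norm (?c u) \<le> 1" for u using t by auto
  have fin': "(\<integral>\<^sup>+ u. ennreal (norm (?t u - ?c u)) * ennreal (exp (a u)) \<partial>weighted lam z) < \<infinity>"
  proof -
    have "(\<integral>\<^sup>+ u. ennreal (norm (?t u - ?c u)) * ennreal (exp (a u)) \<partial>weighted lam z) =
      (\<integral>\<^sup>+ u \<in> L. ennreal (norm (t u - 1) * exp (a u)) \<partial>weighted lam z)"
      by (intro nn_integral_cong) (auto simp: ennreal_mult indicator_def)
    with fin show ?thesis by simp
  qed
  \<comment> \<open>The subtracted 1 in the integrand is the product of the constant weights 1, so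
    the series is the difference of the Ursell series for exp(-h) and for 1.\<close>
  have s: "s n = (ursell_coeff ?t (Suc n) - ursell_coeff ?c (Suc n)) / fact (Suc n)" for n
  proof -
    let ?P = "PiM {..<Suc n} (\<lambda>_. weighted lam z)" and ?U = "\<lambda>x. complex_of_real (ursell (mayer v) (Suc n) x)"
    let ?E = "PiE {..<Suc n} (\<lambda>_. L)"
    have set_int: "set_integrable ?P ?E (\<lambda>x. (\<Prod>j<Suc n. t (x j)) * ?U x)"
      if "integrable (weighted lam z) (restricted L t)" for t :: "'a \<Rightarrow> complex"
      unfolding set_integrable_def
    proof (rule Bochner_Integration.integrable_cong[THEN iffD1, OF refl])
      show "integrable ?P (\<lambda>x. (\<Prod>j<Suc n. restricted L t (x j)) * ?U x)"
        by (rule integrable_prod_weight[OF _ that measurable_ursell abs_ursell_le]) auto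
      fix x assume x: "x \<in> space ?P"
      show "(\<Prod>j<Suc n. restricted L t (x j)) * ?U x = indicat_real ?E x *\<^sub>R ((\<Prod>j<Suc n. t (x j)) * ?U x)"
        using restricted_prod[OF x finite_lessThan] by (rule sym)
    qed
    have "(LINT x : ?E | ?P. ((\<Prod>j<Suc n. t (x j)) - 1) * ?U x) =
       (LINT x : ?E | ?P. (\<Prod>j<Suc n. t (x j)) * ?U x - (\<Prod>j<Suc n. 1) * ?U x)"
      by (simp add: left_diff_distrib)
    also have "\<dots> = (LINT x : ?E | ?P. (\<Prod>j<Suc n. t (x j)) * ?U x) - (LINT x : ?E | ?P. (\<Prod>j<Suc n. 1) * ?U x)"
      using set_int[OF it] set_int[OF i1] by (rule set_integral_diff)
    also have "\<dots> = ursell_coeff ?t (Suc n) - ursell_coeff ?c (Suc n)"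
      unfolding ursell_coeff_def set_integral_PiE_eq_weighted_integral[OF finite_lessThan, symmetric] ..
    finally show ?thesis unfolding s_def by (simp add: divide_inverse mult.commute del: fact_Suc)
  qed
  show "summable s"
    unfolding s[abs_def] using summable_norm_ursell_coeff_diff[OF it t1(1) i1 t1(2) ub fin']
    by (rule summable_norm_cancel)
  have "exp (suminf s) * partition_sum ?c = partition_sum ?t"
    unfolding s[abs_def] by (rule partition_sum_ratio[OF it t1(1) i1 t1(2) a ub fin'])
  moreover have "partition_sum ?c \<noteq> 0" using of_real_partition_fn[OF i1] by (metis of_real_eq_0_iff)
  ultimately show "exp (suminf s) = gibbs_expect lam z v L (\<lambda>n x. \<Prod>j<n. t (x j))"
    unfolding gibbs_expect_eq_ratio[OF i1 it] by (simp add: field_simps)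
  show "integrable (weighted lam z) ?t" by (rule it)
qed

end

text \<open>For h in [0, infinity] the expectation is asserted to be positive, which gives
  \<open>ln\<close> its meaning. For complex h the convergent sum is asserted to be a logarithm of
  the expectation, through its exponential: the sum itself need not lie in the principal
  branch.\<close>

theorem mainTheorem5:
  fixes lam :: "'a::polish_space measure"
    and v :: "'a \<Rightarrow> 'a \<Rightarrow> ennreal"
    and z :: "'a \<Rightarrow> real"
    and a :: "'a \<Rightarrow> real"
  assumes lam_sets: "sets lam = sets borel"
    and lam_loc_fin: "\<And>B. B \<in> sets borel \<Longrightarrow> bounded B \<Longrightarrow> emeasure lam B < \<infinity>"
    and v_meas: "(\<lambda>(x, y). v x y) \<in> borel_measurable (borel \<Otimes>\<^sub>M borel)"
    and v_sym: "\<And>x y. v x y = v y x"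
    and z_meas: "z \<in> borel_measurable borel"
    and z_nonneg: "\<And>x. 0 \<le> z x"
    and z_loc_int: "\<And>B. B \<in> sets borel \<Longrightarrow> bounded B \<Longrightarrow>
                        (\<integral>\<^sup>+ x \<in> B. ennreal (z x) \<partial>lam) < \<infinity>"
    and a_meas: "a \<in> borel_measurable borel"
    and a_nonneg: "\<And>x. 0 \<le> a x"
    and KP: "AE x0 in lam.
      (\<Sum>k. ennreal (1 / fact (Suc k)) *
         (\<integral>\<^sup>+ y. ennreal ((\<Prod>j<Suc k. \<bar>mayer v x0 (y j)\<bar>)
                        * (\<Prod>j<Suc k. \<Prod>i<j. 1 + mayer v (y i) (y j))
                        * (\<Prod>j<Suc k. z (y j) * exp (a (y j))))
           \<partial>(PiM {..<Suc k} (\<lambda>_. lam))))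
      \<le> ennreal (exp (a x0) - 1)"
  shows "(AE x0 in lam.
           (\<Sum>n. ennreal (1 / fact (Suc n)) *
              (\<integral>\<^sup>+ x. ennreal \<bar>ursell (mayer v) (Suc (Suc n))
                                     (\<lambda>i. if i = 0 then x0 else x (i - 1))\<bar>
                 \<partial>(PiM {..<Suc n} (\<lambda>_. weighted lam z))))
           \<le> ennreal (exp (a x0) - 1))
       \<and> (\<forall>\<Lambda>. \<Lambda> \<in> sets borel \<longrightarrow> bounded \<Lambda> \<longrightarrow> 0 < emeasure (weighted lam z) \<Lambda> \<longrightarrow>
            (\<forall>h :: 'a \<Rightarrow> ennreal. h \<in> borel_measurable borel \<longrightarrow>
               (\<integral>\<^sup>+ x \<in> \<Lambda>. ennreal (\<bar>emexp (h x) - 1\<bar> * exp (a x)) \<partial>(weighted lam z)) < \<infinity> \<longrightarrow>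
               0 < gibbs_expect lam z v \<Lambda> (\<lambda>n x. \<Prod>j<n. emexp (h (x j))) \<and>
               (\<lambda>n. (1 / fact (Suc n)) *
                  (LINT x : (PiE {..<Suc n} (\<lambda>_. \<Lambda>)) | PiM {..<Suc n} (\<lambda>_. weighted lam z).
                     ((\<Prod>j<Suc n. emexp (h (x j))) - 1) * ursell (mayer v) (Suc n) x))
                 sums ln (gibbs_expect lam z v \<Lambda> (\<lambda>n x. \<Prod>j<n. emexp (h (x j)))))
          \<and> (\<forall>h :: 'a \<Rightarrow> complex. h \<in> borel_measurable borel \<longrightarrow> (\<forall>x\<in>\<Lambda>. 0 \<le> Re (h x)) \<longrightarrow>
               (\<integral>\<^sup>+ x \<in> \<Lambda>. ennreal (cmod (exp (- h x) - 1) * exp (a x)) \<partial>(weighted lam z)) < \<infinity> \<longrightarrow>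
               (let s = (\<lambda>n. complex_of_real (1 / fact (Suc n)) *
                  (LINT x : (PiE {..<Suc n} (\<lambda>_. \<Lambda>)) | PiM {..<Suc n} (\<lambda>_. weighted lam z).
                     (exp (- (\<Sum>j<Suc n. h (x j))) - 1) * complex_of_real (ursell (mayer v) (Suc n) x)))
                in summable s \<and>
                   exp (suminf s) = gibbs_expect lam z v \<Lambda> (\<lambda>n x. exp (- (\<Sum>j<n. h (x j)))))))"
proof -
  let ?M = "weighted lam z"
  have sets_M: "sets ?M = sets borel" by (simp add: weighted_def lam_sets)
  have [measurable]: "z \<in> borel_measurable lam" "a \<in> borel_measurable lam"
    using z_meas a_meas by (simp_all cong: measurable_cong_sets add: lam_sets)
  have a_M: "a \<in> borel_measurable ?M" using a_meas by (simp cong: measurable_cong_sets add: sets_M)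
  have M_fin: "emeasure ?M B < \<infinity>" if "B \<in> sets borel" "bounded B" for B
    unfolding weighted_def using that z_loc_int[OF that] lam_sets by (subst emeasure_density) auto
  interpret lam: full_sigma_finite_measure lam
    by (rule borel_sigma_finite_if_locally_finite[OF lam_sets lam_loc_fin])
  interpret M: full_sigma_finite_measure ?M
    by (rule borel_sigma_finite_if_locally_finite[OF sets_M M_fin])
  interpret mayer_gas lam z v
  proof (unfold_locales)
    have "(\<lambda>p. emexp (case p of (x, y) \<Rightarrow> v x y) - 1) \<in> borel_measurable (borel \<Otimes>\<^sub>M borel)"
      using v_meas by measurable
    then have "(\<lambda>(x, y). mayer v x y) \<in> borel_measurable (borel \<Otimes>\<^sub>M borel)"
      by (simp add: mayer_def case_prod_unfold)
    then show "(\<lambda>(x, y). mayer v x y) \<in> borel_measurable (?M \<Otimes>\<^sub>M ?M)"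
      by (simp cong: measurable_cong_sets add: sets_pair_measure_cong[OF sets_M sets_M])
    show "mayer v x y = mayer v y x" "mayer v x y \<le> 0" "- 1 \<le> mayer v x y" "v x y = v y x" for x y
      using emexp_bounds[of "v x y"] v_sym[of x y] by (auto simp: mayer_def)
  qed
  \<comment> \<open>The factors z of the hypothesis become the density of the weighted product
    measure.\<close>
  have kernel: "kernel a k u = (\<integral>\<^sup>+ y. ennreal ((\<Prod>j<k. \<bar>mayer v u (y j)\<bar>)
      * (\<Prod>j<k. \<Prod>i<j. 1 + mayer v (y i) (y j)) * (\<Prod>j<k. z (y j) * exp (a (y j)))) \<partial>(PiM {..<k} (\<lambda>_. lam)))"
    for k u
  proof -
    let ?F = "\<lambda>y. (\<Prod>j<k. \<bar>mayer v u (y j)\<bar>) * (\<Prod>j<k. \<Prod>i<j. 1 + mayer v (y i) (y j)) * (\<Prod>j<k. exp (a (y j)))"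
    have "?F \<in> borel_measurable (PiM {..<k} (\<lambda>_. ?M))"
      using a_M by (auto intro!: borel_measurable_times borel_measurable_prod
        borel_measurable_abs measurable_f_comp borel_measurable_add measurable_component_singleton
        measurable_compose[OF measurable_component_singleton] simp: M.space_M)
    then have F [measurable]: "?F \<in> borel_measurable (PiM {..<k} (\<lambda>_. lam))"
      by (simp cong: measurable_cong_sets sets_PiM_cong add: sets_M lam_sets)
    have F0: "0 \<le> ?F y" for y
      using one_plus_f by (intro mult_nonneg_nonneg prod_nonneg) auto
    have "kernel a k u = (\<integral>\<^sup>+ y. ennreal (?F y) \<partial>density (PiM {..<k} (\<lambda>_. lam)) (\<lambda>y. \<Prod>j<k. ennreal (z (y j))))"
      unfolding kernel_def using M.sigma_finite_measure_axioms lam.sigma_finite_measure_axioms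
      unfolding weighted_def by (subst PiM_density) auto
    also have "\<dots> = (\<integral>\<^sup>+ y. (\<Prod>j<k. ennreal (z (y j))) * ennreal (?F y) \<partial>PiM {..<k} (\<lambda>_. lam))"
      by (rule nn_integral_density) measurable
    also have "\<dots> = (\<integral>\<^sup>+ y. ennreal ((\<Prod>j<k. \<bar>mayer v u (y j)\<bar>)
      * (\<Prod>j<k. \<Prod>i<j. 1 + mayer v (y i) (y j)) * (\<Prod>j<k. z (y j) * exp (a (y j)))) \<partial>(PiM {..<k} (\<lambda>_. lam)))"
    proof (rule nn_integral_cong)
      fix y
      have "(\<Prod>j<k. ennreal (z (y j))) * ennreal (?F y) = ennreal ((\<Prod>j<k. z (y j)) * ?F y)"
        using F0 z_nonneg by (simp add: prod_ennreal ennreal_mult prod_nonneg)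
      also have "(\<Prod>j<k. z (y j)) * ?F y = (\<Prod>j<k. \<bar>mayer v u (y j)\<bar>)
        * (\<Prod>j<k. \<Prod>i<j. 1 + mayer v (y i) (y j)) * (\<Prod>j<k. z (y j) * exp (a (y j)))"
        by (simp add: prod.distrib)
      finally show "(\<Prod>j<k. ennreal (z (y j))) * ennreal (?F y) = ennreal ((\<Prod>j<k. \<bar>mayer v u (y j)\<bar>)
        * (\<Prod>j<k. \<Prod>i<j. 1 + mayer v (y i) (y j)) * (\<Prod>j<k. z (y j) * exp (a (y j))))" .
    qed
    finally show ?thesis .
  qed
  \<comment> \<open>One set of good points serves both measures: its complement is null for
    \<open>lam\<close>, as the first claim requires, and hence for the weighted measure, as the
    induction requires.\<close>
  define G where "G = {u. (\<Sum>k. ennreal (1 / fact (Suc k)) * kernel a (Suc k) u) \<le> ennreal (exp (a u) - 1)}"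
  have G_lam: "AE u in lam. u \<in> G" using KP unfolding G_def kernel by simp
  then have G: "AE u in ?M. u \<in> G" unfolding weighted_def by (subst AE_density) auto
  have bound: "(\<Sum>n. ennreal (1 / fact (Suc n)) * ursell_integral (Suc n) u) \<le> ennreal (exp (a u) - 1)"
    if "u \<in> G" for u
    using suminf_ursell_integral_le[OF a_M a_nonneg G _ that] unfolding G_def by blast
  \<comment> \<open>Including the term n = 0, equal to 1, gives the bound exp(a). The difference of
    two expansions uses this form: one marked vertex and n others, with n = 0 allowed.\<close>
  have ub: "AE u in ?M. (\<Sum>n. ennreal (1 / fact n) * ursell_integral n u) \<le> ennreal (exp (a u))"
    using G
  proof (rule eventually_mono)
    fix u assume u: "u \<in> G"
    show "(\<Sum>n. ennreal (1 / fact n) * ursell_integral n u) \<le> ennreal (exp (a u))"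
    proof (rule suminf_le_const)
      fix n
      have "(\<Sum>k<n. ennreal (1 / fact k) * ursell_integral k u) \<le> (\<Sum>k<Suc n. ennreal (1 / fact k) * ursell_integral k u)"
        by (intro sum_mono2) auto
      also have "\<dots> = 1 + (\<Sum>k<n. ennreal (1 / fact (Suc k)) * ursell_integral (Suc k) u)"
        by (subst sum.lessThan_Suc_shift) simp
      also have "\<dots> \<le> 1 + (\<Sum>k. ennreal (1 / fact (Suc k)) * ursell_integral (Suc k) u)"
        by (intro add_left_mono sum_le_suminf) auto
      also have "\<dots> \<le> 1 + ennreal (exp (a u) - 1)" using bound[OF u] by (rule add_left_mono)
      also have "\<dots> = ennreal (exp (a u))" using a_nonneg[of u] by (simp flip: ennreal_1 ennreal_plus)
      finally show "(\<Sum>k<n. ennreal (1 / fact k) * ursell_integral k u) \<le> ennreal (exp (a u))" .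
    qed simp
  qed
  show ?thesis
  proof (intro conjI allI impI)
    show "AE x0 in lam.
           (\<Sum>n. ennreal (1 / fact (Suc n)) *
              (\<integral>\<^sup>+ x. ennreal \<bar>ursell (mayer v) (Suc (Suc n))
                                     (\<lambda>i. if i = 0 then x0 else x (i - 1))\<bar>
                 \<partial>(PiM {..<Suc n} (\<lambda>_. weighted lam z))))
           \<le> ennreal (exp (a x0) - 1)"
      using G_lam bound unfolding ursell_integral_def by (auto elim: eventually_mono)
  next
    fix L :: "'a set" and h :: "'a \<Rightarrow> ennreal"
    assume L: "L \<in> sets borel" "bounded L" and h: "h \<in> borel_measurable borel"
      and fin: "(\<integral>\<^sup>+ x \<in> L. ennreal (\<bar>emexp (h x) - 1\<bar> * exp (a x)) \<partial>?M) < \<infinity>"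
    let ?t = "\<lambda>x. complex_of_real (emexp (h x))"
    let ?s = "\<lambda>n. (1 / fact (Suc n)) *
                  (LINT x : (PiE {..<Suc n} (\<lambda>_. L)) | PiM {..<Suc n} (\<lambda>_. ?M).
                     ((\<Prod>j<Suc n. emexp (h (x j))) - 1) * ursell (mayer v) (Suc n) x)"
    let ?E = "gibbs_expect lam z v L (\<lambda>n x. \<Prod>j<n. emexp (h (x j)))"
    have t: "?t \<in> borel_measurable ?M"
      using h by (simp cong: measurable_cong_sets add: sets_M)
    have t1: "norm (?t u) \<le> 1" for u using emexp_bounds[of "h u"] by simp
    have "norm (?t u - 1) = \<bar>emexp (h u) - 1\<bar>" for u
      by (metis norm_of_real of_real_1 of_real_diff)
    then have fin': "(\<integral>\<^sup>+ u \<in> L. ennreal (norm (?t u - 1) * exp (a u)) \<partial>?M) < \<infinity>" using fin by simp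
    have L': "L \<in> sets ?M" "emeasure ?M L < \<infinity>" using L M_fin sets_M by auto
    note ce = cluster_expansion[OF L' a_M ub t t1 fin']
    have s: "complex_of_real (?s n) = complex_of_real (1 / fact (Suc n)) *
        (LINT x : (PiE {..<Suc n} (\<lambda>_. L)) | PiM {..<Suc n} (\<lambda>_. ?M).
           ((\<Prod>j<Suc n. ?t (x j)) - 1) * complex_of_real (ursell (mayer v) (Suc n) x))" for n
      unfolding of_real_mult set_integral_complex_of_real[symmetric]
      by (simp only: of_real_mult of_real_diff of_real_prod of_real_1)
    have sum: "summable ?s"
      using ce(1) unfolding s[symmetric] by (simp only: summable_complex_of_real)
    have "complex_of_real (exp (suminf ?s)) = exp (\<Sum>n. complex_of_real (?s n))"
      unfolding bounded_linear.suminf[OF bounded_linear_of_real sum, symmetric] exp_of_real ..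
    also have "\<dots> = complex_of_real ?E"
      unfolding s of_real_gibbs_expect[OF ce(3)] by (rule ce(2))
    \<comment> \<open>Being the exponential of a real number, the expectation is positive, and
      \<open>ln\<close> recovers the sum.\<close>
    finally have E: "exp (suminf ?s) = ?E" by (simp only: of_real_eq_iff)
    show "0 < ?E" unfolding E[symmetric] by simp
    have "ln ?E = suminf ?s" unfolding E[symmetric] by simp
    then show "?s sums ln ?E" using sum by (simp only: summable_sums)
  next
    fix L :: "'a set" and h :: "'a \<Rightarrow> complex"
    assume L: "L \<in> sets borel" "bounded L" and h: "h \<in> borel_measurable borel" "\<forall>x\<in>L. 0 \<le> Re (h x)"
      and fin: "(\<integral>\<^sup>+ x \<in> L. ennreal (cmod (exp (- h x) - 1) * exp (a x)) \<partial>?M) < \<infinity>"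
    have t: "(\<lambda>x. exp (- h x)) \<in> borel_measurable ?M"
      using h(1) by (simp cong: measurable_cong_sets add: sets_M)
    have t1: "norm (exp (- h u)) \<le> 1" if "u \<in> L" for u using h(2) that by simp
    have L': "L \<in> sets ?M" "emeasure ?M L < \<infinity>" using L M_fin sets_M by auto
    have e: "exp (- (\<Sum>j<n. h (x j))) = (\<Prod>j<n. exp (- h (x j)))" for n :: nat and x :: "nat \<Rightarrow> 'a"
      by (simp add: exp_sum flip: sum_negf)
    show "let s = (\<lambda>n. complex_of_real (1 / fact (Suc n)) *
                  (LINT x : (PiE {..<Suc n} (\<lambda>_. L)) | PiM {..<Suc n} (\<lambda>_. weighted lam z).
                     (exp (- (\<Sum>j<Suc n. h (x j))) - 1) * complex_of_real (ursell (mayer v) (Suc n) x)))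
                in summable s \<and>
                   exp (suminf s) = gibbs_expect lam z v L (\<lambda>n x. exp (- (\<Sum>j<n. h (x j))))"
      unfolding Let_def e using cluster_expansion(1,2)[OF L' a_M ub t t1 fin] by (rule conjI)
  qed
qed

end
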